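(* Assume that for $P$-almost every $\omega$, the integrand $h(\cdot,\omega)$ together with the measure $\mu(\omega)$ satisfies: (i) $t\mapsto\operatorname{dom}h_t(\cdot,\omega)$ is left-inner semicontinuous; (ii) for every $x\in X$, $x\in\operatorname{int}L^\infty_\omega(\operatorname{dom}h(\cdot,\omega))\Rightarrow I_h(x,\omega)<\infty\Rightarrow x_t\in\operatorname{cl}\operatorname{dom}h_t(\cdot,\omega)$ for all $t\in[0,T]$; (iii) $I_h(\cdot,\omega)$ is proper on $X$; (iv) $X\cap\operatorname{int}L^\infty_\omega(\operatorname{dom}h(\cdot,\omega))\ne\emptyset$. Assume moreover that there exists $\bar x\in\mathcal{N}^\infty$ with $\bar x\in\operatorname{int}\mathbb{L}^\infty(\operatorname{dom}h)$, and that for every $x\in\operatorname{int}\mathbb{L}^\infty(\operatorname{dom}h)$ there exist $r>0$ and real-valued $\beta\in\mathbb{L}^1$ with $h_t(x_t+x')\le\beta_t$ for all $x'\in\mathbb{B}_r$ ($\eta$-a.e.). Then $$\inf_{x\in\mathcal{N}^\infty}E\int_{[0,T]}h_t(x_t)\,d\mu_t=E\int_{[0,T]}\inf_{x\in\mathbb{R}^d}h_t(x)\,d\mu_t.$$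
   Context: Fix $T>0$, $d\ge1$. $X$: left-continuous $x:\mathbb{R}\to\mathbb{R}^d$ of bounded variation, constant on $(-\infty,0]$ and on $(T,\infty)$. $(\Omega,\mathcal{F},(\mathcal{F}_t)_{t\ge0},P)$: filtered probability space with the usual hypotheses. Predictable (resp. optional) $\sigma$-algebra on $\Omega\times[0,T]$: generated by left- (resp. right-) continuous adapted processes. Optional projection ${}^ov$: the optional process with $E[v_\tau1_{\{\tau<\infty\}}\mid\mathcal{F}_\tau]={}^ov_\tau1_{\{\tau<\infty\}}$ a.s. for all stopping times $\tau$. $\mathcal{N}^\infty$: adapted processes $x$ with $x(\omega)\in X$ a.s. and essentially bounded pathwise total variation. $\mu$: random positive Radon measure on $[0,T]$, a.s. atomless with full support, optional ($E\int v\,d\mu=E\int{}^ov\,d\mu$ for bounded measurable $v$). $\eta(A)=E\int1_Ad\mu$, $\mathbb{L}^p=L^p(\Omega\times[0,T],\mathcal{F}\otimes\mathcal{B}([0,T]),\eta;\mathbb{R}^d)$ ($\mathbb{L}^1$ also used for real-valued functions). $h$: predictable convex normal integrand on $\mathbb{R}^d$ (convex in $x$, $(\omega,t)\mapsto\operatorname{epi}h_t(\cdot,\omega)$ closed-valued and predictably measurable), satisfying $h_t(x,\omega)\ge x\cdot v_t(\omega)-\alpha_t(\omega)$ for some $v\in\mathbb{L}^1$ and nonnegative $\alpha\in\mathbb{L}^1$. $I_h(x,\omega)=\int_{[0,T]}h_t(x_t,\omega)d\mu_t(\omega)$; integrals are $+\infty$ unless the positive part is integrable. $\operatorname{dom}h_t=\{x:h_t(x)<\infty\}$.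 Left-inner semicontinuity: with $\tau$ the topology on $[0,T]$ generated by intervals $(s,t]$, $t\mapsto S_t$ is left-isc if $\{t:S_t\cap A\ne\emptyset\}$ is $\tau$-open for every open $A\subseteq\mathbb{R}^d$. $L^\infty_\omega(S):=\{x\in L^\infty([0,T],\mu(\omega);\mathbb{R}^d): x_t\in S_t\ \mu(\omega)\text{-a.e.}\}$ and $\mathbb{L}^\infty(S):=\{x\in\mathbb{L}^\infty: x\in S\ \eta\text{-a.e.}\}$, interiors in the respective $L^\infty$ norm topologies. $\mathbb{B}_r$ is the closed ball of radius $r$ centered at the origin in $\mathbb{R}^d$. *)

theory Defs
  imports "HOL-Probability.Probability"
begin

definition int_conv :: "'b measure \<Rightarrow> ('b \<Rightarrow> ereal) \<Rightarrow> ereal" where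
  "int_conv N g =
     (let P = (\<integral>\<^sup>+ s. e2ennreal (g s) \<partial>N);
          Q = (\<integral>\<^sup>+ s. e2ennreal (- g s) \<partial>N)
      in if P = \<infinity> then \<infinity> else enn2ereal P - enn2ereal Q)"

definition total_variation :: "(real \<Rightarrow> 'd::real_normed_vector) \<Rightarrow> ereal" where
  "total_variation x =
     (SUP p \<in> {(ts :: nat \<Rightarrow> real, n :: nat). mono ts}.
        ereal (\<Sum>i<snd p. norm (x (fst p (Suc i)) - x (fst p i))))"

definition pathX :: "real \<Rightarrow> (real \<Rightarrow> 'd::real_normed_vector) set" where
  "pathX T = {x. (\<forall>t. continuous (at_left t) x)
               \<and> total_variation x < \<infinity>
               \<and> (\<forall>s. s \<le> 0 \<longrightarrow> x s = x 0)
               \<and> (\<forall>s t. T < s \<longrightarrow> T < t \<longrightarrow> x s = x t)}"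

definition usual_filtration :: "'a measure \<Rightarrow> (real \<Rightarrow> 'a set set) \<Rightarrow> bool" where
  "usual_filtration M F \<longleftrightarrow>
     (\<forall>t\<ge>0. sigma_algebra (space M) (F t) \<and> F t \<subseteq> sets M)
   \<and> (\<forall>s t. 0 \<le> s \<longrightarrow> s \<le> t \<longrightarrow> F s \<subseteq> F t)
   \<and> (\<forall>t\<ge>0. F t = (\<Inter>s\<in>{t<..}. F s))
   \<and> (\<forall>A N. N \<in> sets M \<longrightarrow> emeasure M N = 0 \<longrightarrow> A \<subseteq> N \<longrightarrow> A \<in> F 0)"

definition Fmeas :: "'a measure \<Rightarrow> 'a set set \<Rightarrow> 'a measure" where
  "Fmeas M G = measure_of (space M) G (emeasure M)"

definition adapted_on :: "'a measure \<Rightarrow> (real \<Rightarrow> 'a set set) \<Rightarrow> real set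
    \<Rightarrow> ('a \<Rightarrow> real \<Rightarrow> 'b::topological_space) \<Rightarrow> bool" where
  "adapted_on M F I y \<longleftrightarrow> (\<forall>t\<in>I. (\<lambda>\<omega>. y \<omega> t) \<in> measurable (Fmeas M (F t)) borel)"

definition predictable_sets :: "'a measure \<Rightarrow> (real \<Rightarrow> 'a set set) \<Rightarrow> real \<Rightarrow> ('a \<times> real) set set" where
  "predictable_sets M F T = sigma_sets (space M \<times> {0..T})
     {{p \<in> space M \<times> {0..T}. y (fst p) (snd p) \<in> U} | (y :: 'a \<Rightarrow> real \<Rightarrow> real) U.
        adapted_on M F {0..T} y \<and> (\<forall>\<omega>\<in>space M. \<forall>t\<in>{0<..T}. continuous (at_left t) (y \<omega>))
        \<and> open U}"

definition optional_sets :: "'a measure \<Rightarrow> (real \<Rightarrow> 'a set set) \<Rightarrow> real \<Rightarrow> ('a \<times> real) set set" where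
  "optional_sets M F T = sigma_sets (space M \<times> {0..T})
     {{p \<in> space M \<times> {0..T}. y (fst p) (snd p) \<in> U} | (y :: 'a \<Rightarrow> real \<Rightarrow> real) U.
        adapted_on M F {0..T} y \<and> (\<forall>\<omega>\<in>space M. \<forall>t\<in>{0..<T}. continuous (at_right t) (y \<omega>))
        \<and> open U}"

definition stopping_time_ext :: "'a measure \<Rightarrow> (real \<Rightarrow> 'a set set) \<Rightarrow> ('a \<Rightarrow> ereal) \<Rightarrow> bool" where
  "stopping_time_ext M F \<tau> \<longleftrightarrow>
     (\<forall>\<omega>\<in>space M. 0 \<le> \<tau> \<omega>) \<and> (\<forall>t\<ge>0. {\<omega>\<in>space M. \<tau> \<omega> \<le> ereal t} \<in> F t)"

definition F_infty :: "'a measure \<Rightarrow> (real \<Rightarrow> 'a set set) \<Rightarrow> 'a set set" where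
  "F_infty M F = sigma_sets (space M) (\<Union>t\<in>{0..}. F t)"

definition F_stop :: "'a measure \<Rightarrow> (real \<Rightarrow> 'a set set) \<Rightarrow> ('a \<Rightarrow> ereal) \<Rightarrow> 'a set set" where
  "F_stop M F \<tau> = {A \<in> F_infty M F. \<forall>t\<ge>0. A \<inter> {\<omega>\<in>space M. \<tau> \<omega> \<le> ereal t} \<in> F t}"

text \<open>\<open>u\<close> is an optional projection of the process \<open>v\<close> (both on \<open>\<Omega> \<times> [0,T]\<close>).
  Since processes live on [0,T], stopping times are taken with values in [0,T] \<union> {\<infinity>}.\<close>
definition is_optional_projection :: "'a measure \<Rightarrow> (real \<Rightarrow> 'a set set) \<Rightarrow> real
    \<Rightarrow> ('a \<times> real \<Rightarrow> real) \<Rightarrow> ('a \<times> real \<Rightarrow> real) \<Rightarrow> bool" where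
  "is_optional_projection M F T v u \<longleftrightarrow>
     u \<in> measurable (measure_of (space M \<times> {0..T}) (optional_sets M F T) (\<lambda>_. 0)) borel
   \<and> (\<forall>\<tau>. stopping_time_ext M F \<tau> \<and> (\<forall>\<omega>\<in>space M. \<tau> \<omega> \<le> ereal T \<or> \<tau> \<omega> = \<infinity>) \<longrightarrow>
        (AE \<omega> in M.
           real_cond_exp M (Fmeas M (F_stop M F \<tau>))
             (\<lambda>\<omega>'. if \<tau> \<omega>' < \<infinity> then v (\<omega>', real_of_ereal (\<tau> \<omega>')) else 0) \<omega>
         = (if \<tau> \<omega> < \<infinity> then u (\<omega>, real_of_ereal (\<tau> \<omega>)) else 0)))"

definition eta :: "'a measure \<Rightarrow> ('a \<Rightarrow> real measure) \<Rightarrow> real \<Rightarrow> ('a \<times> real) measure" where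
  "eta M \<mu> T = measure_of (space M \<times> {0..T}) (sets (M \<Otimes>\<^sub>M restrict_space borel {0..T}))
      (\<lambda>A. \<integral>\<^sup>+ \<omega>. emeasure (\<mu> \<omega>) (Pair \<omega> -` A) \<partial>M)"

text \<open>\<open>E \<integral> g d\<mu> = \<integral> g d\<eta>\<close>, with the +infinity convention.\<close>
definition Eint :: "'a measure \<Rightarrow> ('a \<Rightarrow> real measure) \<Rightarrow> real \<Rightarrow> ('a \<Rightarrow> real \<Rightarrow> ereal) \<Rightarrow> ereal" where
  "Eint M \<mu> T g = int_conv (eta M \<mu> T) (\<lambda>p. g (fst p) (snd p))"

definition random_radon_measure :: "'a measure \<Rightarrow> real \<Rightarrow> ('a \<Rightarrow> real measure) \<Rightarrow> bool" where
  "random_radon_measure M T \<mu> \<longleftrightarrow>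
     (\<forall>\<omega>\<in>space M. sets (\<mu> \<omega>) = sets (restrict_space borel {0..T}) \<and> finite_measure (\<mu> \<omega>))
   \<and> (\<forall>A\<in>sets borel. (\<lambda>\<omega>. emeasure (\<mu> \<omega>) (A \<inter> {0..T})) \<in> borel_measurable M)"

definition optional_measure :: "'a measure \<Rightarrow> (real \<Rightarrow> 'a set set) \<Rightarrow> real \<Rightarrow> ('a \<Rightarrow> real measure) \<Rightarrow> bool" where
  "optional_measure M F T \<mu> \<longleftrightarrow>
     (\<forall>v u. v \<in> borel_measurable (M \<Otimes>\<^sub>M restrict_space borel {0..T})
        \<and> (\<exists>B. \<forall>p\<in>space M \<times> {0..T}. \<bar>v p\<bar> \<le> B)
        \<and> is_optional_projection M F T v u
        \<longrightarrow> int_conv (eta M \<mu> T) (\<lambda>p. ereal (v p)) = int_conv (eta M \<mu> T) (\<lambda>p. ereal (u p)))"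

definition Linf :: "'b measure \<Rightarrow> ('b \<Rightarrow> 'd::euclidean_space) set" where
  "Linf N = {y. y \<in> borel_measurable N \<and> esssup N (\<lambda>s. ereal (norm (y s))) < \<infinity>}"

definition Linf_sel :: "'b measure \<Rightarrow> ('b \<Rightarrow> 'd::euclidean_space set) \<Rightarrow> ('b \<Rightarrow> 'd) set" where
  "Linf_sel N S = {y \<in> Linf N. AE s in N. y s \<in> S s}"

definition Linf_int :: "'b measure \<Rightarrow> ('b \<Rightarrow> 'd::euclidean_space set) \<Rightarrow> ('b \<Rightarrow> 'd) set" where
  "Linf_int N S = {x \<in> Linf N. \<exists>r>0. \<forall>y\<in>Linf N.
       esssup N (\<lambda>s. ereal (norm (y s - x s))) < ereal r \<longrightarrow> y \<in> Linf_sel N S}"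

definition epi :: "('d \<Rightarrow> ereal) \<Rightarrow> ('d \<times> real) set" where
  "epi f = {(x, a). f x \<le> ereal a}"

definition predictable_convex_normal_integrand :: "'a measure \<Rightarrow> (real \<Rightarrow> 'a set set) \<Rightarrow> real
    \<Rightarrow> ('a \<Rightarrow> real \<Rightarrow> 'd::euclidean_space \<Rightarrow> ereal) \<Rightarrow> bool" where
  "predictable_convex_normal_integrand M F T h \<longleftrightarrow>
     (\<forall>\<omega>\<in>space M. \<forall>t\<in>{0..T}. convex (epi (h \<omega> t)) \<and> closed (epi (h \<omega> t)))
   \<and> (\<forall>G. open G \<longrightarrow>
        {p \<in> space M \<times> {0..T}. epi (h (fst p) (snd p)) \<inter> G \<noteq> {}} \<in> predictable_sets M F T)"

definition dom_h :: "('d \<Rightarrow> ereal) \<Rightarrow> 'd set" where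
  "dom_h f = {x. f x < \<infinity>}"

definition left_open :: "real \<Rightarrow> real set \<Rightarrow> bool" where
  "left_open T U \<longleftrightarrow> U \<subseteq> {0..T} \<and> (\<forall>t\<in>U. \<exists>s<t. {s<..t} \<inter> {0..T} \<subseteq> U)"

definition left_isc :: "real \<Rightarrow> (real \<Rightarrow> 'd::topological_space set) \<Rightarrow> bool" where
  "left_isc T S \<longleftrightarrow> (\<forall>A. open A \<longrightarrow> left_open T {t \<in> {0..T}. S t \<inter> A \<noteq> {}})"

definition Ninf :: "'a measure \<Rightarrow> (real \<Rightarrow> 'a set set) \<Rightarrow> real \<Rightarrow> ('a \<Rightarrow> real \<Rightarrow> 'd::euclidean_space) set" where
  "Ninf M F T = {x. adapted_on M F {0..} x
                  \<and> (AE \<omega> in M. x \<omega> \<in> pathX T)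
                  \<and> (\<exists>C::real. AE \<omega> in M. total_variation (x \<omega>) \<le> ereal C)}"

end

theory Submission
  imports Defs
begin

text \<open>The inequality \<open>\<ge>\<close> is pointwise. For \<open>\<le>\<close>, left-inner semicontinuity makes the random set of times at
  which a fixed vector \<open>c\<close> lies (with a margin) in the interior of the domain a predictable set \<open>U\<close> with
  left-open paths. For rational \<open>q\<close> let \<open>V = (q, \<tau>]\<close>, where \<open>\<tau>\<close> is the first time after \<open>q\<close> at which
  \<open>\<mu>\<close> starts charging the complement of \<open>U\<close>. Since \<open>\<mu>\<close> is atomless and optional, \<open>\<tau>\<close> is
  read off a continuous adapted process, \<open>V\<close> is contained in \<open>U\<close> up to a null set, and the sets \<open>V\<close> for
  different \<open>q\<close> cover \<open>U\<close>. The process equal to \<open>c\<close> on \<open>V\<close> and to the given interior process off \<open>V\<close> is an interior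
  element of \<open>N\<^sup>\<infinity>\<close>, so its cost is integrable, and the countably many processes obtained in this way have pointwise
  infimum \<open>inf h\<close>. Finitely many of them are pasted along predictable sets whose indicators have
  bounded variation. These form an algebra generating the predictable sets, so the running minima of the costs are
  approximated in \<open>L\<^sup>1\<close>, and monotone convergence concludes.\<close>

section \<open>Paths of bounded variation\<close>

text \<open>The obstacle is that \<open>Ninf\<close> is not stable under arbitrary predictable
  pasting: a measurable near-minimiser has no reason to have bounded variation. Measuring exits by
  mass helps because the mass charged outside \<open>U\<close> increases continuously in time; the
  indicator of its positivity set is then increasing and left continuous, at the price of errors on
  a null set. The covering works because a left-open section contains, with each t > 0, some (q, t]
  with q rational, and time 0 is null. Constants suffice as competitors since convexity lets the
  infimum be approached through the interior of the domain, where a countable dense set is enough.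
  The margin around \<open>c\<close> is what makes the pasted process interior, so that the local
  bound applies to it. Adaptedness of \<mu> is hidden in a duality with optional projections and is
  recovered by testing with an indicator minus its conditional expectation. Since \<eta> may be
  infinite, predictable sets are approximated in finite measures whose density is the gap between
  two costs.\<close>

lemma total_variation_leI:
  assumes "\<And>ts n. mono ts \<Longrightarrow> (\<Sum>i<n. norm (x (ts (Suc i)) - x (ts i))) \<le> C"
  shows "total_variation x \<le> ereal C"
  unfolding total_variation_def by (auto intro!: SUP_least simp: assms)

lemma total_variation_sum_le:
  assumes "total_variation x \<le> ereal C" "mono ts"
  shows "(\<Sum>i<n. norm (x (ts (Suc i)) - x (ts i))) \<le> C"
proof -
  have "ereal (\<Sum>i<n. norm (x (ts (Suc i)) - x (ts i))) \<le> total_variation x"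
    unfolding total_variation_def by (rule SUP_upper2[where i="(ts,n)"]) (auto simp: assms)
  with assms(1) show ?thesis by (meson ereal_less_eq(3) order_trans)
qed

lemma norm_diff_le_total_variation:
  assumes "total_variation x \<le> ereal C"
  shows "norm (x s - x t) \<le> C"
proof -
  let ?ts = "\<lambda>i::nat. if i = 0 then min s t else max s t"
  have "mono ?ts" by (auto simp: mono_def)
  from total_variation_sum_le[OF assms this, of 1] show ?thesis
    by (auto simp: min_def max_def norm_minus_commute split: if_splits)
qed

lemma total_variation_const: "total_variation (\<lambda>_. c) \<le> ereal 0"
  by (rule total_variation_leI) simp

lemma total_variation_mono_01:
  fixes f :: "real \<Rightarrow> real"
  assumes f: "mono f" "\<And>t. f t \<in> {0, 1}"
  shows "total_variation f \<le> ereal 1"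
proof (rule total_variation_leI)
  fix ts :: "nat \<Rightarrow> real" and n assume ts: "mono ts"
  have "(\<Sum>i<n. norm (f (ts (Suc i)) - f (ts i))) = (\<Sum>i<n. f (ts (Suc i)) - f (ts i))"
    using f(1) ts by (intro sum.cong) (auto simp: mono_def)
  also have "\<dots> = f (ts n) - f (ts 0)"
    by (rule sum_lessThan_telescope)
  also have "\<dots> \<le> 1"
    using f(2)[of "ts n"] f(2)[of "ts 0"] by auto
  finally show "(\<Sum>i<n. norm (f (ts (Suc i)) - f (ts i))) \<le> 1" .
qed

text \<open>An increasing 0/1 function can fail left continuity only at a first point where it
  equals 1; the last hypothesis says that there is no first such point.\<close>

lemma left_continuous_mono_01:
  fixes f :: "real \<Rightarrow> real"
  assumes f: "mono f" "\<And>t. f t \<in> {0, 1}" and l: "\<And>t. f t = 1 \<Longrightarrow> \<exists>s<t. f s = 1"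
  shows "continuous (at_left t) f"
proof -
  have "\<exists>b<t. \<forall>s>b. s < t \<longrightarrow> f s = f t"
  proof (cases "f t = 1")
    case True
    then obtain b where b: "b < t" "f b = 1" using l by blast
    have "f s = 1" if "s > b" for s
      using monoD[OF f(1), of b s] that b(2) f(2)[of s] by auto
    with b True show ?thesis by auto
  next
    case False
    then have 0: "f t = 0" using f(2)[of t] by auto
    have "f s = 0" if "s < t" for s
      using monoD[OF f(1), of s t] that 0 f(2)[of s] by auto
    with 0 show ?thesis by (auto intro: exI[of _ "t - 1"])
  qed
  then have "eventually (\<lambda>s. f s = f t) (at_left t)"
    by (simp add: eventually_at_left[of "t - 1" t])
  then show ?thesis
    unfolding continuous_within by (rule tendsto_eventually)
qed

text \<open>A change of \<open>f\<close> switches between the two paths and costs at most their gap,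
  which the sup bounds limit to \<open>K1 + K2\<close>; otherwise the increment is that of one of
  the paths.\<close>

lemma total_variation_paste:
  fixes x z :: "real \<Rightarrow> 'd::real_normed_vector" and f :: "real \<Rightarrow> real"
  assumes x: "total_variation x \<le> ereal C1" "\<And>t. norm (x t) \<le> K1"
    and z: "total_variation z \<le> ereal C2" "\<And>t. norm (z t) \<le> K2"
    and f: "total_variation f \<le> ereal C3" "\<And>t. f t \<in> {0, 1}"
  shows "total_variation (\<lambda>t. f t *\<^sub>R x t + (1 - f t) *\<^sub>R z t) \<le> ereal (C1 + C2 + (K1 + K2) * C3)"
proof (rule total_variation_leI)
  fix ts :: "nat \<Rightarrow> real" and n assume ts: "mono ts"
  let ?w = "\<lambda>t. f t *\<^sub>R x t + (1 - f t) *\<^sub>R z t"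
  have step: "norm (?w u - ?w s) \<le> norm (x u - x s) + norm (z u - z s) + (K1 + K2) * norm (f u - f s)" for u s
  proof -
    have K: "norm (x s - z s) \<le> K1 + K2"
      using norm_triangle_ineq4[of "x s" "z s"] x(2)[of s] z(2)[of s] by linarith
    \<comment> \<open>The path increments carry the weights at \<open>u\<close> and the switch
      carries the gap at \<open>s\<close>, so no product of two increments is left over.\<close>
    have eq: "?w u - ?w s = f u *\<^sub>R (x u - x s) + (1 - f u) *\<^sub>R (z u - z s) + (f u - f s) *\<^sub>R (x s - z s)"
      by (simp add: algebra_simps)
    have "norm (?w u - ?w s) \<le> norm (f u *\<^sub>R (x u - x s)) + norm ((1 - f u) *\<^sub>R (z u - z s))
        + norm ((f u - f s) *\<^sub>R (x s - z s))"
      unfolding eq by (intro norm_triangle_le add_mono order_refl)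
    also have "\<dots> \<le> norm (x u - x s) + norm (z u - z s) + norm (f u - f s) * (K1 + K2)"
      using f(2)[of u] K by (intro add_mono) (auto intro!: mult_left_mono)
    finally show ?thesis by (simp add: mult.commute)
  qed
  have K0: "0 \<le> K1 + K2"
    using norm_ge_zero[of "x 0"] norm_ge_zero[of "z 0"] x(2)[of 0] z(2)[of 0] by linarith
  have "(\<Sum>i<n. norm (?w (ts (Suc i)) - ?w (ts i)))
     \<le> (\<Sum>i<n. norm (x (ts (Suc i)) - x (ts i)) + norm (z (ts (Suc i)) - z (ts i))
          + (K1 + K2) * norm (f (ts (Suc i)) - f (ts i)))"
    by (intro sum_mono step)
  also have "\<dots> = (\<Sum>i<n. norm (x (ts (Suc i)) - x (ts i))) + (\<Sum>i<n. norm (z (ts (Suc i)) - z (ts i)))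
          + (K1 + K2) * (\<Sum>i<n. norm (f (ts (Suc i)) - f (ts i)))"
    by (simp add: sum.distrib sum_distrib_left)
  also have "\<dots> \<le> C1 + C2 + (K1 + K2) * C3"
    using x z f ts K0 by (intro add_mono mult_left_mono total_variation_sum_le)
  finally show "(\<Sum>i<n. norm (?w (ts (Suc i)) - ?w (ts i))) \<le> C1 + C2 + (K1 + K2) * C3" .
qed

lemma pathX_const: "(\<lambda>_. c) \<in> pathX T"
proof -
  have "total_variation (\<lambda>_. c) < \<infinity>"
    by (rule order.strict_trans1[OF total_variation_const]) simp
  then show ?thesis by (simp add: pathX_def)
qed

lemma pathXD:
  assumes "x \<in> pathX T"
  shows "continuous (at_left t) x" "s \<le> 0 \<Longrightarrow> x s = x 0" "T < s \<Longrightarrow> T < t \<Longrightarrow> x s = x t"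
  using assms unfolding pathX_def by blast+

lemma pathX_paste:
  fixes f :: "real \<Rightarrow> real"
  assumes x: "x \<in> pathX T" "total_variation x \<le> ereal C1" "\<And>t. norm (x t) \<le> K1"
    and z: "z \<in> pathX T" "total_variation z \<le> ereal C2" "\<And>t. norm (z t) \<le> K2"
    and f: "f \<in> pathX T" "total_variation f \<le> ereal C3" "\<And>t. f t \<in> {0, 1}"
  shows "(\<lambda>t. f t *\<^sub>R x t + (1 - f t) *\<^sub>R z t) \<in> pathX T"
  unfolding pathX_def mem_Collect_eq
proof (intro conjI allI impI)
  fix t
  have "continuous (at_left t) x" "continuous (at_left t) z" "continuous (at_left t) f"
    by (intro pathXD(1)[OF x(1)] pathXD(1)[OF z(1)] pathXD(1)[OF f(1)])+
  then show "continuous (at_left t) (\<lambda>t. f t *\<^sub>R x t + (1 - f t) *\<^sub>R z t)"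
    by (intro continuous_intros)
next
  show "total_variation (\<lambda>t. f t *\<^sub>R x t + (1 - f t) *\<^sub>R z t) < \<infinity>"
    using total_variation_paste[OF x(2,3) z(2,3) f(2,3)] by (rule order.strict_trans1) simp
next
  fix s :: real assume "s \<le> 0"
  then have "x s = x 0" "z s = z 0" "f s = f 0"
    using \<open>s \<le> 0\<close> pathXD(2)[OF x(1)] pathXD(2)[OF z(1)] pathXD(2)[OF f(1)] by blast+
  then show "f s *\<^sub>R x s + (1 - f s) *\<^sub>R z s = f 0 *\<^sub>R x 0 + (1 - f 0) *\<^sub>R z 0"
    by simp
next
  fix s t assume "T < s" "T < t"
  then have "x s = x t" "z s = z t" "f s = f t"
    using \<open>T < s\<close> \<open>T < t\<close> pathXD(3)[OF x(1)] pathXD(3)[OF z(1)] pathXD(3)[OF f(1)] by blast+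
  then show "f s *\<^sub>R x s + (1 - f s) *\<^sub>R z s = f t *\<^sub>R x t + (1 - f t) *\<^sub>R z t"
    by simp
qed

section \<open>Processes of essentially bounded variation\<close>

text \<open>\<open>Ninf\<close> bounds the variation uniformly in \<omega> but not the values, and
  pasting turns differences of values into jumps; hence the essential bound on the sup norm.\<close>

definition bdd_Ninf :: "'a measure \<Rightarrow> (real \<Rightarrow> 'a set set) \<Rightarrow> real \<Rightarrow> ('a \<Rightarrow> real \<Rightarrow> 'd::euclidean_space) set" where
  "bdd_Ninf M F T = {x \<in> Ninf M F T. \<exists>K::real. AE \<omega> in M. \<forall>t. norm (x \<omega> t) \<le> K}"

lemma bdd_NinfI:
  assumes "adapted_on M F {0..} x" "AE \<omega> in M. x \<omega> \<in> pathX T"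
    "AE \<omega> in M. total_variation (x \<omega>) \<le> ereal C" "AE \<omega> in M. \<forall>t. norm (x \<omega> t) \<le> K"
  shows "x \<in> bdd_Ninf M F T"
  unfolding bdd_Ninf_def Ninf_def mem_Collect_eq
  by (intro conjI assms exI[of _ C] exI[of _ K])

lemma bdd_NinfE:
  assumes "x \<in> bdd_Ninf M F T"
  obtains C K where "adapted_on M F {0..} x" "AE \<omega> in M. x \<omega> \<in> pathX T"
    "AE \<omega> in M. total_variation (x \<omega>) \<le> ereal C" "AE \<omega> in M. \<forall>t. norm (x \<omega> t) \<le> K"
  using assms unfolding bdd_Ninf_def Ninf_def mem_Collect_eq by (elim conjE exE)

lemma bdd_Ninf_paste:
  assumes x: "x \<in> bdd_Ninf M F T" and z: "z \<in> bdd_Ninf M F T"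
    and f: "f \<in> bdd_Ninf M F T" "\<And>\<omega> t. f \<omega> t \<in> {0, 1::real}"
  shows "(\<lambda>\<omega> t. f \<omega> t *\<^sub>R x \<omega> t + (1 - f \<omega> t) *\<^sub>R z \<omega> t) \<in> bdd_Ninf M F T"
proof -
  let ?w = "\<lambda>\<omega> t. f \<omega> t *\<^sub>R x \<omega> t + (1 - f \<omega> t) *\<^sub>R z \<omega> t"
  obtain C1 K1 where x': "adapted_on M F {0..} x" "AE \<omega> in M. x \<omega> \<in> pathX T"
    "AE \<omega> in M. total_variation (x \<omega>) \<le> ereal C1" "AE \<omega> in M. \<forall>t. norm (x \<omega> t) \<le> K1"
    by (rule bdd_NinfE[OF x])
  obtain C2 K2 where z': "adapted_on M F {0..} z" "AE \<omega> in M. z \<omega> \<in> pathX T"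
    "AE \<omega> in M. total_variation (z \<omega>) \<le> ereal C2" "AE \<omega> in M. \<forall>t. norm (z \<omega> t) \<le> K2"
    by (rule bdd_NinfE[OF z])
  obtain C3 K3 where f': "adapted_on M F {0..} f" "AE \<omega> in M. f \<omega> \<in> pathX T"
    "AE \<omega> in M. total_variation (f \<omega>) \<le> ereal C3" "AE \<omega> in M. \<forall>t. norm (f \<omega> t) \<le> K3"
    by (rule bdd_NinfE[OF f(1)])
  show ?thesis
  proof (rule bdd_NinfI)
    show "adapted_on M F {0..} ?w"
      unfolding adapted_on_def
    proof
      fix t :: real assume t: "t \<in> {0..}"
      have [measurable]: "(\<lambda>\<omega>. x \<omega> t) \<in> borel_measurable (Fmeas M (F t))"
        "(\<lambda>\<omega>. z \<omega> t) \<in> borel_measurable (Fmeas M (F t))" "(\<lambda>\<omega>. f \<omega> t) \<in> borel_measurable (Fmeas M (F t))"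
        using x'(1) z'(1) f'(1) t by (simp_all add: adapted_on_def)
      show "(\<lambda>\<omega>. ?w \<omega> t) \<in> borel_measurable (Fmeas M (F t))"
        by measurable
    qed
    show "AE \<omega> in M. ?w \<omega> \<in> pathX T"
      using x'(2-4) z'(2-4) f'(2,3)
    proof eventually_elim
      case (elim \<omega>)
      show ?case
        by (rule pathX_paste[OF elim(1,2) spec[OF elim(3)] elim(4,5) spec[OF elim(6)] elim(7,8) f(2)])
    qed
    show "AE \<omega> in M. total_variation (?w \<omega>) \<le> ereal (C1 + C2 + (K1 + K2) * C3)"
      using x'(3,4) z'(3,4) f'(3)
    proof eventually_elim
      case (elim \<omega>)
      show ?case
        by (rule total_variation_paste[OF elim(1) spec[OF elim(2)] elim(3) spec[OF elim(4)] elim(5) f(2)])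
    qed
    show "AE \<omega> in M. \<forall>t. norm (?w \<omega> t) \<le> max K1 K2"
      using x'(4) z'(4)
    proof eventually_elim
      case (elim \<omega>)
      have "norm (?w \<omega> t) \<le> max K1 K2" for t
        using f(2)[of \<omega> t] elim(1)[rule_format, of t] elim(2)[rule_format, of t] by auto
      then show ?case by blast
    qed
  qed
qed

lemma bdd_Ninf_mono_01:
  fixes f :: "'a \<Rightarrow> real \<Rightarrow> real"
  assumes ad: "adapted_on M F {0..} f" and f01: "\<And>\<omega> t. f \<omega> t \<in> {0, 1}"
    and ae: "AE \<omega> in M. mono (f \<omega>) \<and> (\<forall>t. f \<omega> t = 1 \<longrightarrow> (\<exists>s<t. f \<omega> s = 1))
        \<and> (\<forall>t\<le>0. f \<omega> t = f \<omega> 0) \<and> (\<forall>s t. T < s \<longrightarrow> T < t \<longrightarrow> f \<omega> s = f \<omega> t)"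
  shows "f \<in> bdd_Ninf M F T"
proof -
  have tv: "AE \<omega> in M. total_variation (f \<omega>) \<le> ereal 1"
    using ae
  proof eventually_elim
    case (elim \<omega>)
    then show ?case by (intro total_variation_mono_01 f01) simp
  qed
  have pX: "AE \<omega> in M. f \<omega> \<in> pathX T"
    using ae tv
  proof eventually_elim
    case (elim \<omega>)
    then have "continuous (at_left t) (f \<omega>)" for t
      by (intro left_continuous_mono_01 f01) simp_all
    moreover have "total_variation (f \<omega>) < \<infinity>"
      using elim(2) by (rule order.strict_trans1) simp
    ultimately show ?case
      using elim(1) unfolding pathX_def by blast
  qed
  have "norm (f \<omega> t) \<le> 1" for \<omega> t
    using f01[of \<omega> t] by auto
  then show ?thesis
    by (intro bdd_NinfI[OF ad pX tv, of 1]) simp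
qed

lemma bdd_Ninf_const: "(\<lambda>_ _. c) \<in> bdd_Ninf M F T"
proof (rule bdd_NinfI)
  show "adapted_on M F {0..} (\<lambda>_ _. c)" by (simp add: adapted_on_def)
qed (auto intro: pathX_const total_variation_const)

section \<open>The predictable sigma-algebra\<close>

locale filtered_prob_space = prob_space M for M :: "'a measure" +
  fixes F :: "real \<Rightarrow> 'a set set" and T :: real
  assumes usual: "usual_filtration M F" and T_pos: "0 < T"
begin

section \<open>Consequences of the usual hypotheses\<close>

lemma sigma_algebra_F: "0 \<le> t \<Longrightarrow> sigma_algebra (space M) (F t)"
  and F_subset: "0 \<le> t \<Longrightarrow> F t \<subseteq> sets M"
  and F_mono: "0 \<le> s \<Longrightarrow> s \<le> t \<Longrightarrow> F s \<subseteq> F t"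
  using usual[unfolded usual_filtration_def, THEN conjunct1]
    usual[unfolded usual_filtration_def, THEN conjunct2, THEN conjunct1] by simp_all

lemma space_Fmeas [simp]: "space (Fmeas M G) = space M"
  unfolding Fmeas_def by (rule space_measure_of_conv)

lemma sets_Fmeas: "0 \<le> t \<Longrightarrow> sets (Fmeas M (F t)) = F t"
  unfolding Fmeas_def
  by (simp add: sigma_algebra.sets_measure_of_eq[OF sigma_algebra_F])

lemma null_set_in_F:
  assumes "N \<in> null_sets M" "A \<subseteq> N" "0 \<le> t"
  shows "A \<in> F t"
proof -
  have "N \<in> sets M" "emeasure M N = 0" using assms(1) by auto
  then have "A \<in> F 0"
    using usual[unfolded usual_filtration_def, THEN conjunct2, THEN conjunct2, THEN conjunct2] assms(2)
    by blast
  then show ?thesis using F_mono[OF order_refl assms(3)] by (rule subsetD[rotated])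
qed

lemma subset_F_measurable:
  assumes f: "f \<in> measurable (Fmeas M (F s)) N" and "0 \<le> s" and L: "space L = space M" "F s \<subseteq> sets L"
  shows "f \<in> measurable L N"
proof (rule measurableI)
  show "f x \<in> space N" if "x \<in> space L" for x
    using measurable_space[OF f] that L(1) by simp
  show "f -` A \<inter> space L \<in> sets L" if "A \<in> sets N" for A
    using measurable_sets[OF f that] L by (auto simp: sets_Fmeas \<open>0 \<le> s\<close>)
qed

lemma measurable_Fmeas_M:
  assumes "f \<in> measurable (Fmeas M (F s)) N" "0 \<le> s"
  shows "f \<in> measurable M N"
  using assms F_subset[of s] by (intro subset_F_measurable[OF assms]) simp_all

text \<open>Completeness of the filtration: every subset of a null set lies in \<open>F 0\<close>,
  so correcting an event by such subsets, themselves possibly outside the original sigma-algebra of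
  interest, keeps it in \<open>F t\<close>.\<close>

lemma AE_eq_in_F:
  assumes B: "B \<in> F t" and A: "A \<subseteq> space M" and ae: "AE \<omega> in M. \<omega> \<in> A \<longleftrightarrow> \<omega> \<in> B" and t: "0 \<le> t"
  shows "A \<in> F t"
proof -
  obtain N where N: "N \<in> null_sets M" "{\<omega>\<in>space M. \<not> (\<omega> \<in> A \<longleftrightarrow> \<omega> \<in> B)} \<subseteq> N"
    using ae by (rule AE_E3) blast
  interpret sa: sigma_algebra "space M" "F t" by (rule sigma_algebra_F[OF t])
  have "A - B \<in> F t" "B - A \<in> F t"
    using N A sa.sets_into_space[OF B] by (auto intro!: null_set_in_F[OF N(1) _ t])
  moreover have "A = (B - (B - A)) \<union> (A - B)" by auto
  ultimately show ?thesis using B by (metis sa.Un sa.Diff)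
qed

lemma AE_eq_measurable_Fmeas:
  fixes f :: "'a \<Rightarrow> 'b::topological_space"
  assumes g: "g \<in> borel_measurable (Fmeas M (F t))" and ae: "AE \<omega> in M. f \<omega> = g \<omega>" and t: "0 \<le> t"
  shows "f \<in> borel_measurable (Fmeas M (F t))"
proof (rule borel_measurableI)
  fix S :: "'b set" assume "open S"
  then have "g -` S \<inter> space M \<in> F t"
    using measurable_sets[OF g, of S] by (simp add: sets_Fmeas[OF t])
  then have "f -` S \<inter> space M \<in> F t"
    by (rule AE_eq_in_F) (use ae t in \<open>auto elim!: eventually_mono\<close>)
  then show "f -` S \<inter> space (Fmeas M (F t)) \<in> sets (Fmeas M (F t))"
    by (simp add: sets_Fmeas[OF t])
qed

section \<open>Predictable sets and their generating rectangles\<close>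

definition Pred :: "('a \<times> real) measure" where
  "Pred = measure_of (space M \<times> {0..T}) (predictable_sets M F T) (\<lambda>_. 0)"

lemma sigma_algebra_predictable: "sigma_algebra (space M \<times> {0..T}) (predictable_sets M F T)"
  unfolding predictable_sets_def by (rule sigma_algebra_sigma_sets) auto

lemma space_Pred: "space Pred = space M \<times> {0..T}"
  unfolding Pred_def by (rule space_measure_of_conv)

lemma sets_Pred: "sets Pred = predictable_sets M F T"
  unfolding Pred_def by (rule sigma_algebra.sets_measure_of_eq[OF sigma_algebra_predictable])

lemma left_continuous_predictable_set:
  fixes y :: "'a \<Rightarrow> real \<Rightarrow> real"
  assumes "adapted_on M F {0..T} y" "\<And>\<omega> t. \<omega> \<in> space M \<Longrightarrow> t \<in> {0<..T} \<Longrightarrow> continuous (at_left t) (y \<omega>)"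
    "open U"
  shows "{p \<in> space M \<times> {0..T}. y (fst p) (snd p) \<in> U} \<in> predictable_sets M F T"
  unfolding predictable_sets_def using assms by (intro sigma_sets.Basic) blast

lemma left_continuous_measurable_Pred:
  fixes y :: "'a \<Rightarrow> real \<Rightarrow> 'd::euclidean_space"
  assumes y: "adapted_on M F {0..T} y" "\<And>\<omega> t. \<omega> \<in> space M \<Longrightarrow> t \<in> {0<..T} \<Longrightarrow> continuous (at_left t) (y \<omega>)"
  shows "(\<lambda>p. y (fst p) (snd p)) \<in> borel_measurable Pred"
proof -
  have "(\<lambda>p. y (fst p) (snd p) \<bullet> b) \<in> borel_measurable Pred" for b
  proof (rule borel_measurableI)
    fix U :: "real set" assume U: "open U"
    have ad: "adapted_on M F {0..T} (\<lambda>\<omega> t. y \<omega> t \<bullet> b)"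
      using y(1) by (auto simp: adapted_on_def)
    have "continuous (at_left t) (\<lambda>t. y \<omega> t \<bullet> b)" if "\<omega> \<in> space M" "t \<in> {0<..T}" for \<omega> t
      using y(2)[OF that] by (intro continuous_intros)
    from left_continuous_predictable_set[OF ad this U]
    have "{p \<in> space M \<times> {0..T}. y (fst p) (snd p) \<bullet> b \<in> U} \<in> predictable_sets M F T"
      by simp
    also have "{p \<in> space M \<times> {0..T}. y (fst p) (snd p) \<bullet> b \<in> U}
        = (\<lambda>p. y (fst p) (snd p) \<bullet> b) -` U \<inter> space Pred"
      by (auto simp: space_Pred)
    finally show "(\<lambda>p. y (fst p) (snd p) \<bullet> b) -` U \<inter> space Pred \<in> sets Pred"
      by (simp add: sets_Pred)
  qed
  then show ?thesis
    by (subst borel_measurable_euclidean_space) blast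
qed

text \<open>The customary generators live on {0} and on intervals (s, u]. Prolonging them to
  \<open>T\<close> makes their indicators increasing in time, so \<open>bv_sets_mono_01\<close>
  covers them; the customary ones come back as differences.\<close>

definition rects :: "('a \<times> real) set set" where
  "rects = {A \<times> {0..T} | A. A \<in> F 0} \<union> {A \<times> {s<..T} | A s. 0 \<le> s \<and> s \<le> T \<and> A \<in> F s}"

lemma rects_Pow: "rects \<subseteq> Pow (space M \<times> {0..T})"
proof -
  have "A \<subseteq> space M" if "A \<in> F s" "0 \<le> s" for A s
    using that F_subset sets.sets_into_space by blast
  then show ?thesis unfolding rects_def by force
qed

text \<open>The last grid point strictly before \<open>t\<close>: ceiling minus one, unlike the
  floor, also steps back from grid points, so only left limits are used. Time 0 is its own grid
  point.\<close>

definition left_grid :: "nat \<Rightarrow> real \<Rightarrow> real" where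
  "left_grid n t = (if t \<le> 0 then 0 else (real_of_int \<lceil>t * real (Suc n)\<rceil> - 1) / real (Suc n))"

lemma left_grid_bounds:
  assumes "0 < t"
  shows "0 \<le> left_grid n t" "left_grid n t < t" "t - 1 / real (Suc n) \<le> left_grid n t"
proof -
  have 1: "real_of_int \<lceil>t * real (Suc n)\<rceil> - 1 < t * real (Suc n)"
    "t * real (Suc n) \<le> real_of_int \<lceil>t * real (Suc n)\<rceil>" by linarith+
  have pos: "0 < t * real (Suc n)" using assms by simp
  then have "1 \<le> \<lceil>t * real (Suc n)\<rceil>" by linarith
  then show "0 \<le> left_grid n t" using assms by (simp add: left_grid_def)
  show "left_grid n t < t"
    using 1(1) assms by (simp add: left_grid_def divide_less_eq del: of_nat_Suc)
  show "t - 1 / real (Suc n) \<le> left_grid n t"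
    using 1(2) assms by (simp add: left_grid_def field_simps del: of_nat_Suc)
qed

lemma left_grid_eq_iff:
  assumes "0 < t"
  shows "left_grid n t = real k / real (Suc n) \<longleftrightarrow> t \<in> {real k / real (Suc n) <.. real (Suc k) / real (Suc n)}"
proof -
  have "left_grid n t = real k / real (Suc n) \<longleftrightarrow> \<lceil>t * real (Suc n)\<rceil> = int k + 1"
    using assms by (simp add: left_grid_def field_simps del: of_nat_Suc) linarith
  also have "\<dots> \<longleftrightarrow> real k < t * real (Suc n) \<and> t * real (Suc n) \<le> real (Suc k)"
    by (simp add: ceiling_eq_iff add.commute)
  also have "\<dots> \<longleftrightarrow> t \<in> {real k / real (Suc n) <.. real (Suc k) / real (Suc n)}"
    by (simp add: divide_less_eq le_divide_eq add.commute)
  finally show ?thesis .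
qed

lemma left_grid_nat:
  assumes "0 < t"
  obtains k where "left_grid n t = real k / real (Suc n)"
proof -
  have "0 < t * real (Suc n)" using assms by simp
  then have "1 \<le> \<lceil>t * real (Suc n)\<rceil>" by linarith
  then have "real_of_int \<lceil>t * real (Suc n)\<rceil> - 1 = real (nat (\<lceil>t * real (Suc n)\<rceil> - 1))" by simp
  then have "left_grid n t = real (nat (\<lceil>t * real (Suc n)\<rceil> - 1)) / real (Suc n)"
    using assms by (simp only: left_grid_def) simp
  then show ?thesis by (rule that)
qed

lemma left_grid_tendsto:
  assumes "0 < t" "continuous (at_left t) (y :: real \<Rightarrow> real)"
  shows "(\<lambda>n. y (left_grid n t)) \<longlonglongrightarrow> y t"
proof -
  have "(\<lambda>n. t - 1 / real (Suc n)) \<longlonglongrightarrow> t - 0"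
    by (intro tendsto_intros LIMSEQ_Suc lim_1_over_n)
  then have lim: "(\<lambda>n. t - 1 / real (Suc n)) \<longlonglongrightarrow> t" by simp
  have "(\<lambda>n. left_grid n t) \<longlonglongrightarrow> t"
  proof (rule tendsto_sandwich[rotated 2, of "\<lambda>n. t - 1 / real (Suc n)" t _ "\<lambda>_. t"])
    show "\<forall>\<^sub>F n in sequentially. t - 1 / real (Suc n) \<le> left_grid n t"
      using left_grid_bounds(3)[OF assms(1)] by (intro always_eventually allI)
    show "\<forall>\<^sub>F n in sequentially. left_grid n t \<le> t"
      using left_grid_bounds(2)[OF assms(1)] by (intro always_eventually allI less_imp_le)
  qed (use lim in simp_all)
  then have "filterlim (\<lambda>n. left_grid n t) (at_left t) sequentially"
    using left_grid_bounds(2)[OF assms(1)] by (intro filterlim_at_withinI) (auto intro!: always_eventually less_imp_neq)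
  with assms(2) show ?thesis
    unfolding continuous_within by (rule filterlim_compose)
qed

text \<open>On the cell (k/(n+1), (k+1)/(n+1)] the process is frozen at its value at the left end,
  an event known at that time. The preimage over the cell is therefore a difference of two
  rectangles.\<close>

lemma rects_step_measurable:
  fixes y :: "'a \<Rightarrow> real \<Rightarrow> real"
  assumes y: "adapted_on M F {0..T} y"
  shows "(\<lambda>p. y (fst p) (left_grid n (snd p))) \<in> borel_measurable (sigma (space M \<times> {0..T}) rects)"
    (is "?f \<in> borel_measurable ?R")
proof (rule borel_measurableI)
  fix U :: "real set" assume U: "open U"
  have sR: "space ?R = space M \<times> {0..T}" by (simp add: space_measure_of_conv)
  have in_R: "B \<in> sets ?R" if "B \<in> rects" for B
    using that rects_Pow by (simp add: sets_measure_of)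
  define A where "A s = {\<omega>\<in>space M. y \<omega> s \<in> U}" for s
  have A: "A s \<in> F s" if "s \<in> {0..T}" for s
  proof -
    have "(\<lambda>\<omega>. y \<omega> s) -` U \<inter> space (Fmeas M (F s)) \<in> sets (Fmeas M (F s))"
      using y that U by (intro measurable_sets[of _ _ borel]) (auto simp: adapted_on_def)
    moreover have "(\<lambda>\<omega>. y \<omega> s) -` U \<inter> space M = A s"
      by (auto simp: A_def)
    ultimately show ?thesis using that by (simp add: sets_Fmeas)
  qed
  let ?g = "\<lambda>k. real k / real (Suc n)"
  let ?K = "{k. ?g k \<le> T}"
  \<comment> \<open>The start \<open>u\<close> may be later than the observation time
    \<open>s\<close>, as \<open>F\<close> increases, and may lie past the horizon, where the
    rectangle is empty. Both happen at the upper end of a grid cell.\<close>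
  have S: "A s \<times> {u<..T} \<in> sets ?R" if "0 \<le> s" "s \<le> u" "s \<le> T" for s u
  proof (cases "u \<le> T")
    case True
    have "A s \<in> F u" using that A[of s] F_mono[of s u] by auto
    moreover have "0 \<le> u" using that by simp
    ultimately have "A s \<times> {u<..T} \<in> rects" using True unfolding rects_def by blast
    then show ?thesis by (rule in_R)
  next
    case False then have "{u<..T} = {}" by auto
    then show ?thesis by simp
  qed
  have 0: "A 0 \<times> {0} \<in> sets ?R"
  proof -
    have "A 0 \<times> {0..T} \<in> sets ?R"
      using A[of 0] T_pos by (intro in_R) (simp add: rects_def, blast)
    then have "A 0 \<times> {0..T} - A 0 \<times> {0<..T} \<in> sets ?R"
      using S[of 0 0] T_pos by (intro sets.Diff) simp_all
    also have "A 0 \<times> {0..T} - A 0 \<times> {0<..T} = A 0 \<times> {0}" using T_pos by auto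
    finally show ?thesis .
  qed
  have "?f -` U \<inter> space ?R = A 0 \<times> {0} \<union> (\<Union>k\<in>?K. A (?g k) \<times> {?g k<..T} - A (?g k) \<times> {?g (Suc k)<..T})"
    (is "?l = ?r")
  proof (intro set_eqI iffI)
    fix p assume p: "p \<in> ?l"
    obtain \<omega> t where pt: "p = (\<omega>, t)" by (cases p)
    have \<omega>: "\<omega> \<in> space M" "0 \<le> t" "t \<le> T" "y \<omega> (left_grid n t) \<in> U"
      using p by (auto simp: sR pt)
    show "p \<in> ?r"
    proof (cases "t = 0")
      case True
      then show ?thesis using \<omega> by (auto simp: pt A_def left_grid_def)
    next
      case False
      then have t: "0 < t" using \<omega>(2) by simp
      obtain k where k: "left_grid n t = ?g k" using left_grid_nat[OF t] .
      then have k': "t \<in> {?g k<..?g (Suc k)}" using left_grid_eq_iff[OF t] by blast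
      have "p \<in> A (?g k) \<times> {?g k<..T} - A (?g k) \<times> {?g (Suc k)<..T}"
        using \<omega> k' k by (auto simp: pt A_def)
      moreover have "k \<in> ?K" using k' \<omega>(3) by auto
      ultimately show ?thesis by blast
    qed
  next
    fix p assume p: "p \<in> ?r"
    obtain \<omega> t where pt: "p = (\<omega>, t)" by (cases p)
    show "p \<in> ?l"
    proof (cases "p \<in> A 0 \<times> {0}")
      case True
      then show ?thesis using T_pos by (auto simp: pt sR A_def left_grid_def)
    next
      case False
      then obtain k where k: "\<omega> \<in> A (?g k)" "t \<in> {?g k<..?g (Suc k)}" "t \<le> T"
        using p pt by auto
      have "0 \<le> ?g k" by simp
      then have t: "0 < t" using k(2) by (meson greaterThanAtMost_iff order_le_less_trans)
      then have "left_grid n t = ?g k" using k(2) left_grid_eq_iff[OF t] by blast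
      then show ?thesis using k t by (auto simp: pt sR A_def)
    qed
  qed
  moreover have "?r \<in> sets ?R"
  proof (intro sets.Un 0 sets.countable_UN'')
    fix k assume "k \<in> ?K"
    then have k: "?g k \<le> T" by simp
    show "A (?g k) \<times> {?g k<..T} - A (?g k) \<times> {?g (Suc k)<..T} \<in> sets ?R"
      using k by (intro sets.Diff S order_refl divide_right_mono) simp_all
  qed simp
  ultimately show "?f -` U \<inter> space ?R \<in> sets ?R" by simp
qed

text \<open>Left continuity makes each generating process the pointwise limit of its frozen grid
  versions.\<close>

lemma predictable_sets_subset_rects: "predictable_sets M F T \<subseteq> sigma_sets (space M \<times> {0..T}) rects"
proof -
  let ?R = "sigma (space M \<times> {0..T}) rects"
  have sR: "space ?R = space M \<times> {0..T}" by (simp add: space_measure_of_conv)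
  have setsR: "sets ?R = sigma_sets (space M \<times> {0..T}) rects"
    using rects_Pow by (simp add: sets_measure_of)
  have "{p \<in> space M \<times> {0..T}. y (fst p) (snd p) \<in> U} \<in> sets ?R"
    if y: "adapted_on M F {0..T} y" "\<forall>\<omega>\<in>space M. \<forall>t\<in>{0<..T}. continuous (at_left t) (y \<omega>)"
      and U: "open U" for y :: "'a \<Rightarrow> real \<Rightarrow> real" and U
  proof -
    have "(\<lambda>p. y (fst p) (snd p)) \<in> borel_measurable ?R"
    proof (rule borel_measurable_LIMSEQ_real)
      show "(\<lambda>p. y (fst p) (left_grid n (snd p))) \<in> borel_measurable ?R" for n
        by (rule rects_step_measurable[OF y(1)])
      fix p assume "p \<in> space ?R"
      then have p: "fst p \<in> space M" "0 \<le> snd p" "snd p \<le> T" by (auto simp: sR)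
      show "(\<lambda>n. y (fst p) (left_grid n (snd p))) \<longlonglongrightarrow> y (fst p) (snd p)"
      proof (cases "snd p = 0")
        case True then show ?thesis by (simp add: left_grid_def)
      next
        case False
        then show ?thesis using p y(2) by (intro left_grid_tendsto) auto
      qed
    qed
    from measurable_sets[OF this, of U] U
    have "(\<lambda>p. y (fst p) (snd p)) -` U \<inter> space ?R \<in> sets ?R" by simp
    also have "(\<lambda>p. y (fst p) (snd p)) -` U \<inter> space ?R = {p \<in> space M \<times> {0..T}. y (fst p) (snd p) \<in> U}"
      by (auto simp: sR)
    finally show ?thesis .
  qed
  then have "{{p \<in> space M \<times> {0..T}. y (fst p) (snd p) \<in> U} | (y :: 'a \<Rightarrow> real \<Rightarrow> real) U.
        adapted_on M F {0..T} y \<and> (\<forall>\<omega>\<in>space M. \<forall>t\<in>{0<..T}. continuous (at_left t) (y \<omega>))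
        \<and> open U} \<subseteq> sets ?R"
    by blast
  from sets.sigma_sets_subset[OF this] show ?thesis
    by (simp only: predictable_sets_def setsR sR)
qed

text \<open>Sets along which processes can be pasted inside \<open>bdd_Ninf\<close>. Predictability
  is demanded separately because the path properties of \<open>f\<close> hold only almost surely,
  whereas \<open>f\<close> represents \<open>B\<close> for every \<omega>.\<close>

definition bv_sets :: "('a \<times> real) set set" where
  "bv_sets = {B \<in> predictable_sets M F T. \<exists>f\<in>bdd_Ninf M F T. (\<forall>\<omega> t. f \<omega> t \<in> {0, 1::real})
     \<and> (\<forall>\<omega>\<in>space M. \<forall>t\<in>{0..T}. (\<omega>, t) \<in> B \<longleftrightarrow> f \<omega> t = 1)}"

lemma bv_setsI:
  assumes "B \<in> predictable_sets M F T" "f \<in> bdd_Ninf M F T" "\<And>\<omega> t. f \<omega> t \<in> {0, 1::real}"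
    "\<And>\<omega> t. \<omega> \<in> space M \<Longrightarrow> t \<in> {0..T} \<Longrightarrow> (\<omega>, t) \<in> B \<longleftrightarrow> f \<omega> t = 1"
  shows "B \<in> bv_sets"
  unfolding bv_sets_def by (simp, intro conjI bexI[of _ f]) (use assms in auto)

lemma bv_setsE:
  assumes "B \<in> bv_sets"
  obtains f where "B \<in> predictable_sets M F T" "f \<in> bdd_Ninf M F T" "\<forall>\<omega> t. f \<omega> t \<in> {0, 1::real}"
    "\<forall>\<omega>\<in>space M. \<forall>t\<in>{0..T}. (\<omega>, t) \<in> B \<longleftrightarrow> f \<omega> t = 1"
  using assms unfolding bv_sets_def by blast

lemma bv_sets_mono_01:
  fixes f :: "'a \<Rightarrow> real \<Rightarrow> real"
  assumes ad: "adapted_on M F {0..} f" and f01: "\<And>\<omega> t. f \<omega> t \<in> {0, 1}"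
    and mono: "\<And>\<omega>. mono (f \<omega>)" and left: "\<And>\<omega> t. f \<omega> t = 1 \<Longrightarrow> \<exists>s<t. f \<omega> s = 1"
    and 0: "\<And>\<omega> t. t \<le> 0 \<Longrightarrow> f \<omega> t = f \<omega> 0" and T: "\<And>\<omega> s t. T < s \<Longrightarrow> T < t \<Longrightarrow> f \<omega> s = f \<omega> t"
  shows "{p \<in> space M \<times> {0..T}. f (fst p) (snd p) = 1} \<in> bv_sets"
proof -
  have ad': "adapted_on M F {0..T} f" using ad by (auto simp: adapted_on_def)
  \<comment> \<open>The generators are preimages of open sets; for a 0/1 process the open half-line
    above 1/2 singles out the value 1.\<close>
  have "{p \<in> space M \<times> {0..T}. f (fst p) (snd p) \<in> {1/2<..}} \<in> predictable_sets M F T"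
    by (intro left_continuous_predictable_set ad' left_continuous_mono_01 mono f01 left) simp_all
  moreover have "f \<omega> t \<in> {1/2<..} \<longleftrightarrow> f \<omega> t = 1" for \<omega> t
    using f01[of \<omega> t] by auto
  ultimately have "{p \<in> space M \<times> {0..T}. f (fst p) (snd p) = 1} \<in> predictable_sets M F T" by simp
  moreover have "f \<in> bdd_Ninf M F T"
    by (rule bdd_Ninf_mono_01[OF ad f01]) (use mono left 0 T in blast)
  ultimately show ?thesis
    by (rule bv_setsI[OF _ _ f01]) simp
qed

lemma rects_bv_sets: "rects \<subseteq> bv_sets"
proof
  fix B assume "B \<in> rects"
  then consider A where "A \<in> F 0" "B = A \<times> {0..T}"
    | A s where "0 \<le> s" "s \<le> T" "A \<in> F s" "B = A \<times> {s<..T}"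
    unfolding rects_def by blast
  then show "B \<in> bv_sets"
  proof cases
    case 1
    have A: "A \<subseteq> space M" using 1(1) F_subset[of 0] sets.sets_into_space[of A M] by auto
    have "{p \<in> space M \<times> {0..T}. (indicator A (fst p) :: real) = 1} \<in> bv_sets"
    proof (rule bv_sets_mono_01[of "\<lambda>\<omega> t. indicator A \<omega>"])
      show "adapted_on M F {0..} (\<lambda>\<omega> t. indicator A \<omega> :: real)"
        unfolding adapted_on_def
        using 1(1) by (auto intro!: borel_measurable_indicator simp: sets_Fmeas dest: subsetD[OF F_mono[OF order_refl]])
      show "\<exists>s<t. (indicator A \<omega> :: real) = 1" if "(indicator A \<omega> :: real) = 1" for \<omega> and t :: real
        using that by (auto intro: exI[of _ "t - 1"])
    qed (auto simp: mono_def indicator_def)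
    also have "{p \<in> space M \<times> {0..T}. (indicator A (fst p) :: real) = 1} = B"
      using A 1(2) by (auto simp: indicator_def)
    finally show ?thesis .
  next
    case 2
    have A: "A \<subseteq> space M" using 2(1,3) F_subset[of s] sets.sets_into_space[of A M] by auto
    let ?f = "\<lambda>\<omega> t. if t > s then indicator A \<omega> else (0 :: real)"
    have "{p \<in> space M \<times> {0..T}. ?f (fst p) (snd p) = 1} \<in> bv_sets"
    proof (rule bv_sets_mono_01)
      show "adapted_on M F {0..} ?f"
        unfolding adapted_on_def
      proof
        fix t :: real assume "t \<in> {0..}"
        then show "(\<lambda>\<omega>. ?f \<omega> t) \<in> borel_measurable (Fmeas M (F t))"
          using 2(1,3) F_mono[of s t]
          by (cases "s < t") (auto intro!: borel_measurable_indicator simp: sets_Fmeas)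
      qed
      show "\<exists>r<t. ?f \<omega> r = 1" if "?f \<omega> t = 1" for \<omega> t
        using that dense[of s t] by (auto split: if_splits)
    qed (use 2(1,2) in \<open>auto simp: mono_def indicator_def\<close>)
    also have "{p \<in> space M \<times> {0..T}. ?f (fst p) (snd p) = 1} = B"
      using A 2 by (auto simp: indicator_def split: if_splits)
    finally show ?thesis .
  qed
qed

section \<open>The algebra of pasting sets and its density in the predictable sets\<close>

lemma bv_sets_Compl:
  assumes "B \<in> bv_sets"
  shows "space M \<times> {0..T} - B \<in> bv_sets"
proof -
  obtain f where f0: "B \<in> predictable_sets M F T" "f \<in> bdd_Ninf M F T" "\<forall>\<omega> t. f \<omega> t \<in> {0, 1::real}"
    "\<forall>\<omega>\<in>space M. \<forall>t\<in>{0..T}. (\<omega>, t) \<in> B \<longleftrightarrow> f \<omega> t = 1"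
    by (rule bv_setsE[OF assms])
  note f = f0(1,2) f0(3)[rule_format] f0(4)[rule_format]
  have "space M \<times> {0..T} - B \<in> predictable_sets M F T"
    using sets.compl_sets[of B Pred] f(1) by (simp add: sets_Pred space_Pred)
  \<comment> \<open>The process \<open>1 - f\<close> is the paste of the constants 0 and 1 along
    \<open>f\<close>, so the pasting lemma supplies its variation bound.\<close>
  moreover have "(\<lambda>\<omega> t. f \<omega> t *\<^sub>R (0::real) + (1 - f \<omega> t) *\<^sub>R 1) \<in> bdd_Ninf M F T"
    by (rule bdd_Ninf_paste[OF bdd_Ninf_const bdd_Ninf_const f(2,3)])
  then have "(\<lambda>\<omega> t. 1 - f \<omega> t) \<in> bdd_Ninf M F T" by simp
  moreover have "1 - f \<omega> t \<in> {0, 1}" for \<omega> t using f(3)[of \<omega> t] by auto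
  moreover have "(\<omega>, t) \<in> space M \<times> {0..T} - B \<longleftrightarrow> 1 - f \<omega> t = 1" if "\<omega> \<in> space M" "t \<in> {0..T}" for \<omega> t
    using f(3)[of \<omega> t] f(4)[OF that] that by auto
  ultimately show ?thesis by (rule bv_setsI)
qed

lemma bv_sets_Un:
  assumes "A \<in> bv_sets" "B \<in> bv_sets"
  shows "A \<union> B \<in> bv_sets"
proof -
  obtain f where f0: "A \<in> predictable_sets M F T" "f \<in> bdd_Ninf M F T" "\<forall>\<omega> t. f \<omega> t \<in> {0, 1::real}"
    "\<forall>\<omega>\<in>space M. \<forall>t\<in>{0..T}. (\<omega>, t) \<in> A \<longleftrightarrow> f \<omega> t = 1"
    by (rule bv_setsE[OF assms(1)])
  note f = f0(1,2) f0(3)[rule_format] f0(4)[rule_format]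
  obtain g where g0: "B \<in> predictable_sets M F T" "g \<in> bdd_Ninf M F T" "\<forall>\<omega> t. g \<omega> t \<in> {0, 1::real}"
    "\<forall>\<omega>\<in>space M. \<forall>t\<in>{0..T}. (\<omega>, t) \<in> B \<longleftrightarrow> g \<omega> t = 1"
    by (rule bv_setsE[OF assms(2)])
  note g = g0(1,2) g0(3)[rule_format] g0(4)[rule_format]
  \<comment> \<open>Pasting the constant 1 and \<open>g\<close> along \<open>f\<close> gives the
    maximum of the two indicators.\<close>
  let ?h = "\<lambda>\<omega> t. f \<omega> t *\<^sub>R 1 + (1 - f \<omega> t) *\<^sub>R g \<omega> t"
  have "A \<union> B \<in> predictable_sets M F T"
    using sets.Un[of A Pred B] f(1) g(1) by (simp add: sets_Pred)
  moreover have "?h \<in> bdd_Ninf M F T"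
    by (rule bdd_Ninf_paste[OF bdd_Ninf_const g(2) f(2,3)])
  moreover have "?h \<omega> t \<in> {0, 1}" for \<omega> t using f(3)[of \<omega> t] g(3)[of \<omega> t] by auto
  moreover have "(\<omega>, t) \<in> A \<union> B \<longleftrightarrow> ?h \<omega> t = 1" if "\<omega> \<in> space M" "t \<in> {0..T}" for \<omega> t
    using f(3)[of \<omega> t] g(3)[of \<omega> t] f(4)[OF that] g(4)[OF that] by auto
  ultimately show ?thesis by (rule bv_setsI)
qed

lemma bv_sets_paste:
  assumes "B \<in> bv_sets" "x \<in> bdd_Ninf M F T" "z \<in> bdd_Ninf M F T"
  obtains w where "w \<in> bdd_Ninf M F T"
    "\<And>\<omega> t. \<omega> \<in> space M \<Longrightarrow> t \<in> {0..T} \<Longrightarrow> w \<omega> t = (if (\<omega>, t) \<in> B then x \<omega> t else z \<omega> t)"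
proof -
  obtain f where f0: "B \<in> predictable_sets M F T" "f \<in> bdd_Ninf M F T" "\<forall>\<omega> t. f \<omega> t \<in> {0, 1::real}"
    "\<forall>\<omega>\<in>space M. \<forall>t\<in>{0..T}. (\<omega>, t) \<in> B \<longleftrightarrow> f \<omega> t = 1"
    by (rule bv_setsE[OF assms(1)])
  note f = f0(2) f0(3)[rule_format] f0(4)[rule_format]
  show ?thesis
  proof (rule that)
    show "(\<lambda>\<omega> t. f \<omega> t *\<^sub>R x \<omega> t + (1 - f \<omega> t) *\<^sub>R z \<omega> t) \<in> bdd_Ninf M F T"
      by (rule bdd_Ninf_paste[OF assms(2,3) f(1,2)])
    show "f \<omega> t *\<^sub>R x \<omega> t + (1 - f \<omega> t) *\<^sub>R z \<omega> t = (if (\<omega>, t) \<in> B then x \<omega> t else z \<omega> t)"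
      if "\<omega> \<in> space M" "t \<in> {0..T}" for \<omega> t
      using f(2)[of \<omega> t] f(3)[OF that] by auto
  qed
qed

text \<open>An algebra is dense in the sigma-algebra that it generates, for the measure of the
  symmetric difference. The induction shows that the approximable sets are closed under complements
  and countable unions. The finite measure is left free; it is later a weighted version of
  \<eta>.\<close>

lemma bv_sets_approx:
  assumes \<nu>: "finite_measure \<nu>" "predictable_sets M F T \<subseteq> sets \<nu>"
    and B: "B \<in> predictable_sets M F T" and "0 < (\<epsilon>::real)"
  obtains A where "A \<in> bv_sets" "measure \<nu> ((A - B) \<union> (B - A)) < \<epsilon>"
proof -
  interpret finite_measure \<nu> by (rule \<nu>)
  let ?d = "\<lambda>A B. measure \<nu> ((A - B) \<union> (B - A))"
  let ?good = "\<lambda>B. B \<in> predictable_sets M F T \<and> (\<forall>\<epsilon>>0. \<exists>A\<in>bv_sets. ?d A B < \<epsilon>)"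
  have bv: "A \<in> bv_sets \<Longrightarrow> A \<in> sets \<nu>" for A using \<nu>(2) by (auto simp: bv_sets_def)
  have bvp: "A \<in> bv_sets \<Longrightarrow> A \<in> sets Pred" for A by (auto simp: bv_sets_def sets_Pred)
  have pr: "A \<in> sets Pred \<Longrightarrow> A \<in> sets \<nu>" for A using \<nu>(2) by (auto simp: sets_Pred)
  have goodP: "?good B \<Longrightarrow> B \<in> sets Pred" for B by (simp add: sets_Pred)
  have empty: "{} \<in> bv_sets"
  proof -
    have "{} \<in> F 0" using sets.empty_sets[of "Fmeas M (F 0)"] by (simp add: sets_Fmeas)
    then have "{} \<times> {0..T} \<in> rects" unfolding rects_def by blast
    then show ?thesis using rects_bv_sets by auto
  qed
  have Un: "?good (B1 \<union> B2)" if g: "?good B1" "?good B2" for B1 B2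
  proof (intro conjI allI impI)
    show "B1 \<union> B2 \<in> predictable_sets M F T"
      using sets.Un[OF goodP[OF g(1)] goodP[OF g(2)]] by (simp add: sets_Pred)
    fix \<epsilon> :: real assume "0 < \<epsilon>"
    then have e2: "0 < \<epsilon>/2" by simp
    obtain A1 where A1: "A1 \<in> bv_sets" "?d A1 B1 < \<epsilon>/2" using g(1) e2 by blast
    obtain A2 where A2: "A2 \<in> bv_sets" "?d A2 B2 < \<epsilon>/2" using g(2) e2 by blast
    note [simp] = pr[OF goodP[OF g(1)]] pr[OF goodP[OF g(2)]] bv[OF A1(1)] bv[OF A2(1)]
    have "?d (A1 \<union> A2) (B1 \<union> B2) \<le> measure \<nu> (((A1 - B1) \<union> (B1 - A1)) \<union> ((A2 - B2) \<union> (B2 - A2)))"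
      by (intro finite_measure_mono sets.Un sets.Diff) auto
    also have "\<dots> \<le> ?d A1 B1 + ?d A2 B2"
      by (intro measure_Un_le sets.Un sets.Diff) simp_all
    finally have "?d (A1 \<union> A2) (B1 \<union> B2) < \<epsilon>" using A1(2) A2(2) by linarith
    then show "\<exists>A\<in>bv_sets. ?d A (B1 \<union> B2) < \<epsilon>" using bv_sets_Un[OF A1(1) A2(1)] by blast
  qed
  have bv_good: "?good B" if "B \<in> bv_sets" for B
    using that bvp[OF that] by (auto simp: sets_Pred intro!: bexI[of _ B])
  have "B \<in> sigma_sets (space M \<times> {0..T}) rects"
    using B predictable_sets_subset_rects by blast
  then have "?good B"
  proof induction
    case (Basic B)
    then show ?case using rects_bv_sets by (intro bv_good) blast
  next
    case Empty
    show ?case by (rule bv_good[OF empty])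
  next
    case (Compl B)
    show ?case
    proof (intro conjI allI impI)
      show "space M \<times> {0..T} - B \<in> predictable_sets M F T"
        using sets.compl_sets[OF goodP[OF Compl.IH]] by (simp add: sets_Pred space_Pred)
      fix \<epsilon> :: real assume "0 < \<epsilon>"
      then obtain A where A: "A \<in> bv_sets" "?d A B < \<epsilon>" using Compl.IH by blast
      let ?S = "space M \<times> {0..T}"
      have "A \<subseteq> ?S" "B \<subseteq> ?S"
        using sets.sets_into_space[OF bvp[OF A(1)]] sets.sets_into_space[OF goodP[OF Compl.IH]]
        by (simp_all add: space_Pred)
      then have "((?S - A) - (?S - B)) \<union> ((?S - B) - (?S - A)) = (A - B) \<union> (B - A)" by blast
      then show "\<exists>A\<in>bv_sets. ?d A (?S - B) < \<epsilon>"
        using A bv_sets_Compl[OF A(1)] by (intro bexI[of _ "?S - A"]) simp_all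
    qed
  next
    case (Union B)
    let ?U = "\<lambda>n. \<Union>i<n. B i"
    have Un: "?good (?U n)" for n
    proof (induction n)
      case 0 then show ?case using bv_good[OF empty] by simp
    next
      case (Suc n)
      have "?U (Suc n) = ?U n \<union> B n" by (auto simp: lessThan_Suc)
      then show ?case using Un[OF Suc Union.IH[of n]] by simp
    qed
    have Bs: "B i \<in> sets \<nu>" for i by (rule pr[OF goodP[OF Union.IH]])
    \<comment> \<open>Finiteness enters here: the part of the union missed by the first
      \<open>n\<close> sets decreases to the empty set, so half of the error pays for truncation and
      half for approximating the finite union.\<close>
    have lim: "(\<lambda>n. measure \<nu> (\<Union>(range B) - ?U n)) \<longlonglongrightarrow> measure \<nu> (\<Inter>n. \<Union>(range B) - ?U n)"
      by (rule finite_Lim_measure_decseq) (use Bs in \<open>auto simp: decseq_def\<close>)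
    have "(\<Inter>n. \<Union>(range B) - ?U n) = {}" by auto
    with lim have lim: "(\<lambda>n. measure \<nu> (\<Union>(range B) - ?U n)) \<longlonglongrightarrow> 0"
      by (simp only: measure_empty)
    show ?case
    proof (intro conjI allI impI)
      show "\<Union>(range B) \<in> predictable_sets M F T"
        using sets.countable_UN[of B UNIV Pred] goodP[OF Union.IH] by (auto simp: sets_Pred)
      fix \<epsilon> :: real assume "0 < \<epsilon>"
      then have e2: "0 < \<epsilon>/2" by simp
      obtain n where n: "measure \<nu> (\<Union>(range B) - ?U n) < \<epsilon>/2"
        using order_tendstoD(2)[OF lim e2] eventually_sequentially by auto
      obtain A where A: "A \<in> bv_sets" "?d A (?U n) < \<epsilon>/2" using Un[of n] e2 by blast
      have "?d A (\<Union>(range B)) \<le> measure \<nu> (((A - ?U n) \<union> (?U n - A)) \<union> (\<Union>(range B) - ?U n))"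
        using bv[OF A(1)] Bs by (intro finite_measure_mono) auto
      also have "\<dots> \<le> ?d A (?U n) + measure \<nu> (\<Union>(range B) - ?U n)"
        using bv[OF A(1)] Bs by (intro measure_Un_le) auto
      finally have "?d A (\<Union>(range B)) < \<epsilon>" using n A(2) by linarith
      then show "\<exists>A\<in>bv_sets. ?d A (\<Union>(range B)) < \<epsilon>" using A(1) by blast
    qed
  qed
  then show ?thesis using that \<open>0 < \<epsilon>\<close> by blast
qed

end

section \<open>Random measures\<close>

text \<open>A Dynkin argument from rectangles, finiteness handling complements. The sigma-algebra on
  \<omega> is a parameter because the lemma serves twice: with \<open>M\<close> to build \<eta>, and
  with \<open>F t\<close> to make the exit mass adapted.\<close>

lemma measurable_emeasure_finite_kernel:
  assumes sets: "\<And>\<omega>. \<omega> \<in> space N \<Longrightarrow> sets (\<kappa> \<omega>) = sets S"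
    and fin: "\<And>\<omega>. \<omega> \<in> space N \<Longrightarrow> finite_measure (\<kappa> \<omega>)"
    and C: "\<And>C. C \<in> sets S \<Longrightarrow> (\<lambda>\<omega>. emeasure (\<kappa> \<omega>) C) \<in> borel_measurable N"
    and Q: "Q \<in> sets (N \<Otimes>\<^sub>M S)"
  shows "(\<lambda>\<omega>. emeasure (\<kappa> \<omega>) (Pair \<omega> -` Q)) \<in> borel_measurable N"
  using Int_stable_pair_measure_generator pair_measure_closed Q
  unfolding sets_pair_measure
proof (induct rule: sigma_sets_induct_disjoint)
  case (basic A)
  then obtain B D where B: "A = B \<times> D" "B \<in> sets N" "D \<in> sets S" by auto
  have "emeasure (\<kappa> \<omega>) (Pair \<omega> -` A) = indicator B \<omega> * emeasure (\<kappa> \<omega>) D" for \<omega>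
    unfolding B(1) by (auto simp: indicator_def)
  then show ?case using B(2) C[OF B(3)] by simp
next
  case empty show ?case by simp
next
  case (compl A)
  have A: "A \<in> sets (N \<Otimes>\<^sub>M S)" using compl(1) by (simp add: sets_pair_measure)
  have eq: "emeasure (\<kappa> \<omega>) (Pair \<omega> -` ((space N \<times> space S) - A)) = emeasure (\<kappa> \<omega>) (space S) - emeasure (\<kappa> \<omega>) (Pair \<omega> -` A)"
    if \<omega>: "\<omega> \<in> space N" for \<omega>
  proof -
    have sp: "space (\<kappa> \<omega>) = space S" by (rule sets_eq_imp_space_eq[OF sets[OF \<omega>]])
    have "Pair \<omega> -` A \<in> sets (\<kappa> \<omega>)" using sets_Pair1[OF A] sets[OF \<omega>] by simp
    moreover have "Pair \<omega> -` ((space N \<times> space S) - A) = space (\<kappa> \<omega>) - Pair \<omega> -` A"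
      using \<omega> sp by auto
    ultimately show ?thesis
      using emeasure_compl[of "Pair \<omega> -` A" "\<kappa> \<omega>"] finite_measure.emeasure_finite[OF fin[OF \<omega>]] sp by simp
  qed
  then show ?case
    using compl(2) C[OF sets.top] by (subst measurable_cong[OF eq]) auto
next
  case (union F)
  have F: "F i \<in> sets (N \<Otimes>\<^sub>M S)" for i using union(2) by (auto simp: sets_pair_measure)
  have eq: "emeasure (\<kappa> \<omega>) (Pair \<omega> -` \<Union>(range F)) = (\<Sum>i. emeasure (\<kappa> \<omega>) (Pair \<omega> -` F i))"
    if \<omega>: "\<omega> \<in> space N" for \<omega>
    unfolding vimage_UN
    using union(1) sets_Pair1[OF F] sets[OF \<omega>]
    by (intro suminf_emeasure[symmetric]) (auto simp: disjoint_family_on_def)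
  then show ?case
    using union(3) by (subst measurable_cong[OF eq]) auto
qed

section \<open>The measure \<eta> and its null sets\<close>

locale random_measure_space = filtered_prob_space M F T
  for M :: "'a measure" and F :: "real \<Rightarrow> 'a set set" and T :: real +
  fixes \<mu> :: "'a \<Rightarrow> real measure"
  assumes radon: "random_radon_measure M T \<mu>"
begin

abbreviation IT :: "real measure" where "IT \<equiv> restrict_space borel {0..T}"
abbreviation \<eta> :: "('a \<times> real) measure" where "\<eta> \<equiv> eta M \<mu> T"

lemma space_IT: "space IT = {0..T}"
  by (simp add: space_restrict_space)

lemma sets_IT: "C \<in> sets IT \<longleftrightarrow> C \<in> sets borel \<and> C \<subseteq> {0..T}"
  by (auto simp: sets_restrict_space_iff)

lemma sets_mu: "\<omega> \<in> space M \<Longrightarrow> sets (\<mu> \<omega>) = sets IT"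
  and finite_mu: "\<omega> \<in> space M \<Longrightarrow> finite_measure (\<mu> \<omega>)"
  using radon unfolding random_radon_measure_def by simp_all

lemma space_mu: "\<omega> \<in> space M \<Longrightarrow> space (\<mu> \<omega>) = {0..T}"
  using sets_eq_imp_space_eq[OF sets_mu] by (simp add: space_IT)

lemma emeasure_mu_measurable: "C \<in> sets IT \<Longrightarrow> (\<lambda>\<omega>. emeasure (\<mu> \<omega>) C) \<in> borel_measurable M"
proof -
  assume C: "C \<in> sets IT"
  then have "C \<inter> {0..T} = C" "C \<in> sets borel" by (auto simp: sets_IT)
  with radon show ?thesis unfolding random_radon_measure_def by metis
qed

lemma emeasure_mu_cut_measurable:
  assumes "Q \<in> sets (M \<Otimes>\<^sub>M IT)"
  shows "(\<lambda>\<omega>. emeasure (\<mu> \<omega>) (Pair \<omega> -` Q)) \<in> borel_measurable M"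
  by (rule measurable_emeasure_finite_kernel[OF sets_mu finite_mu emeasure_mu_measurable assms])

lemma sets_eta: "sets \<eta> = sets (M \<Otimes>\<^sub>M IT)"
proof -
  have "sigma_algebra (space M \<times> {0..T}) (sets (M \<Otimes>\<^sub>M IT))"
    using sets.sigma_algebra_axioms[of "M \<Otimes>\<^sub>M IT"] by (simp add: space_pair_measure space_IT)
  then show ?thesis unfolding eta_def by (rule sigma_algebra.sets_measure_of_eq)
qed

lemma space_eta: "space \<eta> = space M \<times> {0..T}"
  unfolding eta_def by (rule space_measure_of_conv)

text \<open>\<open>measure_of\<close> returns the prescribed set function only once this is known to
  be countably additive, which follows by exchanging the series with the expectation.\<close>

lemma emeasure_eta:
  assumes "A \<in> sets \<eta>"
  shows "emeasure \<eta> A = (\<integral>\<^sup>+ \<omega>. emeasure (\<mu> \<omega>) (Pair \<omega> -` A) \<partial>M)"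
  unfolding eta_def
proof (rule emeasure_measure_of_sigma)
  show "sigma_algebra (space M \<times> {0..T}) (sets (M \<Otimes>\<^sub>M IT))"
    using sets.sigma_algebra_axioms[of "M \<Otimes>\<^sub>M IT"] by (simp add: space_pair_measure space_IT)
  show "positive (sets (M \<Otimes>\<^sub>M IT)) (\<lambda>A. \<integral>\<^sup>+ \<omega>. emeasure (\<mu> \<omega>) (Pair \<omega> -` A) \<partial>M)"
    by (simp add: positive_def)
  show "countably_additive (sets (M \<Otimes>\<^sub>M IT)) (\<lambda>A. \<integral>\<^sup>+ \<omega>. emeasure (\<mu> \<omega>) (Pair \<omega> -` A) \<partial>M)"
  proof (rule countably_additiveI)
    fix A :: "nat \<Rightarrow> ('a \<times> real) set"
    assume A: "range A \<subseteq> sets (M \<Otimes>\<^sub>M IT)" "disjoint_family A"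
    have "(\<Sum>i. \<integral>\<^sup>+ \<omega>. emeasure (\<mu> \<omega>) (Pair \<omega> -` A i) \<partial>M) = (\<integral>\<^sup>+ \<omega>. (\<Sum>i. emeasure (\<mu> \<omega>) (Pair \<omega> -` A i)) \<partial>M)"
      using A(1) by (intro nn_integral_suminf[symmetric] emeasure_mu_cut_measurable) auto
    also have "\<dots> = (\<integral>\<^sup>+ \<omega>. emeasure (\<mu> \<omega>) (Pair \<omega> -` \<Union>(range A)) \<partial>M)"
    proof (rule nn_integral_cong)
      fix \<omega> assume \<omega>: "\<omega> \<in> space M"
      have "Pair \<omega> -` A i \<in> sets (\<mu> \<omega>)" for i
        using A(1) sets_Pair1[of "A i" M IT \<omega>] sets_mu[OF \<omega>] by auto
      then show "(\<Sum>i. emeasure (\<mu> \<omega>) (Pair \<omega> -` A i)) = emeasure (\<mu> \<omega>) (Pair \<omega> -` \<Union>(range A))"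
        unfolding vimage_UN using A(2)
        by (intro suminf_emeasure) (auto simp: disjoint_family_on_def)
    qed
    finally show "(\<Sum>i. \<integral>\<^sup>+ \<omega>. emeasure (\<mu> \<omega>) (Pair \<omega> -` A i) \<partial>M) = (\<integral>\<^sup>+ \<omega>. emeasure (\<mu> \<omega>) (Pair \<omega> -` \<Union>(range A)) \<partial>M)" .
  qed
  show "A \<in> sets (M \<Otimes>\<^sub>M IT)" using assms by (simp add: sets_eta)
qed

lemma cut_sets_mu:
  assumes "A \<in> sets \<eta>" "\<omega> \<in> space M"
  shows "Pair \<omega> -` A \<in> sets (\<mu> \<omega>)"
  using assms sets_Pair1[of A M IT \<omega>] sets_mu[OF assms(2)] by (simp add: sets_eta)

lemma null_sets_etaI:
  assumes "A \<in> sets \<eta>" "AE \<omega> in M. emeasure (\<mu> \<omega>) (Pair \<omega> -` A) = 0"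
  shows "A \<in> null_sets \<eta>"
  using assms emeasure_mu_cut_measurable[of A]
  by (simp add: null_sets_def emeasure_eta sets_eta nn_integral_0_iff_AE)

lemma AE_eta_D:
  assumes "AE p in \<eta>. P p"
  shows "AE \<omega> in M. AE t in \<mu> \<omega>. P (\<omega>, t)"
proof -
  obtain Q where Q: "{p\<in>space \<eta>. \<not> P p} \<subseteq> Q" "emeasure \<eta> Q = 0" "Q \<in> sets \<eta>"
    using AE_E[OF assms] by blast
  have "AE \<omega> in M. emeasure (\<mu> \<omega>) (Pair \<omega> -` Q) = 0"
    using Q(2,3) emeasure_mu_cut_measurable[of Q] by (simp add: emeasure_eta sets_eta nn_integral_0_iff_AE)
  moreover have "AE t in \<mu> \<omega>. P (\<omega>, t)"
    if \<omega>: "\<omega> \<in> space M" and 0: "emeasure (\<mu> \<omega>) (Pair \<omega> -` Q) = 0" for \<omega>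
  proof (rule AE_I')
    show "Pair \<omega> -` Q \<in> null_sets (\<mu> \<omega>)"
      using cut_sets_mu[OF Q(3) \<omega>] 0 by auto
    show "{t \<in> space (\<mu> \<omega>). \<not> P (\<omega>, t)} \<subseteq> Pair \<omega> -` Q"
      using Q(1) \<omega> by (auto simp: space_mu space_eta subset_eq)
  qed
  ultimately show ?thesis by (auto elim: AE_mp)
qed

text \<open>Both sides integrate \<open>f\<close> against a measure on \<open>M\<close>: the first
  marginal of \<eta> restricted to the strip over \<open>C\<close>, and the measure with density the
  mass of \<open>C\<close>. They agree on events, hence on \<open>f\<close>.\<close>

lemma nn_integral_eta_rect:
  assumes f: "f \<in> borel_measurable M" and C: "C \<in> sets IT"
  shows "(\<integral>\<^sup>+ p. f (fst p) * indicator C (snd p) \<partial>\<eta>) = (\<integral>\<^sup>+ \<omega>. f \<omega> * emeasure (\<mu> \<omega>) C \<partial>M)"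
proof -
  note [measurable_cong] = sets_eta
  have [measurable]: "C \<in> sets IT" by (rule C)
  have [measurable]: "f \<in> borel_measurable M" by (rule f)
  have fst_m[measurable]: "fst \<in> measurable \<eta> M" "snd \<in> measurable \<eta> IT"
    by measurable
  let ?N1 = "distr (density \<eta> (\<lambda>p. indicator C (snd p))) M fst"
  let ?N2 = "density M (\<lambda>\<omega>. emeasure (\<mu> \<omega>) C)"
  have "?N1 = ?N2"
  proof (rule measure_eqI)
    fix B assume "B \<in> sets ?N1"
    then have B[measurable]: "B \<in> sets M" by simp
    have BC: "B \<times> C \<in> sets \<eta>" using B C by (simp add: sets_eta)
    have sub: "B \<subseteq> space M" "C \<subseteq> {0..T}" using sets.sets_into_space[OF B] C by (auto simp: sets_IT)
    have "fst -` B \<inter> space \<eta> \<in> sets \<eta>" by measurable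
    then have "emeasure ?N1 B = (\<integral>\<^sup>+ p. indicator C (snd p) * indicator (fst -` B \<inter> space \<eta>) p \<partial>\<eta>)"
      by (simp add: emeasure_distr emeasure_density)
    also have "\<dots> = (\<integral>\<^sup>+ p. indicator (B \<times> C) p \<partial>\<eta>)"
      using sub by (intro nn_integral_cong) (auto simp: indicator_def space_eta)
    also have "\<dots> = (\<integral>\<^sup>+ \<omega>. emeasure (\<mu> \<omega>) (Pair \<omega> -` (B \<times> C)) \<partial>M)"
      using BC by (simp add: emeasure_eta)
    also have "\<dots> = (\<integral>\<^sup>+ \<omega>. emeasure (\<mu> \<omega>) C * indicator B \<omega> \<partial>M)"
      by (intro nn_integral_cong) (auto simp: indicator_def)
    also have "\<dots> = emeasure ?N2 B"
      using emeasure_mu_measurable[OF C] B by (simp add: emeasure_density)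
    finally show "emeasure ?N1 B = emeasure ?N2 B" .
  qed simp
  then have "(\<integral>\<^sup>+ \<omega>. f \<omega> \<partial>?N1) = (\<integral>\<^sup>+ \<omega>. f \<omega> \<partial>?N2)" by simp
  then show ?thesis
    using emeasure_mu_measurable[OF C]
    by (simp add: nn_integral_distr nn_integral_density mult.commute)
qed

text \<open>\<open>P\<close> may be nonmeasurable, so its failures are enclosed in a null strip of
  exceptional \<omega> together with the slice at time 0, which atomlessness makes null. Leaving out
  time 0 provides room to the left of \<open>t\<close>.\<close>

lemma AE_eta_I:
  assumes "AE \<omega> in M. \<forall>t\<in>{0<..T}. P (\<omega>, t)"
    and atomless: "AE \<omega> in M. \<forall>t. emeasure (\<mu> \<omega>) {t} = 0"
  shows "AE p in \<eta>. P p"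
proof -
  obtain N where N: "\<And>\<omega>. \<omega> \<in> space M - N \<Longrightarrow> \<forall>t\<in>{0<..T}. P (\<omega>, t)" "N \<in> null_sets M"
    using AE_E3[OF assms(1)] by blast
  have NN: "N \<times> {0..T} \<in> sets \<eta>" "space M \<times> {0} \<in> sets \<eta>"
    using N(2) T_pos by (auto simp: sets_eta sets_IT intro!: pair_measureI)
  have "N \<times> {0..T} \<in> null_sets \<eta>"
    by (rule null_sets_etaI[OF NN(1)], use AE_not_in[OF N(2)] in \<open>eventually_elim\<close>) simp
  moreover have "space M \<times> {0} \<in> null_sets \<eta>"
  proof (rule null_sets_etaI[OF NN(2)])
    show "AE \<omega> in M. emeasure (\<mu> \<omega>) (Pair \<omega> -` (space M \<times> {0})) = 0"
      using atomless
    proof eventually_elim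
      case (elim \<omega>)
      then show ?case by (cases "\<omega> \<in> space M") (auto simp: vimage_def)
    qed
  qed
  ultimately have "N \<times> {0..T} \<union> space M \<times> {0} \<in> null_sets \<eta>" by (rule null_sets.Un)
  then show ?thesis
  proof (rule AE_I')
    show "{p \<in> space \<eta>. \<not> P p} \<subseteq> N \<times> {0..T} \<union> space M \<times> {0}"
    proof
      fix p assume p: "p \<in> {p \<in> space \<eta>. \<not> P p}"
      then obtain \<omega> t where \<omega>: "p = (\<omega>, t)" "\<omega> \<in> space M" "0 \<le> t" "t \<le> T" "\<not> P (\<omega>, t)"
        by (auto simp: space_eta)
      have "\<omega> \<in> N \<or> t = 0"
      proof (rule ccontr)
        assume "\<not> (\<omega> \<in> N \<or> t = 0)"
        then have "t \<in> {0<..T}" "\<omega> \<in> space M - N" using \<omega> by auto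
        with N(1) \<omega>(5) show False by blast
      qed
      then show "p \<in> N \<times> {0..T} \<union> space M \<times> {0}" using \<omega> by auto
    qed
  qed
qed

lemma predictable_sets_eta: "predictable_sets M F T \<subseteq> sets \<eta>"
proof -
  have "A \<in> sets M" if "A \<in> F s" "0 \<le> s" for A s using that F_subset by blast
  then have "rects \<subseteq> sets (M \<Otimes>\<^sub>M IT)"
    unfolding rects_def by (auto intro!: pair_measureI simp: sets_IT)
  from sets.sigma_sets_subset[OF this] predictable_sets_subset_rects show ?thesis
    by (auto simp: sets_eta space_pair_measure space_IT)
qed

lemma measurable_Pred_eta: "f \<in> measurable Pred N \<Longrightarrow> f \<in> measurable \<eta> N"
  using predictable_sets_eta
  by (rule_tac measurable_mono[THEN subsetD]) (auto simp: sets_Pred space_Pred space_eta)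

section \<open>An optional random measure is adapted\<close>

lemma F_stop_Int_in_F:
  assumes B: "B \<in> sigma_sets (space M) (F_stop M F \<tau>)" and st: "stopping_time_ext M F \<tau>" and t: "0 \<le> t"
  shows "B \<in> sets M \<and> B \<inter> {\<omega>\<in>space M. \<tau> \<omega> \<le> ereal t} \<in> F t"
  using B
proof induction
  interpret Ft: sigma_algebra "space M" "F t" by (rule sigma_algebra_F[OF t])
  let ?Z = "{\<omega>\<in>space M. \<tau> \<omega> \<le> ereal t}"
  have Z: "?Z \<in> F t" using st t by (auto simp: stopping_time_ext_def)
  {
    case (Basic B)
    have "F_infty M F \<subseteq> sets M"
      unfolding F_infty_def using F_subset by (intro sets.sigma_sets_subset) auto
    then show ?case using Basic t by (auto simp: F_stop_def)
  next
    case Empty show ?case by simp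
  next
    case (Compl B)
    \<comment> \<open>\<open>Fmeas\<close> passes to the sigma-algebra generated by
      \<open>F_stop M F \<tau>\<close>, so the defining property is carried through generation.
      Complements are taken inside \<open>?Z\<close>, which lies in \<open>F t\<close>
      itself.\<close>
    have "(space M - B) \<inter> ?Z = ?Z - B \<inter> ?Z" by auto
    then show ?case using Compl.IH Z by (auto simp del: Int_iff)
  next
    case (Union B)
    have "(\<Union>(range B)) \<inter> ?Z = (\<Union>i. B i \<inter> ?Z)" by auto
    moreover have "(\<Union>i. B i \<inter> ?Z) \<in> F t" using Union.IH by (intro Ft.countable_UN) blast
    moreover have "\<Union>(range B) \<in> sets M" using Union.IH by (intro sets.countable_UN) blast
    ultimately show ?case by simp
  }
qed

lemma stopping_time_ext_vimage_in_F:
  assumes st: "stopping_time_ext M F \<tau>" and t: "0 \<le> t" and C: "C \<in> sets borel" "C \<subseteq> {0..t}"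
  shows "{\<omega>\<in>space M. \<tau> \<omega> < \<infinity> \<and> real_of_ereal (\<tau> \<omega>) \<in> C} \<in> F t"
proof -
  let ?G = "Fmeas M (F t)"
  \<comment> \<open>Values after \<open>t\<close> are sent to \<open>t + 1\<close>, outside
    \<open>C\<close>. The capped time is measurable for \<open>F t\<close> and has the required
    preimage of \<open>C\<close>.\<close>
  define g where "g \<omega> = (if \<tau> \<omega> \<le> ereal t then real_of_ereal (\<tau> \<omega>) else t + 1)" for \<omega>
  have Z: "{\<omega>\<in>space M. \<tau> \<omega> \<le> ereal s} \<in> F t" if "0 \<le> s" "s \<le> t" for s
    using st that F_mono[of s t] by (auto simp: stopping_time_ext_def)
  have pos: "0 \<le> \<tau> \<omega>" if "\<omega> \<in> space M" for \<omega> using st that by (auto simp: stopping_time_ext_def)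
  have ge: "g \<omega> \<le> a \<longleftrightarrow> (if a < 0 then False else if a < t + 1 then \<tau> \<omega> \<le> ereal (min a t) else True)"
    if "\<omega> \<in> space M" for \<omega> a
    using pos[OF that] t unfolding g_def by (cases "\<tau> \<omega>") auto
  have "g \<in> borel_measurable ?G"
    unfolding borel_measurable_iff_le
  proof
    fix a
    have "{\<omega>\<in>space M. g \<omega> \<le> a} = (if a < 0 then {} else if a < t + 1 then {\<omega>\<in>space M. \<tau> \<omega> \<le> ereal (min a t)} else space M)"
      using ge by auto
    also have "\<dots> \<in> sets ?G"
      using Z[of "min a t"] t sets.top[of ?G] sets.empty_sets[of ?G] by (auto simp: sets_Fmeas)
    finally show "{\<omega> \<in> space ?G. g \<omega> \<le> a} \<in> sets ?G" by simp
  qed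
  from measurable_sets[OF this C(1)] have "g -` C \<inter> space M \<in> F t"
    using t by (simp add: sets_Fmeas)
  also have "g -` C \<inter> space M = {\<omega>\<in>space M. \<tau> \<omega> < \<infinity> \<and> real_of_ereal (\<tau> \<omega>) \<in> C}"
  proof (intro set_eqI iffI)
    fix \<omega> assume \<omega>: "\<omega> \<in> g -` C \<inter> space M"
    then have "\<tau> \<omega> \<le> ereal t" using C(2) by (auto simp: g_def split: if_splits)
    then show "\<omega> \<in> {\<omega>\<in>space M. \<tau> \<omega> < \<infinity> \<and> real_of_ereal (\<tau> \<omega>) \<in> C}"
      using \<omega> by (auto simp: g_def)
  next
    fix \<omega> assume \<omega>: "\<omega> \<in> {\<omega>\<in>space M. \<tau> \<omega> < \<infinity> \<and> real_of_ereal (\<tau> \<omega>) \<in> C}"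
    then have "real_of_ereal (\<tau> \<omega>) \<le> t" using C(2) by auto
    then have "\<tau> \<omega> \<le> ereal t" using \<omega> pos[of \<omega>] by (cases "\<tau> \<omega>") auto
    then show "\<omega> \<in> g -` C \<inter> space M" using \<omega> by (auto simp: g_def)
  qed
  finally show ?thesis .
qed

lemma subalgebra_Fmeas: "0 \<le> t \<Longrightarrow> subalgebra M (Fmeas M (F t))"
  using F_subset by (simp add: subalgebra_def sets_Fmeas)

text \<open>Sampling the process at \<tau> multiplies \<open>Y\<close> by the event that \<tau>
  falls in \<open>C\<close>. As \<open>C\<close> ends before \<open>t\<close>, that event meets
  every event of the stopped sigma-algebra in an event of \<open>F t\<close>, over which
  \<open>Y\<close> integrates to 0.\<close>

lemma is_optional_projection_centered:
  assumes t: "0 \<le> t" and C: "C \<in> sets borel" "C \<subseteq> {0..t}"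
    and Y: "Y \<in> borel_measurable M" "\<And>\<omega>. \<bar>Y \<omega>\<bar> \<le> 1"
    and center: "\<And>B. B \<in> F t \<Longrightarrow> (LINT \<omega>:B|M. Y \<omega>) = 0"
  shows "is_optional_projection M F T (\<lambda>p. Y (fst p) * indicator C (snd p)) (\<lambda>_. 0)"
  unfolding is_optional_projection_def
proof (intro conjI allI impI)
  fix \<tau> assume *: "stopping_time_ext M F \<tau> \<and> (\<forall>\<omega>\<in>space M. \<tau> \<omega> \<le> ereal T \<or> \<tau> \<omega> = \<infinity>)"
  then have st: "stopping_time_ext M F \<tau>" by blast
  let ?K = "Fmeas M (F_stop M F \<tau>)"
  define E where "E = {\<omega>\<in>space M. \<tau> \<omega> < \<infinity> \<and> real_of_ereal (\<tau> \<omega>) \<in> C}"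
  have E: "E \<in> F t" unfolding E_def by (rule stopping_time_ext_vimage_in_F[OF st t C])
  have EM[measurable]: "E \<in> sets M" using E F_subset[OF t] by blast
  note [measurable] = Y(1)
  have EZ: "E \<subseteq> {\<omega>\<in>space M. \<tau> \<omega> \<le> ereal t}"
  proof
    fix \<omega> assume \<omega>: "\<omega> \<in> E"
    then have "real_of_ereal (\<tau> \<omega>) \<le> t" "0 \<le> \<tau> \<omega>" "\<omega> \<in> space M" "\<tau> \<omega> < \<infinity>"
      using C(2) st by (auto simp: E_def stopping_time_ext_def)
    then show "\<omega> \<in> {\<omega>\<in>space M. \<tau> \<omega> \<le> ereal t}" by (cases "\<tau> \<omega>") auto
  qed
  have "F_stop M F \<tau> \<subseteq> sets M"
    using F_stop_Int_in_F[OF sigma_sets.Basic st t] by blast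
  then have Pw: "F_stop M F \<tau> \<subseteq> Pow (space M)" using sets.sets_into_space by blast
  then have sK: "sets ?K = sigma_sets (space M) (F_stop M F \<tau>)"
    unfolding Fmeas_def by (rule sets_measure_of)
  interpret K: finite_measure_subalgebra M ?K
    by standard (use F_stop_Int_in_F[OF _ st t] in \<open>auto simp: subalgebra_def sK\<close>)
  have "AE \<omega> in M. real_cond_exp M ?K (\<lambda>\<omega>. Y \<omega> * indicator E \<omega>) \<omega> = 0"
  proof (rule K.real_cond_exp_charact)
    fix B assume "B \<in> sets ?K"
    then have B: "B \<in> sets M" "B \<inter> {\<omega>\<in>space M. \<tau> \<omega> \<le> ereal t} \<in> F t"
      using F_stop_Int_in_F[OF _ st t] by (auto simp: sK)
    interpret Ft: sigma_algebra "space M" "F t" by (rule sigma_algebra_F[OF t])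
    have "B \<inter> E = (B \<inter> {\<omega>\<in>space M. \<tau> \<omega> \<le> ereal t}) \<inter> E" using EZ by auto
    then have "B \<inter> E \<in> F t" using B(2) E Ft.Int by metis
    from center[OF this] show "(LINT \<omega>:B|M. Y \<omega> * indicator E \<omega>) = (LINT \<omega>:B|M. 0)"
      by (simp add: set_lebesgue_integral_def indicator_inter_arith mult_ac)
  next
    show "integrable M (\<lambda>\<omega>. Y \<omega> * indicator E \<omega>)"
      by (rule integrable_const_bound[of _ 1]) (use Y(2) in \<open>auto simp: indicator_def\<close>)
  qed auto
  moreover have eq: "Y \<omega> * indicator E \<omega>
      = (if \<tau> \<omega> < \<infinity> then Y \<omega> * indicator C (real_of_ereal (\<tau> \<omega>)) else 0)" if "\<omega> \<in> space M" for \<omega>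
    using that by (auto simp: E_def indicator_def)
  moreover have "AE \<omega> in M. real_cond_exp M ?K (\<lambda>\<omega>. Y \<omega> * indicator E \<omega>) \<omega>
      = real_cond_exp M ?K (\<lambda>\<omega>. if \<tau> \<omega> < \<infinity> then Y \<omega> * indicator C (real_of_ereal (\<tau> \<omega>)) else 0) \<omega>"
  proof (rule K.real_cond_exp_cong)
    show "(\<lambda>\<omega>. if \<tau> \<omega> < \<infinity> then Y \<omega> * indicator C (real_of_ereal (\<tau> \<omega>)) else 0) \<in> borel_measurable M"
      by (subst measurable_cong[OF eq[symmetric]]) simp_all
  qed (use eq in auto)
  ultimately show "AE \<omega> in M. real_cond_exp M ?K (\<lambda>\<omega>'. if \<tau> \<omega>' < \<infinity>
      then Y (fst (\<omega>', real_of_ereal (\<tau> \<omega>'))) * indicator C (snd (\<omega>', real_of_ereal (\<tau> \<omega>'))) else 0) \<omega>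
      = (if \<tau> \<omega> < \<infinity> then 0 else 0)"
    unfolding fst_conv snd_conv if_cancel by (auto elim: AE_mp)
qed simp

text \<open>With \<open>m\<close> the mass of \<open>C\<close>, A the event m \<le> a and Y the
  indicator of A minus its conditional expectation given \<open>F t\<close>, centering gives E[Y] =
  0 and optionality gives E[Y m] = 0. Hence Y (a - m), which is nonnegative, has mean 0 and vanishes
  almost surely: the conditional expectation is the indicator wherever m differs from a.\<close>

lemma emeasure_mu_level_set:
  assumes opt: "optional_measure M F T \<mu>" and t: "0 \<le> t" "t \<le> T" and C: "C \<in> sets borel" "C \<subseteq> {0..t}"
    and a: "0 \<le> (a::real)"
  obtains W where "W \<in> borel_measurable (Fmeas M (F t))"
    "AE \<omega> in M. (measure (\<mu> \<omega>) C < a \<longrightarrow> W \<omega> = (1::real)) \<and> (a < measure (\<mu> \<omega>) C \<longrightarrow> W \<omega> = 0)"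
proof -
  let ?G = "Fmeas M (F t)"
  define m where "m \<omega> = measure (\<mu> \<omega>) C" for \<omega>
  have CI: "C \<in> sets IT" using C t by (auto simp: sets_IT)
  have em: "emeasure (\<mu> \<omega>) C = ennreal (m \<omega>)" if "\<omega> \<in> space M" for \<omega>
    using finite_measure.emeasure_eq_measure[OF finite_mu[OF that]] by (simp add: m_def)
  have m0: "0 \<le> m \<omega>" for \<omega> by (simp add: m_def)
  have [measurable]: "m \<in> borel_measurable M"
    unfolding m_def measure_def using emeasure_mu_measurable[OF CI] by measurable
  define A where "A = {\<omega>\<in>space M. m \<omega> \<le> a}"
  have [measurable]: "A \<in> sets M" unfolding A_def by measurable
  interpret G: finite_measure_subalgebra M ?G
    by standard (rule subalgebra_Fmeas[OF t(1)])
  define W0 where "W0 = real_cond_exp M ?G (indicator A)"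
  \<comment> \<open>Clipping to [0, 1] makes the bounds hold for every \<omega>: optionality tests
    processes bounded everywhere, and the sign of \<open>D\<close> below is needed
    pointwise.\<close>
  define W where "W \<omega> = max 0 (min 1 (W0 \<omega>))" for \<omega>
  have intA: "integrable M (indicator A :: 'a \<Rightarrow> real)"
    by (intro integrable_real_indicator) (simp_all add: emeasure_eq_measure)
  have "AE \<omega> in M. 0 \<le> W0 \<omega>" "AE \<omega> in M. W0 \<omega> \<le> 1"
    unfolding W0_def by (rule G.real_cond_exp_ge_c[OF intA] G.real_cond_exp_le_c[OF intA]; simp)+
  then have WW: "AE \<omega> in M. W \<omega> = W0 \<omega>"
    by eventually_elim (simp add: W_def)
  have WG: "W \<in> borel_measurable ?G"
    unfolding W_def W0_def by measurable
  have [measurable]: "W \<in> borel_measurable M" by (rule measurable_Fmeas_M[OF WG t(1)])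
  have W01: "0 \<le> W \<omega>" "W \<omega> \<le> 1" for \<omega> by (auto simp: W_def)
  define Y where "Y \<omega> = indicator A \<omega> - W \<omega>" for \<omega>
  have [measurable]: "Y \<in> borel_measurable M" unfolding Y_def by measurable
  have Y1: "\<bar>Y \<omega>\<bar> \<le> 1" for \<omega> using W01[of \<omega>] by (auto simp: Y_def indicator_def)
  have intY: "integrable M Y"
    by (rule integrable_const_bound[of _ 1]) (use Y1 in auto)
  have intW: "integrable M W"
    by (rule integrable_const_bound[of _ 1]) (use W01 in auto)
  have center: "(LINT \<omega>:B|M. Y \<omega>) = 0" if B: "B \<in> F t" for B
  proof -
    have BG: "B \<in> sets ?G" using B t by (simp add: sets_Fmeas)
    have BM[measurable]: "B \<in> sets M" using B F_subset[OF t(1)] by blast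
    have "(LINT \<omega>:B|M. Y \<omega>) = (LINT \<omega>:B|M. indicator A \<omega>) - (LINT \<omega>:B|M. W \<omega>)"
      unfolding Y_def
      by (intro set_integral_diff; unfold set_integrable_def; intro integrable_mult_indicator intA intW; fact)
    also have "(LINT \<omega>:B|M. W \<omega>) = (LINT \<omega>:B|M. W0 \<omega>)"
      unfolding set_lebesgue_integral_def
      by (intro integral_cong_AE) (use WW in \<open>auto simp: W0_def elim: eventually_mono\<close>)
    also have "(LINT \<omega>:B|M. indicator A \<omega>) = (LINT \<omega>:B|M. W0 \<omega>)"
      unfolding W0_def by (rule G.real_cond_exp_intA[OF intA BG])
    finally show ?thesis by simp
  qed
  have Y0: "(LINT \<omega>|M. Y \<omega>) = 0"
    using center[of "space M"] sets.top[of ?G] t set_integral_space[OF intY]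
    by (simp add: sets_Fmeas)
  let ?v = "\<lambda>p. Y (fst p) * indicator C (snd p)"
  have proj: "is_optional_projection M F T ?v (\<lambda>_. 0)"
    by (rule is_optional_projection_centered[OF t(1) C]) (use Y1 center in auto)
  have vm: "?v \<in> borel_measurable (M \<Otimes>\<^sub>M IT)" using CI by measurable
  have vb: "\<exists>B. \<forall>p\<in>space M \<times> {0..T}. \<bar>?v p\<bar> \<le> B"
    using Y1 by (intro exI[of _ 1]) (auto simp: indicator_def)
  have "int_conv \<eta> (\<lambda>p. ereal (?v p)) = int_conv \<eta> (\<lambda>p. ereal 0)"
    using opt vm vb proj unfolding optional_measure_def by blast
  then have ic: "int_conv \<eta> (\<lambda>p. ereal (?v p)) = 0" by (simp add: int_conv_def)
  define P where "P = (\<integral>\<^sup>+ \<omega>. ennreal (Y \<omega> * m \<omega>) \<partial>M)"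
  define Q where "Q = (\<integral>\<^sup>+ \<omega>. ennreal (- (Y \<omega> * m \<omega>)) \<partial>M)"
  have "(\<integral>\<^sup>+ p. e2ennreal (ereal (?v p)) \<partial>\<eta>) = (\<integral>\<^sup>+ p. ennreal (Y (fst p)) * indicator C (snd p) \<partial>\<eta>)"
    by (intro nn_integral_cong) (auto simp: indicator_def e2ennreal_ereal)
  also have "\<dots> = (\<integral>\<^sup>+ \<omega>. ennreal (Y \<omega>) * emeasure (\<mu> \<omega>) C \<partial>M)"
    by (rule nn_integral_eta_rect[OF _ CI]) measurable
  also have "\<dots> = P"
    unfolding P_def by (intro nn_integral_cong) (simp add: em m0 ennreal_mult'')
  finally have P: "(\<integral>\<^sup>+ p. e2ennreal (ereal (?v p)) \<partial>\<eta>) = P" .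
  have "(\<integral>\<^sup>+ p. e2ennreal (- ereal (?v p)) \<partial>\<eta>) = (\<integral>\<^sup>+ p. ennreal (- Y (fst p)) * indicator C (snd p) \<partial>\<eta>)"
    by (intro nn_integral_cong) (auto simp: indicator_def e2ennreal_ereal)
  also have "\<dots> = (\<integral>\<^sup>+ \<omega>. ennreal (- Y \<omega>) * emeasure (\<mu> \<omega>) C \<partial>M)"
    by (rule nn_integral_eta_rect[OF _ CI]) measurable
  also have "\<dots> = Q"
    unfolding Q_def by (intro nn_integral_cong) (simp add: em m0 flip: ennreal_mult'')
  finally have Q: "(\<integral>\<^sup>+ p. e2ennreal (- ereal (?v p)) \<partial>\<eta>) = Q" .
  \<comment> \<open>The mass is not assumed to have finite expectation. Integrability of
    \<open>Y * m\<close> comes from the convention of \<open>int_conv\<close>: the value 0 excludes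
    an infinite positive part, and then the negative part is equal to it.\<close>
  have Pfin: "P \<noteq> \<infinity>" and PQ: "enn2ereal P - enn2ereal Q = 0"
    using ic unfolding int_conv_def Let_def P Q by (auto split: if_splits)
  have PQ: "Q = P"
    using Pfin PQ by (cases P; cases Q) (auto simp: enn2ereal_ennreal zero_ereal_def split: if_splits)
  have intYm: "integrable M (\<lambda>\<omega>. Y \<omega> * m \<omega>)"
  proof (rule integrableI_bounded)
    have "(\<integral>\<^sup>+ \<omega>. ennreal (norm (Y \<omega> * m \<omega>)) \<partial>M) = (\<integral>\<^sup>+ \<omega>. ennreal (Y \<omega> * m \<omega>) + ennreal (- (Y \<omega> * m \<omega>)) \<partial>M)"
      by (intro nn_integral_cong) (auto simp: abs_if ennreal_neg)
    also have "\<dots> = P + Q" unfolding P_def Q_def by (rule nn_integral_add) measurable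
    also have "\<dots> < \<infinity>" using Pfin PQ by (simp add: less_top)
    finally show "(\<integral>\<^sup>+ \<omega>. ennreal (norm (Y \<omega> * m \<omega>)) \<partial>M) < \<infinity>" .
  qed measurable
  have Ym0: "(LINT \<omega>|M. Y \<omega> * m \<omega>) = 0"
    using real_lebesgue_integral_def[OF intYm] PQ by (simp add: P_def Q_def)
  \<comment> \<open>Both factors are nonnegative on \<open>A\<close> and both are nonpositive off
    it.\<close>
  define D where "D \<omega> = Y \<omega> * (a - m \<omega>)" for \<omega>
  have D_eq: "D \<omega> = a * Y \<omega> - Y \<omega> * m \<omega>" for \<omega> by (simp add: D_def algebra_simps)
  have D0: "0 \<le> D \<omega>" if "\<omega> \<in> space M" for \<omega>
    using that W01[of \<omega>] by (cases "m \<omega> \<le> a") (auto simp: D_def Y_def A_def mult_nonneg_nonpos)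
  have intD: "integrable M D" unfolding D_eq[abs_def] using intY intYm by simp
  have "(LINT \<omega>|M. D \<omega>) = 0"
    unfolding D_eq[abs_def] using intY intYm Y0 Ym0 by simp
  then have "AE \<omega> in M. D \<omega> = 0"
    using integral_nonneg_eq_0_iff_AE[OF intD] D0 by auto
  then have "AE \<omega> in M. (m \<omega> < a \<longrightarrow> W \<omega> = 1) \<and> (a < m \<omega> \<longrightarrow> W \<omega> = 0)"
    using AE_space
    by eventually_elim (auto simp: D_def Y_def A_def indicator_def split: if_splits)
  then show ?thesis by (intro that[OF WG]) (simp add: m_def)
qed

text \<open>The previous lemma says nothing at the level itself, so the event that the mass is at
  most \<open>a\<close> is cut out by the levels \<open>a + 1 / Suc n\<close>: all the
  \<open>W n\<close> equal 1 if the mass is at most \<open>a\<close>, and some \<open>W n\<close>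
  equals 0 if it is larger.\<close>

lemma measure_mu_adapted:
  assumes opt: "optional_measure M F T \<mu>" and t: "0 \<le> t" "t \<le> T" and C: "C \<in> sets borel" "C \<subseteq> {0..t}"
  shows "(\<lambda>\<omega>. emeasure (\<mu> \<omega>) C) \<in> borel_measurable (Fmeas M (F t))"
proof -
  let ?G = "Fmeas M (F t)"
  let ?m = "\<lambda>\<omega>. measure (\<mu> \<omega>) C"
  have "?m \<in> borel_measurable ?G"
    unfolding borel_measurable_iff_le
  proof
    fix a :: real
    show "{\<omega>\<in>space ?G. ?m \<omega> \<le> a} \<in> sets ?G"
    proof (cases "0 \<le> a")
      case False
      then have "{\<omega>\<in>space ?G. ?m \<omega> \<le> a} = {}"
        using measure_nonneg[of "\<mu> _" C] by (auto simp: not_le intro: less_le_trans)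
      then show ?thesis by (metis sets.empty_sets)
    next
      case True
      have ex: "\<exists>W. W \<in> borel_measurable ?G \<and>
        (AE \<omega> in M. (?m \<omega> < a + 1 / real (Suc n) \<longrightarrow> W \<omega> = (1::real)) \<and> (a + 1 / real (Suc n) < ?m \<omega> \<longrightarrow> W \<omega> = 0))" for n
        by (rule emeasure_mu_level_set[OF opt t C, of "a + 1 / real (Suc n)"]) (use True in auto)
      from choice[OF allI[OF ex]] obtain W where W': "\<forall>n. W n \<in> borel_measurable ?G \<and>
        (AE \<omega> in M. (?m \<omega> < a + 1 / real (Suc n) \<longrightarrow> W n \<omega> = (1::real)) \<and> (a + 1 / real (Suc n) < ?m \<omega> \<longrightarrow> W n \<omega> = 0))" ..
      note W = W'[rule_format, THEN conjunct1] W'[rule_format, THEN conjunct2]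
      let ?B = "{\<omega>\<in>space ?G. \<forall>n. 1/2 < W n \<omega>}"
      have [measurable]: "W n \<in> borel_measurable ?G" for n by (rule W(1))
      have B: "?B \<in> F t"
      proof -
        have "?B \<in> sets ?G" by measurable
        then show ?thesis using t by (simp add: sets_Fmeas)
      qed
      have "AE \<omega> in M. \<forall>n. (?m \<omega> < a + 1 / real (Suc n) \<longrightarrow> W n \<omega> = 1) \<and> (a + 1 / real (Suc n) < ?m \<omega> \<longrightarrow> W n \<omega> = 0)"
        unfolding AE_all_countable using W(2) by (rule allI)
      then have "AE \<omega> in M. \<omega> \<in> {\<omega>\<in>space M. ?m \<omega> \<le> a} \<longleftrightarrow> \<omega> \<in> ?B"
      proof (eventually_elim)
        case (elim \<omega>)
        have "?m \<omega> \<le> a \<longleftrightarrow> (\<forall>n. 1/2 < W n \<omega>)"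
        proof
          assume *: "?m \<omega> \<le> a"
          show "\<forall>n. 1/2 < W n \<omega>"
          proof
            fix n
            have "?m \<omega> < a + 1 / real (Suc n)" using * by (intro order_le_less_trans[OF *]) simp
            then show "1/2 < W n \<omega>" using elim by simp
          qed
        next
          assume *: "\<forall>n. 1/2 < W n \<omega>"
          have "?m \<omega> \<le> a + 1 / real (Suc n)" for n
          proof (rule ccontr)
            assume "\<not> ?m \<omega> \<le> a + 1 / real (Suc n)"
            then have "W n \<omega> = 0" using elim by simp
            then show False using *[rule_format, of n] by simp
          qed
          moreover have "(\<lambda>n. a + 1 / real (Suc n)) \<longlonglongrightarrow> a + 0"
            by (intro tendsto_intros LIMSEQ_Suc lim_1_over_n)
          ultimately show "?m \<omega> \<le> a"
            using LIMSEQ_le_const[of "\<lambda>n. a + 1 / real (Suc n)" a "?m \<omega>"] by auto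
        qed
        then show ?case by simp
      qed
      then have "{\<omega>\<in>space M. ?m \<omega> \<le> a} \<in> F t"
        by (intro AE_eq_in_F[OF B _ _ t(1)]) auto
      then show ?thesis using t by (simp add: sets_Fmeas)
    qed
  qed
  then have "(\<lambda>\<omega>. ennreal (?m \<omega>)) \<in> borel_measurable ?G" by measurable
  then show ?thesis
    by (subst measurable_cong[where g="\<lambda>\<omega>. ennreal (?m \<omega>)"])
      (simp_all add: finite_measure.emeasure_eq_measure[OF finite_mu])
qed

end

section \<open>Convex sets meeting all orthants around a point\<close>

definition signs :: "('d::euclidean_space \<Rightarrow> real) set" where
  "signs = Basis \<rightarrow>\<^sub>E {-1, 1}"

text \<open>An open orthant whose corner is pushed away from \<open>c\<close> by the margin
  \<delta>. Openness is what lets both normality and left-inner semicontinuity be applied to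
  it.\<close>

definition orthant :: "'d::euclidean_space \<Rightarrow> real \<Rightarrow> ('d \<Rightarrow> real) \<Rightarrow> 'd set" where
  "orthant c \<delta> s = {z. \<forall>b\<in>Basis. \<delta> < s b * ((z - c) \<bullet> b)}"

lemma finite_signs: "finite (signs :: ('d::euclidean_space \<Rightarrow> real) set)"
  unfolding signs_def by (intro finite_PiE) auto

lemma open_orthant: "open (orthant c \<delta> s)"
proof -
  have "open (\<Inter>b\<in>Basis. {z. \<delta> < s b * ((z - c) \<bullet> b)})"
    by (intro open_INT ballI open_Collect_less continuous_intros) simp
  also have "(\<Inter>b\<in>Basis. {z. \<delta> < s b * ((z - c) \<bullet> b)}) = orthant c \<delta> s"
    by (auto simp: orthant_def)
  finally show ?thesis .
qed

text \<open>If a point \<open>z\<close> of the ball were missing, a hyperplane with normal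
  \<open>a\<close> would separate it from \<open>D\<close>; but \<open>D\<close> also has a point
  strictly on the opposite side of \<open>z\<close> from \<open>a\<close> in every coordinate, which
  forces \<open>a\<close> to vanish.\<close>

lemma convex_meets_orthants_imp_cball_subset:
  fixes c :: "'d::euclidean_space"
  assumes D: "convex D" and meets: "\<And>s. s \<in> signs \<Longrightarrow> D \<inter> orthant c \<delta> s \<noteq> {}"
  shows "cball c \<delta> \<subseteq> D"
proof (rule ccontr)
  assume "\<not> cball c \<delta> \<subseteq> D"
  then obtain z where "z \<in> cball c \<delta>" and zD: "z \<notin> D" by blast
  then have z: "z \<notin> D" "norm (z - c) \<le> \<delta>" by (simp_all add: dist_norm norm_minus_commute)
  have "convex ((\<lambda>x. x - z) ` D)" using D by (rule convex_translation_subtract)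
  moreover have "0 \<notin> (\<lambda>x. x - z) ` D" using z by auto
  ultimately obtain a where a: "a \<noteq> 0" "\<forall>x\<in>(\<lambda>x. x - z) ` D. 0 \<le> a \<bullet> x"
    using separating_hyperplane_set_0 by blast
  \<comment> \<open>Signs opposite to those of \<open>a\<close>; where a coordinate of
    \<open>a\<close> is 0 either sign would do.\<close>
  define s where "s = (\<lambda>b\<in>Basis. if a \<bullet> b \<le> 0 then 1 else -1 :: real)"
  have "s \<in> signs" by (auto simp: s_def signs_def)
  then obtain x where x: "x \<in> D" "x \<in> orthant c \<delta> s" using meets by blast
  have lt: "0 < s b * ((x - z) \<bullet> b)" if b: "b \<in> Basis" for b
  proof -
    have "\<bar>(z - c) \<bullet> b\<bar> \<le> \<delta>" using Basis_le_norm[OF b, of "z - c"] z(2) by simp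
    moreover have "\<bar>s b\<bar> = 1" using b by (simp add: s_def)
    ultimately have "s b * ((z - c) \<bullet> b) \<le> \<delta>"
      by (metis abs_le_D1 abs_mult mult_1)
    moreover have "\<delta> < s b * ((x - c) \<bullet> b)" using x(2) b by (simp add: orthant_def)
    moreover have "s b * ((x - z) \<bullet> b) = s b * ((x - c) \<bullet> b) - s b * ((z - c) \<bullet> b)"
      by (simp add: inner_diff_left algebra_simps)
    ultimately show ?thesis by linarith
  qed
  have le: "0 \<le> - ((a \<bullet> b) * ((x - z) \<bullet> b))" if b: "b \<in> Basis" for b
    using lt[OF b] b by (cases "a \<bullet> b \<le> 0") (auto simp: s_def mult_nonpos_nonneg mult_nonneg_nonpos)
  have "(\<Sum>b\<in>Basis. - ((a \<bullet> b) * ((x - z) \<bullet> b))) = - (a \<bullet> (x - z))"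
    by (subst euclidean_inner) (simp add: sum_negf)
  moreover have "0 \<le> a \<bullet> (x - z)" using a(2) x(1) by blast
  moreover have "0 \<le> (\<Sum>b\<in>Basis. - ((a \<bullet> b) * ((x - z) \<bullet> b)))" using le by (intro sum_nonneg) blast
  ultimately have "(\<Sum>b\<in>Basis. - ((a \<bullet> b) * ((x - z) \<bullet> b))) = 0" by linarith
  then have 0: "(a \<bullet> b) * ((x - z) \<bullet> b) = 0" if "b \<in> Basis" for b
    using sum_nonneg_eq_0_iff[of Basis "\<lambda>b. - ((a \<bullet> b) * ((x - z) \<bullet> b))"] le that by auto
  have "a \<bullet> b = 0" if "b \<in> Basis" for b
    using 0[OF that] lt[OF that] by (auto simp: mult_eq_0_iff)
  then show False using a(1) euclidean_all_zero_iff by blast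
qed

lemma ball_subset_imp_meets_orthants:
  fixes c :: "'d::euclidean_space" and \<delta> \<rho> :: real
  assumes "ball c \<rho> \<subseteq> D" "0 < \<delta>" "2 * \<delta> * DIM('d) < \<rho>" "s \<in> signs"
  shows "D \<inter> orthant c \<delta> s \<noteq> {}"
proof -
  \<comment> \<open>A shift by \<open>2 * \<delta>\<close> along each axis lies strictly beyond the
    margin \<delta>, and by the triangle inequality its length is at most
    \<open>2 * \<delta> * DIM('d)\<close>.\<close>
  let ?z = "c + (\<Sum>b\<in>Basis. (2 * \<delta> * s b) *\<^sub>R b)"
  have s: "s b = -1 \<or> s b = 1" if "b \<in> Basis" for b
    using assms(4) that by (auto simp: signs_def)
  have "norm (\<Sum>b\<in>(Basis::'d set). (2 * \<delta> * s b) *\<^sub>R b) \<le> (\<Sum>b\<in>(Basis::'d set). 2 * \<delta>)"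
  proof (rule sum_norm_le)
    fix b :: 'd assume b: "b \<in> Basis"
    then show "norm ((2 * \<delta> * s b) *\<^sub>R b) \<le> 2 * \<delta>"
      using s[OF b] assms(2) by (auto simp: abs_mult)
  qed
  then have "dist c ?z < \<rho>" using assms(3) by (simp add: dist_norm mult.commute)
  then have "?z \<in> D" using assms(1) by auto
  moreover have "?z \<in> orthant c \<delta> s"
    unfolding orthant_def
  proof (intro CollectI ballI)
    fix b :: 'd assume b: "b \<in> Basis"
    have "(?z - c) \<bullet> b = 2 * \<delta> * s b"
      using b by (simp add: inner_sum_left inner_Basis if_distrib sum.delta cong: if_cong)
    then show "\<delta> < s b * ((?z - c) \<bullet> b)"
      using s[OF b] assms(2) by auto
  qed
  ultimately show ?thesis by blast
qed

text \<open>The domain is the projection of the epigraph, so for open \<open>G\<close> this becomes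
  a condition on an open cylinder, the form in which normality is stated.\<close>

lemma dom_h_meets_iff: "dom_h f \<inter> G \<noteq> {} \<longleftrightarrow> epi f \<inter> (G \<times> UNIV) \<noteq> {}"
proof
  assume "dom_h f \<inter> G \<noteq> {}"
  then obtain x where x: "f x < \<infinity>" "x \<in> G" by (auto simp: dom_h_def)
  then obtain a :: real where "f x \<le> ereal a" by (cases "f x") auto
  then have "(x, a) \<in> epi f \<inter> (G \<times> UNIV)" using x(2) by (simp add: epi_def)
  then show "epi f \<inter> (G \<times> UNIV) \<noteq> {}" by blast
next
  assume "epi f \<inter> (G \<times> UNIV) \<noteq> {}"
  then obtain x and a :: real where "f x \<le> ereal a" "x \<in> G" by (auto simp: epi_def)
  then have "f x < \<infinity>" by (auto intro: order_le_less_trans)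
  then have "x \<in> dom_h f \<inter> G" using \<open>x \<in> G\<close> by (simp add: dom_h_def)
  then show "dom_h f \<inter> G \<noteq> {}" by blast
qed

lemma convex_dom_h:
  fixes f :: "'d::euclidean_space \<Rightarrow> ereal"
  assumes "convex (epi f)"
  shows "convex (dom_h f)"
proof -
  have "dom_h f = fst ` epi f"
    using dom_h_meets_iff[of f "{_}"] by (force simp: image_iff)
  then show ?thesis using convex_linear_image[OF linear_fst assms] by simp
qed

lemma left_open_finite_Inter:
  assumes "finite S" "\<And>s. s \<in> S \<Longrightarrow> left_open T (U s)" "\<And>s. s \<in> S \<Longrightarrow> t \<in> U s"
  shows "\<exists>r<t. \<forall>s\<in>S. {r<..t} \<inter> {0..T} \<subseteq> U s"
  using assms
proof (induction S rule: finite_induct)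
  case empty
  show ?case by (auto intro: exI[of _ "t - 1"])
next
  case (insert s S)
  then obtain r where r: "r < t" "\<forall>s\<in>S. {r<..t} \<inter> {0..T} \<subseteq> U s" by auto
  from insert.prems obtain r' where r': "r' < t" "{r'<..t} \<inter> {0..T} \<subseteq> U s"
    unfolding left_open_def by blast
  have "{max r r'<..t} \<inter> {0..T} \<subseteq> {r<..t} \<inter> {0..T}" "{max r r'<..t} \<inter> {0..T} \<subseteq> {r'<..t} \<inter> {0..T}"
    by auto
  then have "\<forall>s\<in>insert s S. {max r r'<..t} \<inter> {0..T} \<subseteq> U s"
    using r(2) r'(2) by blast
  then show ?case using r(1) r'(1) by (intro exI[of _ "max r r'"]) simp
qed

section \<open>Exit times measured by the random measure\<close>

context random_measure_space
begin

lemma bv_sets_Diff: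
  assumes "A \<in> bv_sets" "B \<in> bv_sets"
  shows "A - B \<in> bv_sets"
proof -
  have "A \<subseteq> space M \<times> {0..T}"
    using assms(1) sets.sets_into_space[of A Pred] by (auto simp: bv_sets_def sets_Pred space_Pred)
  then have "A - B = space M \<times> {0..T} - ((space M \<times> {0..T} - A) \<union> B)" by blast
  then show ?thesis using assms by (simp add: bv_sets_Compl bv_sets_Un)
qed

text \<open>Predictable sets are progressively measurable: a rectangle that starts after
  \<open>t\<close> disappears under the cut, and one that starts before has its event in
  \<open>F t\<close>. Thus the exit mass at \<open>t\<close> uses only what is known at
  \<open>t\<close>.\<close>

lemma predictable_progressive:
  assumes B: "B \<in> predictable_sets M F T" and t: "0 \<le> t"
  shows "B \<inter> (space M \<times> {..t}) \<in> sets (Fmeas M (F t) \<Otimes>\<^sub>M IT)"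
proof -
  let ?P = "Fmeas M (F t) \<Otimes>\<^sub>M IT"
  have rect: "A \<times> C \<in> sets ?P" if "A \<in> F t" "C \<in> sets borel" "C \<subseteq> {0..T}" for A C
    using that t by (intro pair_measureI) (auto simp: sets_Fmeas sets_IT)
  have sub: "A \<subseteq> space M" if "A \<in> F s" "0 \<le> s" for A s
    using that F_subset sets.sets_into_space by blast
  have spF: "space M \<in> F t" using sets.top[of "Fmeas M (F t)"] t by (simp add: sets_Fmeas)
  have "B \<in> sigma_sets (space M \<times> {0..T}) rects" using B predictable_sets_subset_rects by blast
  then show ?thesis
  proof induction
    case (Basic B)
    then consider A where "A \<in> F 0" "B = A \<times> {0..T}"
      | A s where "0 \<le> s" "s \<le> T" "A \<in> F s" "B = A \<times> {s<..T}"
      unfolding rects_def by blast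
    then show ?case
    proof cases
      case 1
      have "B \<inter> (space M \<times> {..t}) = A \<times> ({0..T} \<inter> {..t})" using sub[OF 1(1)] 1(2) by auto
      moreover have "A \<in> F t" using 1(1) F_mono[of 0 t] t by auto
      ultimately show ?thesis using rect[of A "{0..T} \<inter> {..t}"] by simp
    next
      case 2
      show ?thesis
      proof (cases "s \<le> t")
        case True
        have "B \<inter> (space M \<times> {..t}) = A \<times> ({s<..T} \<inter> {..t})" using sub[OF 2(3,1)] 2(4) by auto
        moreover have "A \<in> F t" using 2(1,3) F_mono[of s t] True by auto
        moreover have "{s<..T} \<inter> {..t} \<subseteq> {0..T}" using 2(1) by auto
        ultimately show ?thesis using rect[of A "{s<..T} \<inter> {..t}"] by simp
      next
        case False
        then have "B \<inter> (space M \<times> {..t}) = {}" using 2(4) by auto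
        then show ?thesis by simp
      qed
    qed
  next
    case Empty show ?case by simp
  next
    case (Compl B)
    have "(space M \<times> {0..T} - B) \<inter> (space M \<times> {..t}) = space M \<times> ({0..T} \<inter> {..t}) - B \<inter> (space M \<times> {..t})"
      by auto
    moreover have "space M \<times> ({0..T} \<inter> {..t}) \<in> sets ?P" using spF by (intro rect) auto
    ultimately show ?case using sets.Diff[OF _ Compl.IH] by simp
  next
    case (Union B)
    have eq: "\<Union>(range B) \<inter> (space M \<times> {..t}) = (\<Union>i. B i \<inter> (space M \<times> {..t}))" by auto
    show ?case unfolding eq using Union.IH by (intro sets.countable_UN) blast
  qed
qed

text \<open>The exit time from \<open>U\<close> after \<open>q\<close> is measured by \<open>\<mu>\<close>: it is the first time at which the
  continuous adapted increasing process below becomes positive. This replaces debut and section theorems.\<close>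
definition exit_mass :: "('a \<times> real) set \<Rightarrow> real \<Rightarrow> 'a \<Rightarrow> real \<Rightarrow> ennreal" where
  "exit_mass U q \<omega> t = emeasure (\<mu> \<omega>) (Pair \<omega> -` (space M \<times> {q<..t} - U))"

lemma exit_mass_cut:
  assumes U: "U \<in> predictable_sets M F T" and "0 \<le> q" "t \<le> T"
  shows "space M \<times> {q<..t} - U \<in> sets \<eta>"
proof -
  have "space M \<times> {q<..t} \<in> sets \<eta>"
    using assms by (auto simp: sets_eta sets_IT intro!: pair_measureI)
  then show ?thesis using U predictable_sets_eta by auto
qed

lemma exit_mass_mono:
  assumes U: "U \<in> predictable_sets M F T" and "0 \<le> q" "s \<le> t" "t \<le> T" and \<omega>: "\<omega> \<in> space M"
  shows "exit_mass U q \<omega> s \<le> exit_mass U q \<omega> t"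
  unfolding exit_mass_def
  using cut_sets_mu[OF exit_mass_cut[OF U assms(2,4)] \<omega>] assms(3) by (intro emeasure_mono) auto

lemma exit_mass_adapted:
  assumes opt: "optional_measure M F T \<mu>" and U: "U \<in> predictable_sets M F T" and q: "0 \<le> q" and t: "0 \<le> t" "t \<le> T"
  shows "(\<lambda>\<omega>. exit_mass U q \<omega> t) \<in> borel_measurable (Fmeas M (F t))"
proof -
  let ?G = "Fmeas M (F t)"
  let ?D = "space M \<times> {q<..t} - U"
  \<comment> \<open>Only masses of subsets of [0, t] are known to be measurable for
    \<open>F t\<close>, so the kernel lemma is applied to the restriction of \<mu> to that
    interval.\<close>
  let ?\<kappa> = "\<lambda>\<omega>. density (\<mu> \<omega>) (indicator {0..t})"
  have It: "{0..t} \<in> sets IT" using t by (simp add: sets_IT)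
  have spF: "space M \<in> F t" using sets.top[of ?G] t by (simp add: sets_Fmeas)
  have \<kappa>: "emeasure (?\<kappa> \<omega>) C = emeasure (\<mu> \<omega>) ({0..t} \<inter> C)" if "C \<in> sets IT" "\<omega> \<in> space M" for C \<omega>
    using that It by (intro emeasure_restricted) (simp_all add: sets_mu)
  have "space M \<times> {q<..t} - U \<inter> (space M \<times> {..t}) \<in> sets (?G \<Otimes>\<^sub>M IT)"
  proof (intro sets.Diff predictable_progressive U t(1))
    show "space M \<times> {q<..t} \<in> sets (?G \<Otimes>\<^sub>M IT)"
      using spF q t by (intro pair_measureI) (auto simp: sets_Fmeas sets_IT)
  qed
  also have "space M \<times> {q<..t} - U \<inter> (space M \<times> {..t}) = ?D" by auto
  finally have D: "?D \<in> sets (?G \<Otimes>\<^sub>M IT)" .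
  have "(\<lambda>\<omega>. emeasure (?\<kappa> \<omega>) (Pair \<omega> -` ?D)) \<in> borel_measurable ?G"
  proof (rule measurable_emeasure_finite_kernel[OF _ _ _ D])
    show "sets (?\<kappa> \<omega>) = sets IT" if "\<omega> \<in> space ?G" for \<omega> using that by (simp add: sets_mu)
    show "finite_measure (?\<kappa> \<omega>)" if "\<omega> \<in> space ?G" for \<omega>
      using that It by (intro finite_measure.finite_measure_restricted finite_mu) (simp_all add: sets_mu)
    fix C assume C: "C \<in> sets IT"
    have "(\<lambda>\<omega>. emeasure (\<mu> \<omega>) ({0..t} \<inter> C)) \<in> borel_measurable ?G"
      using C by (intro measure_mu_adapted[OF opt t]) (auto simp: sets_IT)
    then show "(\<lambda>\<omega>. emeasure (?\<kappa> \<omega>) C) \<in> borel_measurable ?G"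
      by (rule measurable_cong[THEN iffD2, rotated]) (simp add: \<kappa>[OF C])
  qed
  then show ?thesis
  proof (rule measurable_cong[THEN iffD2, rotated])
    fix \<omega> assume "\<omega> \<in> space ?G"
    then have \<omega>: "\<omega> \<in> space M" by simp
    have "Pair \<omega> -` ?D \<in> sets IT" using cut_sets_mu[OF exit_mass_cut[OF U q t(2)] \<omega>] sets_mu[OF \<omega>] by simp
    moreover have "{0..t} \<inter> Pair \<omega> -` ?D = Pair \<omega> -` ?D" using q by auto
    ultimately show "exit_mass U q \<omega> t = emeasure (?\<kappa> \<omega>) (Pair \<omega> -` ?D)"
      using \<kappa>[OF _ \<omega>] by (simp add: exit_mass_def)
  qed
qed

text \<open>This is left continuity in the form required by \<open>bv_sets_mono_01\<close>. Without
  an atom at \<open>t\<close>, the exit set up to \<open>t\<close> is, up to a null set, the union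
  of the exit sets up to \<open>t - 1 / Suc n\<close>, so one of these is charged.\<close>

lemma exit_mass_left:
  assumes U: "U \<in> predictable_sets M F T" and q: "0 \<le> q" and t: "t \<le> T" and \<omega>: "\<omega> \<in> space M"
    and atom: "emeasure (\<mu> \<omega>) {t} = 0" and pos: "0 < exit_mass U q \<omega> t"
  shows "\<exists>s<t. q < s \<and> 0 < exit_mass U q \<omega> s"
proof (rule ccontr)
  assume neg: "\<not> ?thesis"
  have 0: "exit_mass U q \<omega> s = 0" if "s < t" "q < s" for s
    using that neg by (metis not_gr_zero)
  have qt: "q < t"
  proof (rule ccontr)
    assume "\<not> q < t"
    then show False using pos by (simp add: exit_mass_def)
  qed
  let ?D = "\<lambda>s. Pair \<omega> -` (space M \<times> {q<..s} - U)"
  have D: "?D s \<in> sets (\<mu> \<omega>)" if "s \<le> T" for s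
    by (rule cut_sets_mu[OF exit_mass_cut[OF U q that] \<omega>])
  have s0: "?D (t - 1 / real (Suc n)) \<in> null_sets (\<mu> \<omega>)" for n
  proof -
    have le: "t - 1 / real (Suc n) < t" by simp
    have "emeasure (\<mu> \<omega>) (?D (t - 1 / real (Suc n))) = 0"
    proof (cases "q < t - 1 / real (Suc n)")
      case True
      then show ?thesis using 0[OF le] by (simp add: exit_mass_def)
    next
      case False
      then have "{q<..t - 1 / real (Suc n)} = {}" by auto
      then show ?thesis by simp
    qed
    moreover have "t - 1 / real (Suc n) \<le> T" using le t by linarith
    ultimately show ?thesis using D by (intro null_setsI)
  qed
  have "{t} \<in> null_sets (\<mu> \<omega>)"
    using atom sets_mu[OF \<omega>] q qt t by (auto simp: sets_IT)
  then have "(\<Union>n. ?D (t - 1 / real (Suc n))) \<union> {t} \<in> null_sets (\<mu> \<omega>)"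
    using s0 by (intro null_sets.Un null_sets_UN) auto
  moreover have "?D t \<subseteq> (\<Union>n. ?D (t - 1 / real (Suc n))) \<union> {t}"
  proof
    fix s assume s: "s \<in> ?D t"
    show "s \<in> (\<Union>n. ?D (t - 1 / real (Suc n))) \<union> {t}"
    proof (cases "s = t")
      case False
      then have "0 < t - s" using s by auto
      then obtain n where "1 / real (Suc n) < t - s" using nat_approx_posE by metis
      then have "s \<in> ?D (t - 1 / real (Suc n))" using s by auto
      then show ?thesis by blast
    qed simp
  qed
  ultimately have "?D t \<in> null_sets (\<mu> \<omega>)" using null_sets_subset D[OF t] by blast
  then show False using pos by (auto simp: exit_mass_def)
qed

text \<open>\<open>V\<close> consists of the times after \<open>q\<close> at which no mass has yet
  been charged outside \<open>U\<close>. Staying in \<open>U\<close> on the whole of (q, t] puts t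
  in \<open>V\<close>; conversely, the part of \<open>V\<close> outside \<open>U\<close> carries no
  mass, although it may be nonempty.\<close>

lemma bv_sets_exit:
  assumes opt: "optional_measure M F T \<mu>" and atomless: "AE \<omega> in M. \<forall>t. emeasure (\<mu> \<omega>) {t} = 0"
    and U: "U \<in> predictable_sets M F T" and q: "0 \<le> q" "q \<le> T"
  obtains V where "V \<in> bv_sets" "V - U \<in> null_sets \<eta>"
    "AE \<omega> in M. \<forall>t\<in>{q<..T}. (\<forall>s\<in>{q<..t}. (\<omega>, s) \<in> U) \<longrightarrow> (\<omega>, t) \<in> V"
proof -
  obtain N where N: "\<And>\<omega>. \<omega> \<in> space M - N \<Longrightarrow> \<forall>t. emeasure (\<mu> \<omega>) {t} = 0" "N \<in> null_sets M"
    using AE_E3[OF atomless] by blast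
  \<comment> \<open>On the exceptional null set and after \<open>T\<close> the value is forced to 1
    as soon as \<open>t > q\<close>, so that monotonicity and left continuity hold for every
    \<omega>, as predictability demands.\<close>
  define f where "f \<omega> t = (if t \<le> q then 0 else if T < t \<or> \<omega> \<notin> space M - N then 1
      else if 0 < exit_mass U q \<omega> t then 1 else (0::real))" for \<omega> t
  have f01: "f \<omega> t \<in> {0, 1}" for \<omega> t by (simp add: f_def)
  have "{p \<in> space M \<times> {0..T}. f (fst p) (snd p) = 1} \<in> bv_sets" (is "?V1 \<in> _")
  proof (rule bv_sets_mono_01)
    show "adapted_on M F {0..} f"
      unfolding adapted_on_def
    proof
      fix t :: real assume t: "t \<in> {0..}"
      let ?G = "Fmeas M (F t)"
      consider "t \<le> q" | "q < t" "T < t" | "q < t" "t \<le> T" by linarith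
      then show "(\<lambda>\<omega>. f \<omega> t) \<in> borel_measurable ?G"
      proof cases
        case 3
        have NF[measurable]: "N \<in> sets ?G" using null_set_in_F[OF N(2) order_refl, of t] t by (simp add: sets_Fmeas)
        have [measurable]: "(\<lambda>\<omega>. exit_mass U q \<omega> t) \<in> borel_measurable ?G"
          using t 3 by (intro exit_mass_adapted opt U q) auto
        have "(\<lambda>\<omega>. if \<omega> \<in> N then 1 else if 0 < exit_mass U q \<omega> t then 1 else (0::real)) \<in> borel_measurable ?G"
          by measurable
        then show ?thesis
          by (rule measurable_cong[THEN iffD2, rotated]) (use 3 in \<open>simp add: f_def\<close>)
      qed (simp_all add: f_def)
    qed
    show "mono (f \<omega>)" for \<omega>
    proof (rule monoI)
      fix s t :: real assume st: "s \<le> t"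
      show "f \<omega> s \<le> f \<omega> t"
      proof (cases "q < s \<and> t \<le> T \<and> \<omega> \<in> space M - N")
        case True
        then have "exit_mass U q \<omega> s \<le> exit_mass U q \<omega> t"
          using st q by (intro exit_mass_mono U) auto
        then show ?thesis using st by (auto simp: f_def)
      next
        case False
        then show ?thesis using st by (auto simp: f_def)
      qed
    qed
    show "\<exists>s<t. f \<omega> s = 1" if t: "f \<omega> t = 1" for \<omega> t
    proof (cases "t \<le> T \<and> \<omega> \<in> space M - N")
      case True
      then have "0 < exit_mass U q \<omega> t" "q < t" using t by (auto simp: f_def split: if_splits)
      then obtain s where s: "s < t" "q < s" "0 < exit_mass U q \<omega> s"
        using exit_mass_left[OF U q(1), of t \<omega>] True N(1)[of \<omega>] by blast
      then have "f \<omega> s = 1" by (simp add: f_def)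
      then show ?thesis using s(1) by blast
    next
      case False
      have qt: "q < t" using t by (auto simp: f_def split: if_splits)
      show ?thesis
      proof (cases "t \<le> T")
        case True
        with False have "\<omega> \<notin> space M - N" by blast
        moreover obtain s where "q < s" "s < t" using dense[OF qt] by blast
        moreover from calculation have "f \<omega> s = 1" by (simp add: f_def)
        ultimately show ?thesis by blast
      next
        case False
        then obtain s where s: "T < s" "s < t" using dense[of T t] by auto
        then have "f \<omega> s = 1" using q by (simp add: f_def)
        then show ?thesis using s by blast
      qed
    qed
    show "f \<omega> t = f \<omega> 0" if "t \<le> 0" for \<omega> t using that q by (simp add: f_def)
    show "f \<omega> s = f \<omega> t" if "T < s" "T < t" for \<omega> s t using that q by (simp add: f_def)
  qed (rule f01)
  moreover have "space M \<times> {q<..T} \<in> bv_sets"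
  proof -
    have "space M \<in> F q" using sets.top[of "Fmeas M (F q)"] q by (simp add: sets_Fmeas)
    then have "space M \<times> {q<..T} \<in> rects" using q unfolding rects_def by blast
    then show ?thesis using rects_bv_sets by blast
  qed
  ultimately have V: "space M \<times> {q<..T} - ?V1 \<in> bv_sets" (is "?V \<in> _") by (intro bv_sets_Diff)
  have V_iff: "(\<omega>, t) \<in> ?V \<longleftrightarrow> q < t \<and> t \<le> T \<and> exit_mass U q \<omega> t = 0" if "\<omega> \<in> space M - N" for \<omega> t
    using that q by (auto simp: f_def not_gr_zero)
  show ?thesis
  proof (rule that[OF V])
    show "?V - U \<in> null_sets \<eta>"
    proof (rule null_sets_etaI)
      show VU: "?V - U \<in> sets \<eta>" using V U predictable_sets_eta by (auto simp: bv_sets_def)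
      have "emeasure (\<mu> \<omega>) (Pair \<omega> -` (?V - U)) = 0" if \<omega>: "\<omega> \<in> space M - N" for \<omega>
      proof -
        let ?D = "\<lambda>s. Pair \<omega> -` (space M \<times> {q<..s} - U)"
        let ?Z = "{t. q < t \<and> t \<le> T \<and> exit_mass U q \<omega> t = 0}"
        \<comment> \<open>\<open>?Z\<close> is an interval starting at \<open>q\<close>. Every point
          of it lies below some rational of \<open>?Z\<close>, except possibly an irrational
          maximum, which is all that \<open>?X\<close> can contain. This reduces the estimate to
          countably many null exit sets and one point.\<close>
        let ?X = "{t\<in>?Z. \<forall>r\<in>\<rat> \<inter> ?Z. r < t}"
        have \<omega>M: "\<omega> \<in> space M" using \<omega> by simp
        have D0: "?D r \<in> null_sets (\<mu> \<omega>)" if "r \<in> \<rat> \<inter> ?Z" for r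
          using that cut_sets_mu[OF exit_mass_cut[OF U q(1), of r] \<omega>M] by (auto simp: exit_mass_def)
        have X1: "False" if st: "s \<in> ?X" "t \<in> ?X" "s < t" for s t
        proof -
          obtain r where r: "r \<in> \<rat>" "s < r" "r < t" using Rats_dense_in_real[OF st(3)] by blast
          have "exit_mass U q \<omega> r \<le> exit_mass U q \<omega> t"
            using st r q by (intro exit_mass_mono U \<omega>M) auto
          then have "r \<in> \<rat> \<inter> ?Z" using st r by auto
          then have "r < s" using st(1) by blast
          then show False using r by simp
        qed
        have "?X \<in> null_sets (\<mu> \<omega>)"
        proof (cases "?X = {}")
          case False
          then obtain t where t: "t \<in> ?X" by blast
          have "?X \<subseteq> {t}"
          proof
            fix s assume "s \<in> ?X"
            then show "s \<in> {t}" using X1[of s t] X1[of t s] t by (metis linorder_neqE singletonI)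
          qed
          then have "?X = {t}" using t by blast
          moreover have "{t} \<in> null_sets (\<mu> \<omega>)"
            using N(1)[OF \<omega>] sets_mu[OF \<omega>M] t q by (auto simp: sets_IT)
          ultimately show ?thesis by simp
        qed (metis null_sets.empty_sets)
        moreover have "(\<Union>r\<in>\<rat> \<inter> ?Z. ?D r) \<in> null_sets (\<mu> \<omega>)"
          using D0 by (intro null_sets_UN' countable_subset[OF _ countable_rat]) auto
        ultimately have "(\<Union>r\<in>\<rat> \<inter> ?Z. ?D r) \<union> ?X \<in> null_sets (\<mu> \<omega>)" by (intro null_sets.Un)
        moreover have "Pair \<omega> -` (?V - U) \<subseteq> (\<Union>r\<in>\<rat> \<inter> ?Z. ?D r) \<union> ?X"
        proof
          fix t assume t: "t \<in> Pair \<omega> -` (?V - U)"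
          then have tZ: "t \<in> ?Z" "(\<omega>, t) \<notin> U" using V_iff[OF \<omega>, of t] by auto
          show "t \<in> (\<Union>r\<in>\<rat> \<inter> ?Z. ?D r) \<union> ?X"
          proof (cases "\<forall>r\<in>\<rat> \<inter> ?Z. r < t")
            case False
            then obtain r where "r \<in> \<rat> \<inter> ?Z" "t \<le> r" by (auto simp: not_less)
            then have "t \<in> ?D r" using tZ \<omega>M by auto
            then show ?thesis using \<open>r \<in> \<rat> \<inter> ?Z\<close> by blast
          qed (use tZ in blast)
        qed
        ultimately have "Pair \<omega> -` (?V - U) \<in> null_sets (\<mu> \<omega>)"
          using null_sets_subset cut_sets_mu[OF VU \<omega>M] by blast
        then show ?thesis by auto
      qed
      note null = this
      show "AE \<omega> in M. emeasure (\<mu> \<omega>) (Pair \<omega> -` (?V - U)) = 0"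
        using AE_not_in[OF N(2)] AE_space
      proof eventually_elim
        case (elim \<omega>)
        then show ?case by (intro null) blast
      qed
    qed
    have in_V: "(\<omega>, t) \<in> ?V" if "\<omega> \<in> space M - N" "t \<in> {q<..T}" "\<forall>s\<in>{q<..t}. (\<omega>, s) \<in> U" for \<omega> t
    proof -
      have "Pair \<omega> -` (space M \<times> {q<..t} - U) = {}" using that(3) by auto
      then have "exit_mass U q \<omega> t = 0" by (simp only: exit_mass_def emeasure_empty)
      then show ?thesis using V_iff[OF that(1), of t] that(2) by simp
    qed
    show "AE \<omega> in M. \<forall>t\<in>{q<..T}. (\<forall>s\<in>{q<..t}. (\<omega>, s) \<in> U) \<longrightarrow> (\<omega>, t) \<in> ?V"
      using AE_not_in[OF N(2)] AE_space
    proof eventually_elim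
      case (elim \<omega>)
      then show ?case using in_V[of \<omega>] by blast
    qed
  qed
qed

end

section \<open>Normal integrands\<close>

lemma borel_measurable_ereal_leI:
  fixes f :: "'b \<Rightarrow> ereal"
  assumes "\<And>a::real. {x \<in> space N. f x \<le> ereal a} \<in> sets N"
  shows "f \<in> borel_measurable N"
  unfolding borel_measurable_iff_Iic_ereal
proof
  fix b
  show "f -` {..b} \<inter> space N \<in> sets N"
  proof (cases b)
    case (real r)
    have "f -` {..b} \<inter> space N = {x \<in> space N. f x \<le> ereal r}" using real by auto
    then show ?thesis using assms by simp
  next
    case PInf
    then show ?thesis by (simp add: vimage_def)
  next
    case MInf
    have "f x \<le> -\<infinity> \<longleftrightarrow> (\<forall>n::nat. f x \<le> ereal (- real n))" for x
    proof
      assume *: "\<forall>n::nat. f x \<le> ereal (- real n)"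
      show "f x \<le> -\<infinity>"
      proof (cases "f x")
        case (real r)
        obtain n where "- r < real n" using reals_Archimedean2 by blast
        then show ?thesis using *[rule_format, of n] real by simp
      qed (use * in auto)
    qed simp
    then have "f -` {..b} \<inter> space N = (\<Inter>n::nat. {x \<in> space N. f x \<le> ereal (- real n)})"
      using MInf by auto
    then show ?thesis using assms by auto
  qed
qed

locale integrand_space = random_measure_space M F T \<mu>
  for M :: "'a measure" and F :: "real \<Rightarrow> 'a set set" and T :: real and \<mu> :: "'a \<Rightarrow> real measure" +
  fixes h :: "'a \<Rightarrow> real \<Rightarrow> 'd::euclidean_space \<Rightarrow> ereal"
  assumes normal: "predictable_convex_normal_integrand M F T h"
    and opt: "optional_measure M F T \<mu>"
    and atomless: "AE \<omega> in M. \<forall>t. emeasure (\<mu> \<omega>) {t} = 0"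
begin

abbreviation dom :: "'a \<times> real \<Rightarrow> 'd set" where "dom p \<equiv> dom_h (h (fst p) (snd p))"

lemma convex_epi: "p \<in> space M \<times> {0..T} \<Longrightarrow> convex (epi (h (fst p) (snd p)))"
  and closed_epi: "p \<in> space M \<times> {0..T} \<Longrightarrow> closed (epi (h (fst p) (snd p)))"
  using normal unfolding predictable_convex_normal_integrand_def by auto

lemma epi_meets_predictable:
  "open G \<Longrightarrow> {p \<in> space M \<times> {0..T}. epi (h (fst p) (snd p)) \<inter> G \<noteq> {}} \<in> predictable_sets M F T"
  using normal unfolding predictable_convex_normal_integrand_def by blast

text \<open>Since the epigraph is closed, the value at \<open>x p\<close> is at most
  \<open>a\<close> exactly when the epigraph comes arbitrarily close to \<open>(x p, a)\<close> or
  to points below it, a countable combination of conditions on open sets.\<close>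

lemma integrand_measurable_Pred:
  assumes x: "x \<in> borel_measurable Pred"
  shows "(\<lambda>p. h (fst p) (snd p) (x p)) \<in> borel_measurable Pred"
proof -
  obtain E :: "'d set" where E: "countable E" "\<And>X. open X \<Longrightarrow> X \<noteq> {} \<Longrightarrow> \<exists>d\<in>E. d \<in> X"
    using countable_dense_setE by blast
  have "{p \<in> space Pred. h (fst p) (snd p) (x p) \<le> ereal a} \<in> sets Pred" for a
  proof -
    \<comment> \<open>Normality concerns fixed open sets, while \<open>x p\<close> varies with
      \<open>p\<close>; a nearby point \<open>d\<close> of a countable dense set decouples them. The
      box is unbounded below because epigraphs are closed upwards.\<close>
    let ?W = "\<lambda>n d. {p \<in> space Pred. dist d (x p) < 1 / real (Suc n)}
        \<inter> {p \<in> space M \<times> {0..T}. epi (h (fst p) (snd p)) \<inter> (ball d (1 / real (Suc n)) \<times> {..<a + 1 / real (Suc n)}) \<noteq> {}}"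
    have "{p \<in> space Pred. h (fst p) (snd p) (x p) \<le> ereal a} = (\<Inter>n. \<Union>d\<in>E. ?W n d)" (is "?l = ?r")
    proof (intro set_eqI iffI)
      fix p assume p: "p \<in> ?l"
      show "p \<in> ?r"
      proof
        fix n
        obtain d where d: "d \<in> E" "d \<in> ball (x p) (1 / real (Suc n))"
          using E(2)[of "ball (x p) (1 / real (Suc n))"] by auto
        have "(x p, a) \<in> epi (h (fst p) (snd p)) \<inter> (ball d (1 / real (Suc n)) \<times> {..<a + 1 / real (Suc n)})"
          using p d(2) by (auto simp: epi_def dist_commute)
        then show "p \<in> (\<Union>d\<in>E. ?W n d)"
          using d p by (intro UN_I[of d]) (auto simp: space_Pred dist_commute)
      qed
    next
      fix p assume p: "p \<in> ?r"
      let ?e = "epi (h (fst p) (snd p))"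
      have sp: "p \<in> space M \<times> {0..T}" using p by (auto simp: space_Pred)
      have "\<exists>y. dist y (x p) < 2 / real (Suc n) \<and> (y, a + 1 / real (Suc n)) \<in> ?e" for n
      proof -
        from p obtain d where "d \<in> E" "p \<in> ?W n d" by blast
        then obtain y b where yb: "dist d (x p) < 1 / real (Suc n)" "(y, b) \<in> ?e" "dist d y < 1 / real (Suc n)"
          "b < a + 1 / real (Suc n)" by auto
        have "dist y (x p) \<le> dist d y + dist d (x p)" by (rule dist_triangle3)
        also have "\<dots> < 2 / real (Suc n)" using yb by (simp add: field_simps)
        finally have "dist y (x p) < 2 / real (Suc n)" .
        moreover have "h (fst p) (snd p) y \<le> ereal b" using yb(2) by (simp add: epi_def)
        then have "h (fst p) (snd p) y \<le> ereal (a + 1 / real (Suc n))"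
          by (rule order_trans) (use yb(4) in simp)
        ultimately show ?thesis by (auto simp: epi_def)
      qed
      then have "\<forall>n. \<exists>y. dist y (x p) < 2 / real (Suc n) \<and> (y, a + 1 / real (Suc n)) \<in> ?e" ..
      from choice[OF this] obtain y where
        y': "\<forall>n. dist (y n) (x p) < 2 / real (Suc n) \<and> (y n, a + 1 / real (Suc n)) \<in> ?e" ..
      note y = y'[rule_format, THEN conjunct1] y'[rule_format, THEN conjunct2]
      have l: "(\<lambda>n. 2 / real (Suc n)) \<longlonglongrightarrow> 0" by (rule LIMSEQ_Suc[OF lim_const_over_n])
      have "(\<lambda>n. dist (y n) (x p)) \<longlonglongrightarrow> 0"
      proof (rule tendsto_sandwich[OF _ _ tendsto_const l])
        show "\<forall>\<^sub>F n in sequentially. 0 \<le> dist (y n) (x p)" by simp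
        show "\<forall>\<^sub>F n in sequentially. dist (y n) (x p) \<le> 2 / real (Suc n)"
          using y(1) by (intro always_eventually allI less_imp_le)
      qed
      then have "y \<longlonglongrightarrow> x p" by (rule tendsto_dist_iff[THEN iffD2])
      moreover have "(\<lambda>n. a + 1 / real (Suc n)) \<longlonglongrightarrow> a + 0"
        by (intro tendsto_intros LIMSEQ_Suc lim_1_over_n)
      ultimately have "(\<lambda>n. (y n, a + 1 / real (Suc n))) \<longlonglongrightarrow> (x p, a + 0)" by (rule tendsto_Pair)
      then have "(x p, a + 0) \<in> ?e"
        by (rule closed_sequentially[OF closed_epi[OF sp] y(2)])
      then show "p \<in> ?l" using sp by (simp add: epi_def space_Pred)
    qed
    moreover have "?W n d \<in> sets Pred" for n d
    proof (rule sets.Int)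
      show "{p \<in> space Pred. dist d (x p) < 1 / real (Suc n)} \<in> sets Pred"
        using x by measurable
      show "{p \<in> space M \<times> {0..T}. epi (h (fst p) (snd p)) \<inter> (ball d (1 / real (Suc n)) \<times> {..<a + 1 / real (Suc n)}) \<noteq> {}} \<in> sets Pred"
        unfolding sets_Pred by (intro epi_meets_predictable open_Times) auto
    qed
    then have "(\<Union>d\<in>E. ?W n d) \<in> sets Pred" for n
      using E(1) by (rule sets.countable_UN''[rotated])
    then have "?r \<in> sets Pred"
      by (intro sets.countable_INT' image_subsetI countableI_type) simp_all
    ultimately show ?thesis by simp
  qed
  then show ?thesis by (rule borel_measurable_ereal_leI)
qed

text \<open>A tractable stand-in for the requirement that the domain contain the ball of radius
  \<delta> around \<open>c\<close>: it implies this requirement, follows from a larger ball, and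
  consists of finitely many conditions of meeting an open set.\<close>

definition orthant_set :: "'d \<Rightarrow> real \<Rightarrow> ('a \<times> real) set" where
  "orthant_set c \<delta> = {p \<in> space M \<times> {0..T}. \<forall>s\<in>signs. dom p \<inter> orthant c \<delta> s \<noteq> {}}"

lemma orthant_set_predictable: "orthant_set c \<delta> \<in> predictable_sets M F T"
proof -
  have "{p \<in> space Pred. \<forall>s\<in>signs. dom p \<inter> orthant c \<delta> s \<noteq> {}} \<in> sets Pred"
  proof (intro sets.sets_Collect_finite_All finite_signs)
    fix s :: "'d \<Rightarrow> real"
    show "{p \<in> space Pred. dom p \<inter> orthant c \<delta> s \<noteq> {}} \<in> sets Pred"
      unfolding dom_h_meets_iff sets_Pred space_Pred
      by (intro epi_meets_predictable open_Times open_orthant) auto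
  qed
  then show ?thesis by (simp add: orthant_set_def sets_Pred space_Pred)
qed

lemma orthant_set_cball:
  assumes "p \<in> orthant_set c \<delta>"
  shows "cball c \<delta> \<subseteq> dom p"
  using assms unfolding orthant_set_def
  by (intro convex_meets_orthants_imp_cball_subset convex_dom_h convex_epi) auto

lemma orthant_set_left_open:
  assumes isc: "left_isc T (\<lambda>t. dom_h (h \<omega> t))" and t: "(\<omega>, t) \<in> orthant_set c \<delta>"
  shows "\<exists>r<t. \<forall>s\<in>{r<..t} \<inter> {0..T}. (\<omega>, s) \<in> orthant_set c \<delta>"
proof -
  let ?U = "\<lambda>s. {t\<in>{0..T}. dom_h (h \<omega> t) \<inter> orthant c \<delta> s \<noteq> {}}"
  have "\<exists>r<t. \<forall>s\<in>signs. {r<..t} \<inter> {0..T} \<subseteq> ?U s"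
  proof (rule left_open_finite_Inter[OF finite_signs])
    show "left_open T (?U s)" for s
      using isc open_orthant unfolding left_isc_def by blast
    show "t \<in> ?U s" if "s \<in> signs" for s using t that by (auto simp: orthant_set_def)
  qed
  then show ?thesis using t by (fastforce simp: orthant_set_def)
qed

end

section \<open>Integrals with the convention of \<open>int_conv\<close>\<close>

lemma int_conv_mono:
  assumes "\<And>s. s \<in> space N \<Longrightarrow> f s \<le> g s"
  shows "int_conv N f \<le> int_conv N g"
proof -
  have P: "(\<integral>\<^sup>+ s. e2ennreal (f s) \<partial>N) \<le> (\<integral>\<^sup>+ s. e2ennreal (g s) \<partial>N)"
    using assms by (intro nn_integral_mono e2ennreal_mono)
  have Q: "(\<integral>\<^sup>+ s. e2ennreal (- g s) \<partial>N) \<le> (\<integral>\<^sup>+ s. e2ennreal (- f s) \<partial>N)"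
    using assms by (intro nn_integral_mono e2ennreal_mono) simp
  show ?thesis
  proof (cases "(\<integral>\<^sup>+ s. e2ennreal (g s) \<partial>N) = \<infinity>")
    case False
    with P have "(\<integral>\<^sup>+ s. e2ennreal (f s) \<partial>N) \<noteq> \<infinity>" by (auto simp: top_unique)
    with False P Q show ?thesis
      unfolding int_conv_def Let_def by (simp add: ereal_minus_mono less_eq_ennreal.rep_eq)
  qed (simp add: int_conv_def)
qed

lemma int_conv_cong_AE:
  assumes "AE s in N. f s = g s"
  shows "int_conv N f = int_conv N g"
proof -
  have "(\<integral>\<^sup>+ s. e2ennreal (f s) \<partial>N) = (\<integral>\<^sup>+ s. e2ennreal (g s) \<partial>N)"
    by (rule nn_integral_cong_AE) (use assms in eventually_elim, simp)
  moreover have "(\<integral>\<^sup>+ s. e2ennreal (- f s) \<partial>N) = (\<integral>\<^sup>+ s. e2ennreal (- g s) \<partial>N)"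
    by (rule nn_integral_cong_AE) (use assms in eventually_elim, simp)
  ultimately show ?thesis by (simp add: int_conv_def)
qed

lemma int_conv_integrable:
  assumes "integrable N f"
  shows "int_conv N (\<lambda>s. ereal (f s)) = ereal (integral\<^sup>L N f)"
    "(\<integral>\<^sup>+ s. ennreal (f s) \<partial>N) < \<infinity>" "(\<integral>\<^sup>+ s. ennreal (- f s) \<partial>N) < \<infinity>"
proof -
  have "(\<integral>\<^sup>+ s. ennreal (norm (f s)) \<partial>N) < \<infinity>" using assms by (simp add: integrable_iff_bounded)
  moreover have "(\<integral>\<^sup>+ s. ennreal (f s) \<partial>N) \<le> (\<integral>\<^sup>+ s. ennreal (norm (f s)) \<partial>N)"
    "(\<integral>\<^sup>+ s. ennreal (- f s) \<partial>N) \<le> (\<integral>\<^sup>+ s. ennreal (norm (f s)) \<partial>N)"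
    by (intro nn_integral_mono ennreal_leI; simp)+
  ultimately show fin: "(\<integral>\<^sup>+ s. ennreal (f s) \<partial>N) < \<infinity>" "(\<integral>\<^sup>+ s. ennreal (- f s) \<partial>N) < \<infinity>"
    by (auto intro: order_le_less_trans)
  obtain P where P: "(\<integral>\<^sup>+ s. ennreal (f s) \<partial>N) = ennreal P" "0 \<le> P"
    using fin(1) by (cases "\<integral>\<^sup>+ s. ennreal (f s) \<partial>N") auto
  obtain Q where Q: "(\<integral>\<^sup>+ s. ennreal (- f s) \<partial>N) = ennreal Q" "0 \<le> Q"
    using fin(2) by (cases "\<integral>\<^sup>+ s. ennreal (- f s) \<partial>N") auto
  show "int_conv N (\<lambda>s. ereal (f s)) = ereal (integral\<^sup>L N f)"
    unfolding int_conv_def Let_def real_lebesgue_integral_def[OF assms]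
    using P Q by (simp add: e2ennreal_ereal enn2ereal_ennreal)
qed

text \<open>Positive parts decrease from a finite integral and negative parts increase, so monotone
  convergence handles each. The limit of the positive parts is finite, so the difference makes sense
  even if the limit integral is minus infinity.\<close>

lemma int_conv_tendsto:
  assumes m: "\<And>n. integrable N (m n)" "\<And>n s. m (Suc n) s \<le> m n s"
    and lim: "AE s in N. (\<lambda>n. ereal (m n s)) \<longlonglongrightarrow> J s"
  shows "(\<lambda>n. ereal (integral\<^sup>L N (m n))) \<longlonglongrightarrow> int_conv N J"
proof -
  have [measurable]: "m n \<in> borel_measurable N" for n using m(1) by (rule borel_measurable_integrable)
  have dec: "decseq (\<lambda>n. ennreal (m n s))" "incseq (\<lambda>n. ennreal (- m n s))" for s
    using m(2) by (auto intro!: decseq_SucI incseq_SucI ennreal_leI)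
  have "AE s in N. (INF n. ennreal (m n s)) = e2ennreal (J s)"
    using lim
  proof eventually_elim
    case (elim s)
    then have "(\<lambda>n. ennreal (m n s)) \<longlonglongrightarrow> e2ennreal (J s)"
      using tendsto_e2ennrealI[OF elim] by (simp add: e2ennreal_ereal)
    then show ?case using LIMSEQ_INF[OF dec(1)] LIMSEQ_unique by blast
  qed
  then have "(\<integral>\<^sup>+ s. e2ennreal (J s) \<partial>N) = (\<integral>\<^sup>+ s. (INF n. ennreal (m n s)) \<partial>N)"
    by (intro nn_integral_cong_AE) (auto elim: eventually_mono)
  also have "\<dots> = (INF n. \<integral>\<^sup>+ s. ennreal (m n s) \<partial>N)"
    using m(2) int_conv_integrable(2)[OF m(1)]
    by (intro nn_integral_monotone_convergence_INF_AE') (auto intro: ennreal_leI)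
  finally have P: "(\<integral>\<^sup>+ s. e2ennreal (J s) \<partial>N) = (INF n. \<integral>\<^sup>+ s. ennreal (m n s) \<partial>N)" .
  have "AE s in N. (SUP n. ennreal (- m n s)) = e2ennreal (- J s)"
    using lim
  proof eventually_elim
    case (elim s)
    then have "(\<lambda>n. - ereal (m n s)) \<longlonglongrightarrow> - J s" by (rule tendsto_uminus_ereal)
    then have "(\<lambda>n. ennreal (- m n s)) \<longlonglongrightarrow> e2ennreal (- J s)"
      using tendsto_e2ennrealI by (fastforce simp: e2ennreal_ereal)
    then show ?case using LIMSEQ_SUP[OF dec(2)] LIMSEQ_unique by blast
  qed
  then have "(\<integral>\<^sup>+ s. e2ennreal (- J s) \<partial>N) = (\<integral>\<^sup>+ s. (SUP n. ennreal (- m n s)) \<partial>N)"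
    by (intro nn_integral_cong_AE) (auto elim: eventually_mono)
  also have "\<dots> = (SUP n. \<integral>\<^sup>+ s. ennreal (- m n s) \<partial>N)"
    using m(2) by (intro nn_integral_monotone_convergence_SUP_AE AE_I2 ennreal_leI) auto
  finally have Q: "(\<integral>\<^sup>+ s. e2ennreal (- J s) \<partial>N) = (SUP n. \<integral>\<^sup>+ s. ennreal (- m n s) \<partial>N)" .
  have Pl: "(\<lambda>n. \<integral>\<^sup>+ s. ennreal (m n s) \<partial>N) \<longlonglongrightarrow> (\<integral>\<^sup>+ s. e2ennreal (J s) \<partial>N)"
    unfolding P using m(2) by (intro LIMSEQ_INF decseq_SucI nn_integral_mono ennreal_leI)
  have Ql: "(\<lambda>n. \<integral>\<^sup>+ s. ennreal (- m n s) \<partial>N) \<longlonglongrightarrow> (\<integral>\<^sup>+ s. e2ennreal (- J s) \<partial>N)"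
    unfolding Q using m(2) by (intro LIMSEQ_SUP incseq_SucI nn_integral_mono ennreal_leI) simp
  have Pfin: "(\<integral>\<^sup>+ s. e2ennreal (J s) \<partial>N) \<noteq> \<infinity>"
  proof -
    have "(\<integral>\<^sup>+ s. e2ennreal (J s) \<partial>N) \<le> (\<integral>\<^sup>+ s. ennreal (m 0 s) \<partial>N)" unfolding P by (rule INF_lower) simp
    then show ?thesis using int_conv_integrable(2)[OF m(1), of 0] by (auto simp: top_unique)
  qed
  have eq: "enn2ereal (\<integral>\<^sup>+ s. ennreal (m n s) \<partial>N) - enn2ereal (\<integral>\<^sup>+ s. ennreal (- m n s) \<partial>N)
      = ereal (integral\<^sup>L N (m n))" for n
    using int_conv_integrable[OF m(1), of n]
    by (auto simp: int_conv_def Let_def e2ennreal_ereal split: if_splits)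
  have "(\<lambda>n. enn2ereal (\<integral>\<^sup>+ s. ennreal (m n s) \<partial>N) - enn2ereal (\<integral>\<^sup>+ s. ennreal (- m n s) \<partial>N))
      \<longlonglongrightarrow> enn2ereal (\<integral>\<^sup>+ s. e2ennreal (J s) \<partial>N) - enn2ereal (\<integral>\<^sup>+ s. e2ennreal (- J s) \<partial>N)"
  proof (rule tendsto_diff_ereal_general[OF tendsto_enn2erealI[OF Pl] tendsto_enn2erealI[OF Ql]])
    have "enn2ereal (\<integral>\<^sup>+ s. e2ennreal (J s) \<partial>N) \<noteq> \<infinity>" using Pfin by simp
    moreover have "enn2ereal (\<integral>\<^sup>+ s. e2ennreal (J s) \<partial>N) \<noteq> - \<infinity>"
      using enn2ereal_nonneg[of "\<integral>\<^sup>+ s. e2ennreal (J s) \<partial>N"] by (metis ereal_infty_less_eq2(2) ereal_minus_eq_PInfty_iff less_eq_ereal_def not_MInfty_nonneg)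
    ultimately show "\<not> (enn2ereal (\<integral>\<^sup>+ s. e2ennreal (J s) \<partial>N) = \<infinity> \<and> enn2ereal (\<integral>\<^sup>+ s. e2ennreal (- J s) \<partial>N) = \<infinity>
      \<or> enn2ereal (\<integral>\<^sup>+ s. e2ennreal (J s) \<partial>N) = - \<infinity> \<and> enn2ereal (\<integral>\<^sup>+ s. e2ennreal (- J s) \<partial>N) = - \<infinity>)"
      by blast
  qed
  then show ?thesis using Pfin by (simp add: eq int_conv_def)
qed

section \<open>Interior points in the essential supremum norm\<close>

lemma Linf_iff:
  "y \<in> Linf N \<longleftrightarrow> y \<in> borel_measurable N \<and> (\<exists>K::real. AE s in N. norm (y s) \<le> K)"
proof
  assume y: "y \<in> Linf N"
  then have ym: "y \<in> borel_measurable N" and fin: "esssup N (\<lambda>s. ereal (norm (y s))) < \<infinity>"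
    by (auto simp: Linf_def)
  obtain K :: real where K: "esssup N (\<lambda>s. ereal (norm (y s))) \<le> ereal K"
    using fin by (cases "esssup N (\<lambda>s. ereal (norm (y s)))") auto
  have "AE s in N. norm (y s) \<le> K"
    using esssup_AE[of "\<lambda>s. ereal (norm (y s))" N]
  proof eventually_elim
    case (elim s)
    from order_trans[OF elim K] show ?case by simp
  qed
  with ym show "y \<in> borel_measurable N \<and> (\<exists>K::real. AE s in N. norm (y s) \<le> K)" by blast
next
  assume "y \<in> borel_measurable N \<and> (\<exists>K::real. AE s in N. norm (y s) \<le> K)"
  then obtain K :: real where [measurable]: "y \<in> borel_measurable N" and K: "AE s in N. norm (y s) \<le> K" by blast
  have "esssup N (\<lambda>s. ereal (norm (y s))) \<le> ereal K"
    using K by (intro esssup_I) auto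
  then show "y \<in> Linf N"
    by (auto simp: Linf_def intro: order_le_less_trans)
qed

text \<open>Together with \<open>Linf_intI\<close> this replaces essential suprema by almost
  everywhere bounds; halving the radius absorbs the strict inequality in the definition.\<close>

lemma Linf_intD:
  assumes "x \<in> Linf_int N S"
  shows "x \<in> Linf N"
    "\<exists>r>0. \<forall>y\<in>borel_measurable N. (AE s in N. norm (y s - x s) \<le> r) \<longrightarrow> (AE s in N. y s \<in> S s)"
proof -
  show xL: "x \<in> Linf N" using assms by (simp add: Linf_int_def)
  obtain r where r: "0 < r" "\<And>y. y \<in> Linf N \<Longrightarrow> esssup N (\<lambda>s. ereal (norm (y s - x s))) < ereal r \<Longrightarrow> y \<in> Linf_sel N S"
    using assms by (auto simp: Linf_int_def)
  obtain K :: real where K: "AE s in N. norm (x s) \<le> K" and [measurable]: "x \<in> borel_measurable N"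
    using xL by (auto simp: Linf_iff)
  have "AE s in N. y s \<in> S s"
    if [measurable]: "y \<in> borel_measurable N" and d: "AE s in N. norm (y s - x s) \<le> r / 2" for y
  proof -
    have "AE s in N. norm (y s) \<le> K + r / 2"
      using K d
    proof eventually_elim
      case (elim s)
      then show ?case using norm_triangle_sub[of "y s" "x s"] by linarith
    qed
    then have "y \<in> Linf N" using \<open>y \<in> borel_measurable N\<close> unfolding Linf_iff by blast
    moreover have "esssup N (\<lambda>s. ereal (norm (y s - x s))) \<le> ereal (r / 2)"
      using d by (intro esssup_I) auto
    then have "esssup N (\<lambda>s. ereal (norm (y s - x s))) < ereal r"
      by (rule order_le_less_trans) (use r(1) in simp)
    ultimately show ?thesis using r(2) by (auto simp: Linf_sel_def)
  qed
  then show "\<exists>r>0. \<forall>y\<in>borel_measurable N. (AE s in N. norm (y s - x s) \<le> r) \<longrightarrow> (AE s in N. y s \<in> S s)"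
    using r(1) by (intro exI[of _ "r / 2"]) simp
qed

lemma Linf_intI:
  assumes "x \<in> Linf N" "0 < r"
    "\<And>y. y \<in> borel_measurable N \<Longrightarrow> AE s in N. norm (y s - x s) \<le> r \<Longrightarrow> AE s in N. y s \<in> S s"
  shows "x \<in> Linf_int N S"
  unfolding Linf_int_def
proof (intro CollectI conjI exI[of _ r] ballI impI assms(1,2))
  fix y assume y: "y \<in> Linf N" and d: "esssup N (\<lambda>s. ereal (norm (y s - x s))) < ereal r"
  have "AE s in N. norm (y s - x s) \<le> r"
    using esssup_AE[of "\<lambda>s. ereal (norm (y s - x s))" N]
  proof eventually_elim
    case (elim s)
    from order_le_less_trans[OF elim d] show ?case by simp
  qed
  with y show "y \<in> Linf_sel N S"
    using assms(3) by (simp add: Linf_sel_def Linf_iff)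
qed

lemma Linf_int_cong_AE:
  assumes x: "x \<in> Linf_int N S" and [measurable]: "y \<in> borel_measurable N" and ae: "AE s in N. y s = x s"
  shows "y \<in> Linf_int N S"
proof -
  obtain K :: real where K: "AE s in N. norm (x s) \<le> K"
    using Linf_intD(1)[OF x] by (auto simp: Linf_iff)
  obtain r where r: "0 < r" "\<forall>z\<in>borel_measurable N. (AE s in N. norm (z s - x s) \<le> r) \<longrightarrow> (AE s in N. z s \<in> S s)"
    using Linf_intD(2)[OF x] by blast
  show ?thesis
  proof (rule Linf_intI[OF _ r(1)])
    have "AE s in N. norm (y s) \<le> K" using K ae by eventually_elim simp
    then show "y \<in> Linf N" using \<open>y \<in> borel_measurable N\<close> unfolding Linf_iff by blast
    fix z assume z: "z \<in> borel_measurable N" "AE s in N. norm (z s - y s) \<le> r"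
    from z(2) ae have "AE s in N. norm (z s - x s) \<le> r" by eventually_elim simp
    with z(1) r(2) show "AE s in N. z s \<in> S s" by blast
  qed
qed

section \<open>Approximation of the infimum of a convex function from interior points of its domain\<close>

text \<open>Moving from a near-minimiser \<open>y\<close> a small fraction \<open>l\<close> towards
  \<open>x\<close> drags along a ball of radius \<open>l * r\<close> on which convexity keeps the
  values below \<open>a\<close>; the dense set meets that ball.\<close>

lemma convex_approx_infimum_interior:
  fixes f :: "'d::euclidean_space \<Rightarrow> ereal"
  assumes cv: "convex (epi f)" and r: "0 < r" "\<And>x'. x' \<in> cball 0 r \<Longrightarrow> f (x + x') \<le> ereal \<beta>"
    and y: "f y < a" and E: "\<And>X. open X \<Longrightarrow> X \<noteq> {} \<Longrightarrow> \<exists>d\<in>E. d \<in> X"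
  shows "\<exists>c\<in>E. \<exists>\<rho>>0. ball c \<rho> \<subseteq> dom_h f \<and> f c < a"
proof -
  \<comment> \<open>\<open>f y\<close> and \<open>a\<close> may be infinite, so the convexity
    estimate is run between two real levels \<open>z\<close> and \<open>a'\<close> strictly between
    them.\<close>
  obtain z where z: "f y < ereal z" "ereal z < a" using ereal_dense2[OF y] by blast
  obtain a' where a': "ereal z < ereal a'" "ereal a' < a" using ereal_dense2[OF z(2)] by blast
  define k where "k = \<bar>\<beta> - z\<bar> + 1"
  have k: "0 < k" "\<beta> - z \<le> k" by (auto simp: k_def)
  \<comment> \<open>Chosen so that the excess \<open>l * (\<beta> - z)\<close> uses at most half of
    the room \<open>a' - z\<close>; the absolute value in \<open>k\<close> keeps the denominator
    positive whatever the sign of \<open>\<beta> - z\<close>.\<close>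
  define l where "l = min 1 ((a' - z) / (2 * k))"
  have "0 < (a' - z) / (2 * k)"
    using a'(1) k(1) by simp
  then have l: "0 < l" "l \<le> 1" by (simp_all add: l_def)
  have "l * (\<beta> - z) \<le> l * k" using l k by (intro mult_left_mono) auto
  also have "\<dots> \<le> (a' - z) / (2 * k) * k"
    using k by (intro mult_right_mono) (auto simp: l_def)
  also have "\<dots> = (a' - z) / 2" using k by (simp add: field_simps)
  also have "\<dots> < a' - z" using a' by simp
  finally have lb: "l * \<beta> + (1 - l) * z < a'" by (simp add: algebra_simps)
  define w where "w = l *\<^sub>R x + (1 - l) *\<^sub>R y"
  have lt: "f u < a" if u: "u \<in> ball w (l * r)" for u
  proof -
    define x' where "x' = (1 / l) *\<^sub>R (u - w)"
    have "norm (u - w) \<le> l * r" using u by (simp add: dist_norm norm_minus_commute)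
    then have "norm x' \<le> r" using l by (simp add: x'_def pos_divide_le_eq mult.commute)
    then have "(x + x', \<beta>) \<in> epi f" using r(2) by (simp add: epi_def)
    moreover have "(y, z) \<in> epi f" using z by (simp add: epi_def)
    ultimately have "l *\<^sub>R (x + x', \<beta>) + (1 - l) *\<^sub>R (y, z) \<in> epi f"
      using l by (intro convexD[OF cv]) auto
    moreover have "l *\<^sub>R (x + x') + (1 - l) *\<^sub>R y = u"
      using l by (simp add: x'_def w_def algebra_simps)
    ultimately have "f u \<le> ereal (l * \<beta> + (1 - l) * z)" by (simp add: epi_def)
    also have "\<dots> < ereal a'" using lb by simp
    finally show ?thesis using a'(2) by order
  qed
  have lr: "0 < l * r" using l r by simp
  then obtain c where c: "c \<in> E" "c \<in> ball w (l * r / 2)" using E[of "ball w (l * r / 2)"] by auto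
  have sub: "ball c (l * r / 2) \<subseteq> ball w (l * r)"
  proof
    fix u assume "u \<in> ball c (l * r / 2)"
    then show "u \<in> ball w (l * r)" using c(2) dist_triangle[of w u c] by simp
  qed
  have "u \<in> dom_h f" if "u \<in> ball w (l * r)" for u
    using order_less_le_trans[OF lt[OF that], of \<infinity>] by (simp add: dom_h_def)
  then have "ball c (l * r / 2) \<subseteq> dom_h f" using sub by blast
  moreover have "c \<in> ball w (l * r)" using c(2) lr by auto
  then have "f c < a" by (rule lt)
  ultimately show ?thesis using c(1) lr by (intro bexI[of _ c] exI[of _ "l * r / 2"]) auto
qed

section \<open>Interchange of minimization and integration\<close>

locale interchange = integrand_space M F T \<mu> h
  for M :: "'a measure" and F :: "real \<Rightarrow> 'a set set" and T :: real and \<mu> :: "'a \<Rightarrow> real measure"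
    and h :: "'a \<Rightarrow> real \<Rightarrow> 'd::euclidean_space \<Rightarrow> ereal" +
  fixes v :: "'a \<times> real \<Rightarrow> 'd" and \<alpha> :: "'a \<times> real \<Rightarrow> real"
  assumes v_int: "integrable \<eta> v" and \<alpha>_int: "integrable \<eta> \<alpha>"
    and lower: "\<And>\<omega> t x. \<omega> \<in> space M \<Longrightarrow> t \<in> {0..T} \<Longrightarrow> ereal (x \<bullet> v (\<omega>, t) - \<alpha> (\<omega>, t)) \<le> h \<omega> t x"
    and local_bound: "\<And>x. x \<in> Linf_int \<eta> dom \<Longrightarrow>
      \<exists>r>0. \<exists>\<beta>::'a \<times> real \<Rightarrow> real. integrable \<eta> \<beta> \<and>
        (AE p in \<eta>. \<forall>x'\<in>cball 0 r. h (fst p) (snd p) (x p + x') \<le> ereal (\<beta> p))"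
begin

section \<open>Processes with integrable cost and their pasting\<close>

definition cost :: "('a \<Rightarrow> real \<Rightarrow> 'd) \<Rightarrow> 'a \<times> real \<Rightarrow> real" where
  "cost x p = real_of_ereal (h (fst p) (snd p) (x (fst p) (snd p)))"

text \<open>\<open>cost\<close> sends infinite values to 0, so the last clause guarantees that
  nothing is lost almost everywhere. Measurability for \<open>Pred\<close> is listed because the
  paths are left continuous only almost surely; it makes comparisons of two costs
  predictable.\<close>

definition good :: "('a \<Rightarrow> real \<Rightarrow> 'd) set" where
  "good = {x \<in> bdd_Ninf M F T. (\<lambda>p. x (fst p) (snd p)) \<in> borel_measurable Pred \<and> integrable \<eta> (cost x)
     \<and> (AE p in \<eta>. h (fst p) (snd p) (x (fst p) (snd p)) = ereal (cost x p))}"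

lemma good_Ninf: "x \<in> good \<Longrightarrow> x \<in> Ninf M F T"
  by (simp add: good_def bdd_Ninf_def)

lemma cost_measurable_Pred:
  "(\<lambda>p. x (fst p) (snd p)) \<in> borel_measurable Pred \<Longrightarrow> cost x \<in> borel_measurable Pred"
  unfolding cost_def[abs_def] using integrand_measurable_Pred by (intro borel_measurable_real_of_ereal)

lemma Eint_good:
  assumes "x \<in> good"
  shows "Eint M \<mu> T (\<lambda>\<omega> t. h \<omega> t (x \<omega> t)) = ereal (integral\<^sup>L \<eta> (cost x))"
proof -
  have "int_conv \<eta> (\<lambda>p. h (fst p) (snd p) (x (fst p) (snd p))) = int_conv \<eta> (\<lambda>p. ereal (cost x p))"
    using assms by (intro int_conv_cong_AE) (simp add: good_def)
  also have "\<dots> = ereal (integral\<^sup>L \<eta> (cost x))"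
    using assms by (intro int_conv_integrable) (simp add: good_def)
  finally show ?thesis by (simp add: Eint_def)
qed

text \<open>The cost is squeezed between two integrable functions: \<beta> from the local bound at
  the zero perturbation, and \<open>- K * norm (v p) - \<bar>\<alpha> p\<bar>\<close> from the
  affine minorant with \<open>x\<close> bounded by \<open>K\<close>.\<close>

lemma Linf_int_good:
  assumes x: "x \<in> bdd_Ninf M F T" and xm: "(\<lambda>p. x (fst p) (snd p)) \<in> borel_measurable Pred"
    and xi: "(\<lambda>p. x (fst p) (snd p)) \<in> Linf_int \<eta> dom"
  shows "x \<in> good"
proof -
  obtain r \<beta> where r: "0 < r" and \<beta>: "integrable \<eta> \<beta>"
    and b: "AE p in \<eta>. \<forall>x'\<in>cball 0 r. h (fst p) (snd p) (x (fst p) (snd p) + x') \<le> ereal (\<beta> p)"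
    using local_bound[OF xi] by blast
  obtain K :: real where K: "AE p in \<eta>. norm (x (fst p) (snd p)) \<le> K"
    using Linf_intD(1)[OF xi] by (auto simp: Linf_iff)
  have *: "AE p in \<eta>. h (fst p) (snd p) (x (fst p) (snd p)) = ereal (cost x p)
      \<and> norm (cost x p) \<le> norm (\<bar>\<beta> p\<bar> + (K * norm (v p) + \<bar>\<alpha> p\<bar>))"
    using b K AE_space
  proof eventually_elim
    case (elim p)
    let ?h = "h (fst p) (snd p) (x (fst p) (snd p))"
    have "(0::'d) \<in> cball 0 r" using r by simp
    then have up: "?h \<le> ereal (\<beta> p)" using elim(1) by (metis add_0_right)
    have lo: "ereal (x (fst p) (snd p) \<bullet> v p - \<alpha> p) \<le> ?h"
      using lower[of "fst p" "snd p"] elim(3) by (auto simp: space_eta)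
    obtain c where c: "?h = ereal c" using up lo by (cases ?h) auto
    then have cost: "cost x p = c" by (simp add: cost_def)
    have "\<bar>x (fst p) (snd p) \<bullet> v p\<bar> \<le> norm (x (fst p) (snd p)) * norm (v p)" by (rule Cauchy_Schwarz_ineq2)
    also have "\<dots> \<le> K * norm (v p)" using elim(2) by (intro mult_right_mono) auto
    finally have "- (K * norm (v p)) - \<bar>\<alpha> p\<bar> \<le> c" using lo c by simp
    moreover have "0 \<le> K * norm (v p)"
      using order_trans[OF norm_ge_zero elim(2)] by simp
    ultimately have "\<bar>c\<bar> \<le> \<bar>\<beta> p\<bar> + (K * norm (v p) + \<bar>\<alpha> p\<bar>)" using up c by simp
    then show ?case using c cost by simp
  qed
  have "integrable \<eta> (cost x)"
  proof (rule Bochner_Integration.integrable_bound)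
    show "integrable \<eta> (\<lambda>p. \<bar>\<beta> p\<bar> + (K * norm (v p) + \<bar>\<alpha> p\<bar>))"
      using \<beta> v_int \<alpha>_int by simp
    show "cost x \<in> borel_measurable \<eta>"
      by (intro measurable_Pred_eta cost_measurable_Pred xm)
    show "AE p in \<eta>. norm (cost x p) \<le> norm (\<bar>\<beta> p\<bar> + (K * norm (v p) + \<bar>\<alpha> p\<bar>))"
      using * by eventually_elim blast
  qed
  moreover have "AE p in \<eta>. h (fst p) (snd p) (x (fst p) (snd p)) = ereal (cost x p)"
    using * by eventually_elim blast
  ultimately show ?thesis using x xm by (simp add: good_def)
qed

lemma good_paste:
  assumes A: "A \<in> bv_sets" and x: "x \<in> good" and z: "z \<in> good"
  obtains w where "w \<in> good" "\<forall>p\<in>space \<eta>. cost w p = (if p \<in> A then cost x p else cost z p)"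
proof -
  obtain w where w: "w \<in> bdd_Ninf M F T"
    and w_eq: "\<And>\<omega> t. \<omega> \<in> space M \<Longrightarrow> t \<in> {0..T} \<Longrightarrow> w \<omega> t = (if (\<omega>, t) \<in> A then x \<omega> t else z \<omega> t)"
    using bv_sets_paste[OF A, of x z] x z by (auto simp: good_def)
  have Ap: "A \<in> sets Pred" using A by (simp add: bv_sets_def sets_Pred)
  have eq: "w (fst p) (snd p) = (if p \<in> A then x (fst p) (snd p) else z (fst p) (snd p))"
    if "p \<in> space M \<times> {0..T}" for p
    using w_eq[of "fst p" "snd p"] that by auto
  have cost: "cost w p = (if p \<in> A then cost x p else cost z p)" if "p \<in> space \<eta>" for p
    using eq[of p] that by (simp add: cost_def space_eta)
  have "(\<lambda>p. if p \<in> A then x (fst p) (snd p) else z (fst p) (snd p)) \<in> borel_measurable Pred"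
    using x z Ap by (intro measurable_If_set) (auto simp: good_def)
  then have wm: "(\<lambda>p. w (fst p) (snd p)) \<in> borel_measurable Pred"
    by (rule measurable_cong[THEN iffD2, rotated]) (simp add: eq space_Pred)
  have "integrable \<eta> (cost w)"
  proof (rule Bochner_Integration.integrable_bound)
    show "integrable \<eta> (\<lambda>p. \<bar>cost x p\<bar> + \<bar>cost z p\<bar>)" using x z by (simp add: good_def)
    show "cost w \<in> borel_measurable \<eta>" by (intro measurable_Pred_eta cost_measurable_Pred wm)
    show "AE p in \<eta>. norm (cost w p) \<le> norm (\<bar>cost x p\<bar> + \<bar>cost z p\<bar>)"
      using AE_space by eventually_elim (simp add: cost)
  qed
  moreover have "AE p in \<eta>. h (fst p) (snd p) (x (fst p) (snd p)) = ereal (cost x p)"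
    "AE p in \<eta>. h (fst p) (snd p) (z (fst p) (snd p)) = ereal (cost z p)"
    using x z by (simp_all add: good_def)
  then have "AE p in \<eta>. h (fst p) (snd p) (w (fst p) (snd p)) = ereal (cost w p)"
    using AE_space by eventually_elim (simp add: cost eq space_eta)
  ultimately have "w \<in> good" using w wm by (simp add: good_def)
  then show ?thesis using cost by (intro that) auto
qed

text \<open>The ideal switch happens on the predictable set \<open>B\<close> where \<open>z\<close>
  is cheaper. Switching on a pasting set \<open>A\<close> instead costs the extra amount
  \<open>g\<close> exactly on the symmetric difference, so \<open>A\<close> is chosen close to
  \<open>B\<close> for the finite measure with density \<open>g\<close>.\<close>

lemma good_approx_min:
  assumes w: "w \<in> good" and z: "z \<in> good" and "0 < \<epsilon>"
  obtains w' where "w' \<in> good" "\<forall>p\<in>space \<eta>. min (cost w p) (cost z p) \<le> cost w' p"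
    "integral\<^sup>L \<eta> (cost w') \<le> (\<integral>p. min (cost w p) (cost z p) \<partial>\<eta>) + \<epsilon>"
proof -
  have int: "integrable \<eta> (cost w)" "integrable \<eta> (cost z)" using w z by (simp_all add: good_def)
  define g where "g p = \<bar>cost w p - cost z p\<bar>" for p
  have gi: "integrable \<eta> g" unfolding g_def using int by simp
  then have [measurable]: "g \<in> borel_measurable \<eta>" by (rule borel_measurable_integrable)
  have cm [measurable]: "cost w \<in> borel_measurable Pred" "cost z \<in> borel_measurable Pred"
    using w z by (auto simp: good_def intro: cost_measurable_Pred)
  define \<nu> where "\<nu> = density \<eta> (\<lambda>p. ennreal (g p))"
  have \<nu>: "emeasure \<nu> X = (\<integral>\<^sup>+ p. ennreal (g p * indicator X p) \<partial>\<eta>)" if "X \<in> sets \<eta>" for X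
    unfolding \<nu>_def using that
    by (subst emeasure_density) (auto intro!: nn_integral_cong simp: indicator_def)
  have fin: "finite_measure \<nu>"
  proof
    have "emeasure \<nu> (space \<nu>) = (\<integral>\<^sup>+ p. ennreal (g p * indicator (space \<eta>) p) \<partial>\<eta>)"
      using \<nu>[of "space \<eta>"] by (simp add: \<nu>_def)
    also have "\<dots> = (\<integral>\<^sup>+ p. ennreal (g p) \<partial>\<eta>)" by (intro nn_integral_cong) simp
    also have "\<dots> < \<infinity>" by (rule int_conv_integrable(2)[OF gi])
    finally show "emeasure \<nu> (space \<nu>) \<noteq> \<infinity>" by simp
  qed
  define B where "B = {p \<in> space Pred. cost z p < cost w p}"
  have "B \<in> sets Pred" unfolding B_def by measurable
  then have B: "B \<in> predictable_sets M F T" by (simp add: sets_Pred)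
  obtain A where A: "A \<in> bv_sets" "measure \<nu> ((A - B) \<union> (B - A)) < \<epsilon>"
    by (rule bv_sets_approx[OF fin _ B \<open>0 < \<epsilon>\<close>]) (use predictable_sets_eta in \<open>simp add: \<nu>_def\<close>)
  let ?S = "(A - B) \<union> (B - A)"
  have S: "?S \<in> sets \<eta>" using A B predictable_sets_eta by (auto simp: bv_sets_def)
  have gSi: "integrable \<eta> (\<lambda>p. g p * indicator ?S p)"
    by (rule integrable_real_mult_indicator[OF S gi])
  have eq: "ennreal (\<integral>p. g p * indicator ?S p \<partial>\<eta>) = emeasure \<nu> ?S"
    unfolding \<nu>[OF S] by (intro nn_integral_eq_integral[symmetric] gSi) (simp add: g_def)
  have "0 \<le> (\<integral>p. g p * indicator ?S p \<partial>\<eta>)"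
    by (intro Bochner_Integration.integral_nonneg) (simp add: g_def)
  then have "(\<integral>p. g p * indicator ?S p \<partial>\<eta>) = measure \<nu> ?S"
    unfolding measure_def eq[symmetric] by (simp only: enn2real_ennreal)
  then have le: "(\<integral>p. g p * indicator ?S p \<partial>\<eta>) \<le> \<epsilon>" using A(2) by simp
  obtain w' where w0: "w' \<in> good" "\<forall>p\<in>space \<eta>. cost w' p = (if p \<in> A then cost z p else cost w p)"
    by (rule good_paste[OF A(1) z w])
  note w' = w0(1) w0(2)[rule_format]
  have cost: "cost w' p = min (cost w p) (cost z p) + g p * indicator ?S p" if p: "p \<in> space \<eta>" for p
  proof -
    have "p \<in> B \<longleftrightarrow> cost z p < cost w p" using p by (simp add: B_def space_Pred space_eta)
    then show ?thesis using w'(2)[OF p] by (auto simp: g_def indicator_def min_def abs_if)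
  qed
  have "integral\<^sup>L \<eta> (cost w') = (\<integral>p. min (cost w p) (cost z p) + g p * indicator ?S p \<partial>\<eta>)"
    by (intro Bochner_Integration.integral_cong cost) simp
  also have "\<dots> = (\<integral>p. min (cost w p) (cost z p) \<partial>\<eta>) + (\<integral>p. g p * indicator ?S p \<partial>\<eta>)"
    using int gSi by (intro Bochner_Integration.integral_add) auto
  finally have "integral\<^sup>L \<eta> (cost w') \<le> (\<integral>p. min (cost w p) (cost z p) \<partial>\<eta>) + \<epsilon>" using le by simp
  moreover have "min (cost w p) (cost z p) \<le> cost w' p" if "p \<in> space \<eta>" for p
    using w'(2)[OF that] by auto
  ultimately show ?thesis using w'(1) by (intro that) auto
qed

section \<open>Running minima of the costs\<close>

primrec min_cost :: "(nat \<Rightarrow> 'a \<Rightarrow> real \<Rightarrow> 'd) \<Rightarrow> nat \<Rightarrow> 'a \<times> real \<Rightarrow> real" where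
  "min_cost xs 0 p = cost (xs 0) p"
| "min_cost xs (Suc n) p = min (min_cost xs n p) (cost (xs (Suc n)) p)"

lemma min_cost_integrable:
  assumes "\<And>n. xs n \<in> good"
  shows "integrable \<eta> (min_cost xs n)"
proof (induction n)
  case 0
  have "integrable \<eta> (cost (xs 0))" using assms by (simp add: good_def)
  then show ?case by (subst Bochner_Integration.integrable_cong[OF refl]) auto
next
  case (Suc n)
  have "integrable \<eta> (cost (xs (Suc n)))" using assms by (simp add: good_def)
  with Suc have "integrable \<eta> (\<lambda>p. min (min_cost xs n p) (cost (xs (Suc n)) p))" by (rule integrable_min)
  then show ?case by (subst Bochner_Integration.integrable_cong[OF refl]) auto
qed

lemma min_cost_le: "k \<le> n \<Longrightarrow> min_cost xs n p \<le> cost (xs k) p"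
  by (induction n) (auto simp: le_Suc_eq min_le_iff_disj)

lemma min_cost_attained: "\<exists>k. min_cost xs n p = cost (xs k) p"
proof (induction n)
  case (Suc n)
  then obtain k where "min_cost xs n p = cost (xs k) p" by blast
  then show ?case by (cases "min_cost xs n p \<le> cost (xs (Suc n)) p") (auto simp: min_def)
qed auto

text \<open>The running minimum need not be the cost of a process in \<open>good\<close>, but its
  integral is nearly attained. Each new process is pasted in at half of the permitted error, the
  other half being left to the earlier ones.\<close>

lemma min_cost_approx:
  assumes xs: "\<And>n. xs n \<in> good"
  shows "0 < \<epsilon> \<Longrightarrow> \<exists>w\<in>good. (\<forall>p\<in>space \<eta>. min_cost xs n p \<le> cost w p)
      \<and> integral\<^sup>L \<eta> (cost w) \<le> integral\<^sup>L \<eta> (min_cost xs n) + \<epsilon>"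
proof (induction n arbitrary: \<epsilon>)
  case 0
  have "integral\<^sup>L \<eta> (cost (xs 0)) = integral\<^sup>L \<eta> (min_cost xs 0)"
    by (intro Bochner_Integration.integral_cong) simp_all
  then show ?case using xs[of 0] 0 by (intro bexI[of _ "xs 0"]) simp_all
next
  case (Suc n)
  then have e2: "0 < \<epsilon> / 2" by simp
  obtain w where w: "w \<in> good" "\<And>p. p \<in> space \<eta> \<Longrightarrow> min_cost xs n p \<le> cost w p"
    "integral\<^sup>L \<eta> (cost w) \<le> integral\<^sup>L \<eta> (min_cost xs n) + \<epsilon> / 2"
    using Suc.IH[OF e2] by blast
  let ?z = "xs (Suc n)"
  obtain w' where w0: "w' \<in> good" "\<forall>p\<in>space \<eta>. min (cost w p) (cost ?z p) \<le> cost w' p"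
    "integral\<^sup>L \<eta> (cost w') \<le> (\<integral>p. min (cost w p) (cost ?z p) \<partial>\<eta>) + \<epsilon> / 2"
    by (rule good_approx_min[OF w(1) xs[of "Suc n"] e2])
  note w' = w0(1) w0(2)[rule_format] w0(3)
  have int: "integrable \<eta> (cost w)" "integrable \<eta> (cost ?z)" using w(1) xs by (simp_all add: good_def)
  \<comment> \<open>Replacing \<open>min_cost xs n\<close> by the larger \<open>cost w\<close>
    inside a minimum raises it by at most their difference.\<close>
  have "(\<integral>p. min (cost w p) (cost ?z p) \<partial>\<eta>)
      \<le> (\<integral>p. min_cost xs (Suc n) p + (cost w p - min_cost xs n p) \<partial>\<eta>)"
  proof (rule integral_mono)
    show "integrable \<eta> (\<lambda>p. min (cost w p) (cost ?z p))" using int by (rule integrable_min)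
    show "integrable \<eta> (\<lambda>p. min_cost xs (Suc n) p + (cost w p - min_cost xs n p))"
      using int(1) min_cost_integrable[OF xs] by (intro Bochner_Integration.integrable_add Bochner_Integration.integrable_diff)
    show "min (cost w p) (cost ?z p) \<le> min_cost xs (Suc n) p + (cost w p - min_cost xs n p)"
      if "p \<in> space \<eta>" for p
      using w(2)[OF that] by simp
  qed
  also have "\<dots> = integral\<^sup>L \<eta> (min_cost xs (Suc n)) + (integral\<^sup>L \<eta> (cost w) - integral\<^sup>L \<eta> (min_cost xs n))"
    using int(1) min_cost_integrable[where xs=xs, OF xs, of n] min_cost_integrable[where xs=xs, OF xs, of "Suc n"]
    by (simp del: min_cost.simps)
  finally have "integral\<^sup>L \<eta> (cost w') \<le> integral\<^sup>L \<eta> (min_cost xs (Suc n)) + \<epsilon>"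
    using w(3) w'(3) by simp
  moreover have "min_cost xs (Suc n) p \<le> cost w' p" if "p \<in> space \<eta>" for p
    using w(2)[OF that] w'(2)[OF that] by simp
  ultimately show ?case using w'(1) by blast
qed

text \<open>Reduces the interchange to a countable family in \<open>good\<close> whose values come
  arbitrarily near the pointwise infimum. The levels \<open>a\<close> are extended reals, so an
  infimum of minus infinity is included.\<close>

lemma interchange_sequence:
  fixes xs :: "nat \<Rightarrow> 'a \<Rightarrow> real \<Rightarrow> 'd"
  assumes xs: "\<And>n. xs n \<in> good"
    and dense: "AE p in \<eta>. \<forall>a. (INF y. h (fst p) (snd p) y) < a \<longrightarrow> (\<exists>n. h (fst p) (snd p) (xs n (fst p) (snd p)) < a)"
  shows "(INF x\<in>Ninf M F T. Eint M \<mu> T (\<lambda>\<omega> t. h \<omega> t (x \<omega> t))) = Eint M \<mu> T (\<lambda>\<omega> t. INF y. h \<omega> t y)"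
    (is "?L = ?R")
proof (rule antisym)
  show "?R \<le> ?L"
    unfolding Eint_def by (intro INF_greatest int_conv_mono INF_lower) simp
  have "AE p in \<eta>. \<forall>n. h (fst p) (snd p) (xs n (fst p) (snd p)) = ereal (cost (xs n) p)"
    unfolding AE_all_countable
  proof (rule allI)
    fix n
    show "AE p in \<eta>. h (fst p) (snd p) (xs n (fst p) (snd p)) = ereal (cost (xs n) p)"
      using xs[of n] by (simp add: good_def)
  qed
  with dense have lim: "AE p in \<eta>. (\<lambda>n. ereal (min_cost xs n p)) \<longlonglongrightarrow> (INF y. h (fst p) (snd p) y)"
  proof eventually_elim
    case (elim p)
    let ?J = "INF y. h (fst p) (snd p) y"
    have "?J \<le> ereal (cost (xs k) p)" for k
      by (subst elim(2)[rule_format, symmetric]) (rule INF_lower, simp)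
    then have lb: "?J \<le> ereal (min_cost xs n p)" for n
      using min_cost_attained[of xs n p] by metis
    show ?case
    proof (rule order_tendstoI)
      fix a assume "a < ?J"
      then show "\<forall>\<^sub>F n in sequentially. a < ereal (min_cost xs n p)"
        using lb by (intro always_eventually allI) (rule order_less_le_trans)
    next
      fix a assume "?J < a"
      then obtain k where k: "ereal (cost (xs k) p) < a" using elim by metis
      show "\<forall>\<^sub>F n in sequentially. ereal (min_cost xs n p) < a"
        using eventually_ge_at_top[of k]
      proof eventually_elim
        case (elim n)
        have "ereal (min_cost xs n p) \<le> ereal (cost (xs k) p)" using min_cost_le[OF elim] by simp
        then show ?case using k by (rule order_le_less_trans)
      qed
    qed
  qed
  have conv: "(\<lambda>n. ereal (integral\<^sup>L \<eta> (min_cost xs n))) \<longlonglongrightarrow> int_conv \<eta> (\<lambda>p. INF y. h (fst p) (snd p) y)"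
    by (rule int_conv_tendsto[OF min_cost_integrable[OF xs] _ lim]) simp
  have "?L \<le> ereal (integral\<^sup>L \<eta> (min_cost xs n))" for n
  proof (rule ereal_le_epsilon2)
    fix e :: real assume "0 < e"
    then obtain w where w: "w \<in> good" "integral\<^sup>L \<eta> (cost w) \<le> integral\<^sup>L \<eta> (min_cost xs n) + e"
      using min_cost_approx[where xs=xs, OF xs, of e n] by blast
    have "?L \<le> Eint M \<mu> T (\<lambda>\<omega> t. h \<omega> t (w \<omega> t))" by (rule INF_lower[OF good_Ninf[OF w(1)]])
    also have "\<dots> = ereal (integral\<^sup>L \<eta> (cost w))" by (rule Eint_good[OF w(1)])
    also have "\<dots> \<le> ereal (integral\<^sup>L \<eta> (min_cost xs n)) + ereal e" using w(2) by simp
    finally show "?L \<le> ereal (integral\<^sup>L \<eta> (min_cost xs n)) + ereal e" .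
  qed
  then show "?L \<le> ?R"
    unfolding Eint_def by (intro LIMSEQ_le_const[OF conv]) blast
qed

section \<open>A countable family of interior processes with minimising values\<close>

lemma left_continuous_modification:
  assumes xb: "xb \<in> Ninf M F T" and xi: "(\<lambda>p. xb (fst p) (snd p)) \<in> Linf_int \<eta> dom"
    and supp: "AE \<omega> in M. 0 < emeasure (\<mu> \<omega>) {0..T}"
  obtains x where "x \<in> bdd_Ninf M F T" "(\<lambda>p. x (fst p) (snd p)) \<in> borel_measurable Pred"
    "(\<lambda>p. x (fst p) (snd p)) \<in> Linf_int \<eta> dom"
proof -
  obtain C where C: "adapted_on M F {0..} xb" "AE \<omega> in M. xb \<omega> \<in> pathX T" "AE \<omega> in M. total_variation (xb \<omega>) \<le> ereal C"
    using xb by (auto simp: Ninf_def)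
  obtain K :: real where K: "AE p in \<eta>. norm (xb (fst p) (snd p)) \<le> K"
    using Linf_intD(1)[OF xi] by (auto simp: Linf_iff)
  have "AE \<omega> in M. AE t in \<mu> \<omega>. norm (xb \<omega> t) \<le> K" using AE_eta_D[OF K] by simp
  then have aeN: "AE \<omega> in M. xb \<omega> \<in> pathX T \<and> total_variation (xb \<omega>) \<le> ereal C \<and> (\<forall>t. norm (xb \<omega> t) \<le> K + C)"
    using C(2,3) supp AE_space
  proof eventually_elim
    case (elim \<omega>)
    \<comment> \<open>The essential bound \<open>K\<close> holds for almost every time of a nonzero
      measure, hence at some time; the variation bound then carries it to all times.\<close>
    have "\<exists>t. norm (xb \<omega> t) \<le> K"
    proof (rule ccontr)
      assume "\<nexists>t. norm (xb \<omega> t) \<le> K"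
      then have "AE t in \<mu> \<omega>. False" using elim(1) by auto
      then have "emeasure (\<mu> \<omega>) (space (\<mu> \<omega>)) = 0" by (auto elim!: AE_E intro: emeasure_eq_0)
      then show False using elim(4,5) by (simp add: space_mu)
    qed
    then obtain s where s: "norm (xb \<omega> s) \<le> K" by blast
    have "norm (xb \<omega> t) \<le> K + C" for t
      using norm_diff_le_total_variation[OF elim(3), of t s] s norm_triangle_sub[of "xb \<omega> t" "xb \<omega> s"] by linarith
    then show ?case using elim by blast
  qed
  obtain N where N: "N \<in> null_sets M" "\<And>\<omega>. \<omega> \<in> space M - N \<Longrightarrow> xb \<omega> \<in> pathX T"
    using AE_E3[OF C(2)] by blast
  \<comment> \<open>Setting bad paths to 0 makes every path left continuous, hence the process
    predictable; completeness of the filtration keeps it adapted.\<close>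
  define x where "x \<omega> t = (if \<omega> \<in> space M - N then xb \<omega> t else 0)" for \<omega> t
  have ae: "AE \<omega> in M. x \<omega> = xb \<omega>"
    using AE_not_in[OF N(1)] AE_space by eventually_elim (auto simp: x_def)
  have ad: "adapted_on M F {0..} x"
    unfolding adapted_on_def
  proof
    fix t :: real assume t: "t \<in> {0..}"
    have "(\<lambda>\<omega>. xb \<omega> t) \<in> borel_measurable (Fmeas M (F t))"
      using C(1) t by (simp add: adapted_on_def)
    moreover have "AE \<omega> in M. x \<omega> t = xb \<omega> t" using ae by eventually_elim simp
    moreover have "0 \<le> t" using t by simp
    ultimately show "(\<lambda>\<omega>. x \<omega> t) \<in> borel_measurable (Fmeas M (F t))"
      by (rule AE_eq_measurable_Fmeas)
  qed
  show ?thesis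
  proof (rule that)
    show "x \<in> bdd_Ninf M F T"
    proof (rule bdd_NinfI[OF ad])
      show "AE \<omega> in M. x \<omega> \<in> pathX T" using ae aeN by eventually_elim simp
      show "AE \<omega> in M. total_variation (x \<omega>) \<le> ereal C" using ae aeN by eventually_elim simp
      show "AE \<omega> in M. \<forall>t. norm (x \<omega> t) \<le> K + C" using ae aeN by eventually_elim simp
    qed
    have "continuous (at_left t) (x \<omega>)" for \<omega> t
      using pathXD(1)[of "xb \<omega>" T t] N(2)[of \<omega>] by (cases "\<omega> \<in> space M - N") (auto simp: x_def[abs_def])
    then show xm: "(\<lambda>p. x (fst p) (snd p)) \<in> borel_measurable Pred"
      using ad by (intro left_continuous_measurable_Pred) (auto simp: adapted_on_def)
    have "AE p in \<eta>. x (fst p) (snd p) = xb (fst p) (snd p)"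
      by (rule AE_eta_I[OF _ atomless]) (use ae in \<open>eventually_elim, simp\<close>)
    then show "(\<lambda>p. x (fst p) (snd p)) \<in> Linf_int \<eta> dom"
      by (rule Linf_int_cong_AE[OF xi measurable_Pred_eta[OF xm]])
  qed
qed

text \<open>Interiority survives the pasting because each piece has its own room: \<delta> around
  \<open>c\<close> almost everywhere on \<open>V\<close>, and the radius of \<open>x\<close> off
  \<open>V\<close>.\<close>

lemma constant_on_exit_good:
  assumes x: "x \<in> bdd_Ninf M F T" "(\<lambda>p. x (fst p) (snd p)) \<in> borel_measurable Pred"
    "(\<lambda>p. x (fst p) (snd p)) \<in> Linf_int \<eta> dom"
    and "0 < \<delta>" and q: "0 \<le> q" "q \<le> T"
  shows "\<exists>z\<in>good. AE \<omega> in M. \<forall>t\<in>{q<..T}. (\<forall>s\<in>{q<..t}. (\<omega>, s) \<in> orthant_set c \<delta>) \<longrightarrow> z \<omega> t = c"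
proof -
  obtain V where V: "V \<in> bv_sets" "V - orthant_set c \<delta> \<in> null_sets \<eta>"
    "AE \<omega> in M. \<forall>t\<in>{q<..T}. (\<forall>s\<in>{q<..t}. (\<omega>, s) \<in> orthant_set c \<delta>) \<longrightarrow> (\<omega>, t) \<in> V"
    by (rule bv_sets_exit[OF opt atomless orthant_set_predictable q])
  have VU: "AE p in \<eta>. p \<in> V \<longrightarrow> cball c \<delta> \<subseteq> dom p"
    using AE_not_in[OF V(2)] by eventually_elim (use orthant_set_cball in blast)
  obtain z where z: "z \<in> bdd_Ninf M F T"
    and z_eq: "\<And>\<omega> t. \<omega> \<in> space M \<Longrightarrow> t \<in> {0..T} \<Longrightarrow> z \<omega> t = (if (\<omega>, t) \<in> V then c else x \<omega> t)"
    using bv_sets_paste[OF V(1) bdd_Ninf_const[of c] x(1)] by blast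
  have Vp: "V \<in> sets Pred" using V(1) by (simp add: bv_sets_def sets_Pred)
  have eq: "z (fst p) (snd p) = (if p \<in> V then c else x (fst p) (snd p))" if "p \<in> space M \<times> {0..T}" for p
    using z_eq[of "fst p" "snd p"] that by auto
  have "(\<lambda>p. if p \<in> V then c else x (fst p) (snd p)) \<in> borel_measurable Pred"
    using x(2) Vp by (intro measurable_If_set) auto
  then have zm: "(\<lambda>p. z (fst p) (snd p)) \<in> borel_measurable Pred"
    by (rule measurable_cong[THEN iffD2, rotated]) (simp add: eq space_Pred)
  obtain K :: real where K: "AE p in \<eta>. norm (x (fst p) (snd p)) \<le> K"
    using Linf_intD(1)[OF x(3)] by (auto simp: Linf_iff)
  obtain r where r: "0 < r" "\<forall>y\<in>borel_measurable \<eta>.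
      (AE p in \<eta>. norm (y p - x (fst p) (snd p)) \<le> r) \<longrightarrow> (AE p in \<eta>. y p \<in> dom p)"
    using Linf_intD(2)[OF x(3)] by blast
  have "(\<lambda>p. z (fst p) (snd p)) \<in> Linf_int \<eta> dom"
  proof (rule Linf_intI[of _ _ "min r \<delta>"])
    have "AE p in \<eta>. norm (z (fst p) (snd p)) \<le> max K (norm c)"
      using K AE_space by eventually_elim (auto simp: eq space_eta)
    then show "(\<lambda>p. z (fst p) (snd p)) \<in> Linf \<eta>"
      using measurable_Pred_eta[OF zm] unfolding Linf_iff by blast
    fix y assume y: "y \<in> borel_measurable \<eta>" "AE p in \<eta>. norm (y p - z (fst p) (snd p)) \<le> min r \<delta>"
    \<comment> \<open>The radius \<open>r\<close> concerns perturbations of \<open>x\<close> on the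
      whole space, so the test function \<open>y\<close> is overwritten by \<open>x\<close> on
      \<open>V\<close>, where it may be far from \<open>x\<close>.\<close>
    let ?y = "\<lambda>p. if p \<in> V then x (fst p) (snd p) else y p"
    have "?y \<in> borel_measurable \<eta>"
      using measurable_Pred_eta[OF x(2)] y(1) V(1) predictable_sets_eta
      by (intro measurable_If_set) (auto simp: bv_sets_def)
    moreover have "AE p in \<eta>. norm (?y p - x (fst p) (snd p)) \<le> r"
      using y(2) AE_space by eventually_elim (use r(1) in \<open>auto simp: eq space_eta\<close>)
    ultimately have "AE p in \<eta>. ?y p \<in> dom p" by (rule r(2)[rule_format])
    then show "AE p in \<eta>. y p \<in> dom p"
      using y(2) VU AE_space
    proof eventually_elim
      case (elim p)
      show ?case
      proof (cases "p \<in> V")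
        case True
        then have "y p \<in> cball c \<delta>"
          using elim(2,4) by (simp add: eq space_eta dist_norm norm_minus_commute)
        then show ?thesis using elim(3) True by blast
      qed (use elim(1) in simp)
    qed
  qed (use r(1) \<open>0 < \<delta>\<close> in simp)
  then have "z \<in> good" by (rule Linf_int_good[OF z zm])
  moreover have "AE \<omega> in M. \<forall>t\<in>{q<..T}. (\<forall>s\<in>{q<..t}. (\<omega>, s) \<in> orthant_set c \<delta>) \<longrightarrow> z \<omega> t = c"
    using V(3) AE_space by eventually_elim (use q z_eq in auto)
  ultimately show ?thesis by blast
qed

theorem interchange:
  assumes isc: "AE \<omega> in M. left_isc T (\<lambda>t. dom_h (h \<omega> t))"
    and supp: "AE \<omega> in M. 0 < emeasure (\<mu> \<omega>) {0..T}"
    and xb: "xb \<in> Ninf M F T" "(\<lambda>p. xb (fst p) (snd p)) \<in> Linf_int \<eta> dom"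
  shows "(INF x\<in>Ninf M F T. Eint M \<mu> T (\<lambda>\<omega> t. h \<omega> t (x \<omega> t))) = Eint M \<mu> T (\<lambda>\<omega> t. INF y. h \<omega> t y)"
proof -
  obtain x where x: "x \<in> bdd_Ninf M F T" "(\<lambda>p. x (fst p) (snd p)) \<in> borel_measurable Pred"
    "(\<lambda>p. x (fst p) (snd p)) \<in> Linf_int \<eta> dom"
    by (rule left_continuous_modification[OF xb supp])
  obtain r \<beta> where r: "0 < r"
    and \<beta>: "AE p in \<eta>. \<forall>x'\<in>cball 0 r. h (fst p) (snd p) (x (fst p) (snd p) + x') \<le> ereal (\<beta> p)"
    using local_bound[OF x(3)] by blast
  obtain E :: "'d set" where E: "countable E" "\<And>X. open X \<Longrightarrow> X \<noteq> {} \<Longrightarrow> \<exists>d\<in>E. d \<in> X"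
    using countable_dense_setE by blast
  \<comment> \<open>A process is indexed by the constant that it takes, the margin
    \<open>1 / Suc n\<close> in the orthant conditions, and the rational time after which the
    constant is used.\<close>
  let ?I = "E \<times> (UNIV :: nat set) \<times> (\<rat> \<inter> {0..T})"
  have cI: "countable ?I" using E(1) countable_rat by (intro countable_SIGMA) auto
  have "E \<noteq> {}" using E(2)[of UNIV] by auto
  then have I0: "?I \<noteq> {}" using T_pos by auto
  let ?Q = "\<lambda>i z. z \<in> good \<and> (case i of (c, n, q) \<Rightarrow> AE \<omega> in M. \<forall>t\<in>{q<..T}.
      (\<forall>s\<in>{q<..t}. (\<omega>, s) \<in> orthant_set c (1 / real (Suc n))) \<longrightarrow> z \<omega> t = c)"
  have "\<forall>i\<in>?I. \<exists>z. ?Q i z"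
  proof
    fix i assume "i \<in> ?I"
    then obtain c n q where i: "i = (c, n, q)" "0 \<le> q" "q \<le> T" by auto
    from constant_on_exit_good[OF x _ i(2,3), of "1 / real (Suc n)" c] show "\<exists>z. ?Q i z"
      by (auto simp: i(1))
  qed
  from bchoice[OF this] obtain Z where Z: "\<forall>i\<in>?I. ?Q i (Z i)" ..
  define xs where "xs n = Z (from_nat_into ?I n)" for n
  show ?thesis
  proof (rule interchange_sequence)
    show "xs n \<in> good" for n
      unfolding xs_def by (rule bspec[OF Z from_nat_into[OF I0], THEN conjunct1])
    have "AE \<omega> in M. \<forall>i\<in>?I. case i of (c, n, q) \<Rightarrow> \<forall>t\<in>{q<..T}.
      (\<forall>s\<in>{q<..t}. (\<omega>, s) \<in> orthant_set c (1 / real (Suc n))) \<longrightarrow> Z i \<omega> t = c"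
      unfolding AE_ball_countable[OF cI] using Z by fastforce
    then have "AE \<omega> in M. \<forall>t\<in>{0<..T}. 0 < t \<and> left_isc T (\<lambda>t. dom_h (h \<omega> t)) \<and>
       (\<forall>i\<in>?I. case i of (c, n, q) \<Rightarrow> q < t \<longrightarrow>
         (\<forall>s\<in>{q<..t}. (\<omega>, s) \<in> orthant_set c (1 / real (Suc n))) \<longrightarrow> Z i \<omega> t = c)"
      using isc by eventually_elim fastforce
    then have "AE p in \<eta>. 0 < snd p \<and> left_isc T (\<lambda>t. dom_h (h (fst p) t)) \<and>
       (\<forall>i\<in>?I. case i of (c, n, q) \<Rightarrow> q < snd p \<longrightarrow>
         (\<forall>s\<in>{q<..snd p}. (fst p, s) \<in> orthant_set c (1 / real (Suc n))) \<longrightarrow> Z i (fst p) (snd p) = c)"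
      by (intro AE_eta_I[OF _ atomless]) simp
    then show "AE p in \<eta>. \<forall>a. (INF y. h (fst p) (snd p) y) < a \<longrightarrow> (\<exists>n. h (fst p) (snd p) (xs n (fst p) (snd p)) < a)"
      using \<beta> AE_space
    proof (eventually_elim, intro allI impI)
      fix p a
      assume p0: "0 < snd p \<and> left_isc T (\<lambda>t. dom_h (h (fst p) t)) \<and>
       (\<forall>i\<in>?I. case i of (c, n, q) \<Rightarrow> q < snd p \<longrightarrow>
         (\<forall>s\<in>{q<..snd p}. (fst p, s) \<in> orthant_set c (1 / real (Suc n))) \<longrightarrow> Z i (fst p) (snd p) = c)"
        and b: "\<forall>x'\<in>cball 0 r. h (fst p) (snd p) (x (fst p) (snd p) + x') \<le> ereal (\<beta> p)"
        and p: "p \<in> space \<eta>" and a: "(INF y. h (fst p) (snd p) y) < a"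
      let ?f = "h (fst p) (snd p)"
      obtain y where y: "?f y < a" using a by (auto simp: INF_less_iff)
      have pp: "p \<in> space M \<times> {0..T}" using p by (simp add: space_eta)
      \<comment> \<open>The local bound for \<open>x\<close> supplies the ball from which the
        near-minimiser \<open>y\<close> is moved into the interior, at a point of the dense
        set.\<close>
      obtain c \<rho> where c: "c \<in> E" "0 < \<rho>" "ball c \<rho> \<subseteq> dom p" "?f c < a"
        using convex_approx_infimum_interior[OF convex_epi[OF pp] r _ y E(2)] b by blast
      \<comment> \<open>The factor \<open>2 * DIM('d)\<close> is the one in
        \<open>ball_subset_imp_meets_orthants\<close>: the ball must reach beyond the margin along
        all axes at once.\<close>
      obtain n where n: "1 / real (Suc n) < \<rho> / (2 * DIM('d))"
        using nat_approx_posE[of "\<rho> / (2 * DIM('d))"] c(2) by auto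
      let ?d = "1 / real (Suc n)"
      have "2 * ?d * DIM('d) < \<rho>" using n by (simp add: field_simps)
      then have "p \<in> orthant_set c ?d"
        using ball_subset_imp_meets_orthants[OF c(3), of ?d] pp by (auto simp: orthant_set_def)
      then obtain u where u: "u < snd p" "\<And>s. s \<in> {u<..snd p} \<inter> {0..T} \<Longrightarrow> (fst p, s) \<in> orthant_set c ?d"
        using orthant_set_left_open[of "fst p" "snd p" c ?d] p0 by auto
      \<comment> \<open>Staying above \<open>u\<close> keeps all of (q, t] in the orthant set, and
        staying above 0 makes \<open>q\<close> an admissible index.\<close>
      obtain q where q: "q \<in> \<rat>" "max u 0 < q" "q < snd p"
        using Rats_dense_in_real[of "max u 0" "snd p"] u(1) p0 by auto
      have tT: "snd p \<le> T" using pp by auto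
      have i: "(c, n, q) \<in> ?I" using c(1) q tT by auto
      have "\<forall>s\<in>{q<..snd p}. (fst p, s) \<in> orthant_set c ?d"
        using q(2) tT by (intro ballI u(2)) auto
      then have "Z (c, n, q) (fst p) (snd p) = c" using p0 i q(3) by blast
      moreover obtain k where "from_nat_into ?I k = (c, n, q)"
        using from_nat_into_surj[OF cI i] by blast
      ultimately show "\<exists>n. ?f (xs n (fst p) (snd p)) < a"
        using c(4) by (intro exI[of _ k]) (simp add: xs_def)
    qed
  qed
qed

end

theorem theorem4:
  fixes M :: "'a measure" and F :: "real \<Rightarrow> 'a set set" and T :: real
    and \<mu> :: "'a \<Rightarrow> real measure"
    and h :: "'a \<Rightarrow> real \<Rightarrow> real ^ 'd \<Rightarrow> ereal"
    and v :: "'a \<times> real \<Rightarrow> real ^ 'd" and \<alpha> :: "'a \<times> real \<Rightarrow> real"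
  assumes T_pos: "T > 0"
    and prob: "prob_space M"
    and filt: "usual_filtration M F"
    and mu_radon: "random_radon_measure M T \<mu>"
    and mu_atomless: "AE \<omega> in M. \<forall>t. emeasure (\<mu> \<omega>) {t} = 0"
    and mu_support: "AE \<omega> in M. \<forall>U. open U \<and> U \<inter> {0..T} \<noteq> {} \<longrightarrow> emeasure (\<mu> \<omega>) (U \<inter> {0..T}) > 0"
    and mu_optional: "optional_measure M F T \<mu>"
    and h_normal: "predictable_convex_normal_integrand M F T h"
    and v_int: "integrable (eta M \<mu> T) v"
    and alpha_int: "integrable (eta M \<mu> T) \<alpha>"
    and alpha_nonneg: "\<forall>p. 0 \<le> \<alpha> p"
    and h_lower: "\<forall>\<omega>\<in>space M. \<forall>t\<in>{0..T}. \<forall>x. ereal (x \<bullet> v (\<omega>, t) - \<alpha> (\<omega>, t)) \<le> h \<omega> t x"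
    and pathwise: "AE \<omega> in M.
         left_isc T (\<lambda>t. dom_h (h \<omega> t))
       \<and> (\<forall>x\<in>pathX T.
            (x \<in> Linf_int (\<mu> \<omega>) (\<lambda>t. dom_h (h \<omega> t))
               \<longrightarrow> int_conv (\<mu> \<omega>) (\<lambda>t. h \<omega> t (x t)) < \<infinity>)
          \<and> (int_conv (\<mu> \<omega>) (\<lambda>t. h \<omega> t (x t)) < \<infinity>
               \<longrightarrow> (\<forall>t\<in>{0..T}. x t \<in> closure (dom_h (h \<omega> t)))))
       \<and> (\<forall>x\<in>pathX T. int_conv (\<mu> \<omega>) (\<lambda>t. h \<omega> t (x t)) > - \<infinity>)
       \<and> (\<exists>x\<in>pathX T. int_conv (\<mu> \<omega>) (\<lambda>t. h \<omega> t (x t)) < \<infinity>)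
       \<and> pathX T \<inter> Linf_int (\<mu> \<omega>) (\<lambda>t. dom_h (h \<omega> t)) \<noteq> {}"
    and xbar: "\<exists>xb\<in>Ninf M F T.
         (\<lambda>p. xb (fst p) (snd p)) \<in> Linf_int (eta M \<mu> T) (\<lambda>p. dom_h (h (fst p) (snd p)))"
    and local_bound: "\<forall>x\<in>Linf_int (eta M \<mu> T) (\<lambda>p. dom_h (h (fst p) (snd p))).
         \<exists>r>0. \<exists>\<beta>::'a \<times> real \<Rightarrow> real. integrable (eta M \<mu> T) \<beta> \<and>
           (AE p in eta M \<mu> T. \<forall>x'\<in>cball 0 r. h (fst p) (snd p) (x p + x') \<le> ereal (\<beta> p))"
  shows "(INF x\<in>Ninf M F T. Eint M \<mu> T (\<lambda>\<omega> t. h \<omega> t (x \<omega> t)))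
       = Eint M \<mu> T (\<lambda>\<omega> t. INF y. h \<omega> t y)"
proof -
  interpret interchange M F T \<mu> h v \<alpha>
  proof -
    interpret prob_space M by (rule prob)
    show "interchange M F T \<mu> h v \<alpha>"
    proof
      show "usual_filtration M F" "0 < T" "random_radon_measure M T \<mu>"
        "predictable_convex_normal_integrand M F T h" "optional_measure M F T \<mu>"
        "AE \<omega> in M. \<forall>t. emeasure (\<mu> \<omega>) {t} = 0" "integrable (eta M \<mu> T) v" "integrable (eta M \<mu> T) \<alpha>"
        by fact+
    qed (use h_lower local_bound in blast)+
  qed
  from xbar obtain xb where xb: "xb \<in> Ninf M F T"
    "(\<lambda>p. xb (fst p) (snd p)) \<in> Linf_int (eta M \<mu> T) (\<lambda>p. dom_h (h (fst p) (snd p)))" ..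
  have "AE \<omega> in M. left_isc T (\<lambda>t. dom_h (h \<omega> t))"
    using pathwise by (rule eventually_mono) (rule conjunct1)
  moreover have "AE \<omega> in M. 0 < emeasure (\<mu> \<omega>) {0..T}"
    using mu_support
  proof eventually_elim
    case (elim \<omega>)
    from elim[rule_format, of UNIV] T_pos show ?case by simp
  qed
  ultimately show ?thesis using xb by (rule interchange)
qed

end
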